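(* Let $T>0$, $\alpha\in(0,1)$, and let $f\colon[0,T]\times\mathbb{R}\to\mathbb{R}$ be continuously differentiable and such that there exists $\gamma\ge 0$ with $|f(\tau,x)|\le\gamma(1+|x|)$ for all $\tau\in[0,T]$, $x\in\mathbb{R}$. For $(t,w(\cdot))\in G$, let $x(\cdot\mid t,w(\cdot))$ be the unique solution of the Cauchy problem $$({}^CD^\alpha_{0+}x)(\tau)=f(\tau,x(\tau)),\ \tau\in[t,T],\qquad x(\tau)=w(\tau),\ \tau\in[0,t],$$ and define $\rho\colon G\to\mathbb{R}$ by $\rho(t,w(\cdot))=x(T\mid t,w(\cdot))$. Then the functional $\rho$ is $ci$-differentiable of order $\alpha$ at every point $(t,w(\cdot))\in G$, and the corresponding derivatives are given by $$\partial_t^\alpha\rho(t,w(\cdot))=p(T),\qquad \nabla^\alpha\rho(t,w(\cdot))=q(T),$$ where $p(\cdot)=p(\cdot\mid t,w(\cdot))$ and $q(\cdot)=q(\cdot\mid t,w(\cdot))$ are the unique solutions in $\mathrm{C}^{1-\alpha}(t,T]$ of the integral equations $$p(\tau)=\overline p(\tau)+\frac1{\Gamma(\alpha)}\int_t^\tau\frac{a(\xi)p(\xi)+b(\xi)}{(\tau-\xi)^{1-\alpha}}\,d\xi,\quad \tau\in(t,T],$$ $$q(\tau)=\overline q(\tau)+\frac1{\Gamma(\alpha)}\int_t^\tau\frac{a(\xi)q(\xi)}{(\tau-\xi)^{1-\alpha}}\,d\xi,\quad \tau\in(t,T],$$ respectively. Here, with $x(\cdot)=x(\cdot\mid t,w(\cdot))$,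 $$\overline p(\tau)=-\frac{1-\alpha}{\Gamma(\alpha)}\Bigl(\frac{T-\tau}{T-t}\Bigr)\int_0^t\frac{({}^CD^\alpha_{0+}w)(\xi)}{(\tau-\xi)^{2-\alpha}}\,d\xi,\qquad \overline q(\tau)=\frac1{\Gamma(\alpha)(\tau-t)^{1-\alpha}},\qquad \tau\in(t,T],$$ $$a(\tau)=\frac{\partial f}{\partial x}(\tau,x(\tau)),\qquad b(\tau)=\Bigl(\frac{T-\tau}{T-t}\Bigr)\frac{\partial f}{\partial\tau}(\tau,x(\tau))-\frac{\alpha f(\tau,x(\tau))}{T-t},\qquad \tau\in[t,T].$$
   Context: Space $\mathrm{AC}^\alpha$: for $t\in[0,T]$, $\mathrm{AC}^\alpha[0,t]$ is the set of all functions $x\colon[0,t]\to\mathbb{R}$ that can be represented as $x(\tau)=x(0)+\frac1{\Gamma(\alpha)}\int_0^\tau\frac{\ell(\xi)}{(\tau-\xi)^{1-\alpha}}\,d\xi$, $\tau\in[0,t]$, for some Lebesgue measurable and essentially bounded $\ell\colon[0,T]\to\mathbb{R}$ ($\Gamma$ is the gamma-function). Every $x(\cdot)\in\mathrm{AC}^\alpha[0,t]$ is continuous and has at a.e. $\tau\in[0,t]$ a Caputo derivative of order $\alpha$, $({}^CD^\alpha_{0+}x)(\tau)=\frac1{\Gamma(1-\alpha)}\frac{d}{d\tau}\int_0^\tau\frac{x(\xi)-x(0)}{(\tau-\xi)^\alpha}\,d\xi$, and it equals $\ell(\tau)$ for a.e. $\tau\in[0,t]$. Initial data: $G=\bigcup_{t\in[0,T)}\bigl(\{t\}\times\mathrm{AC}^\alpha[0,t]\bigr)$.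 Solution of the Cauchy problem for $(t,w(\cdot))\in G$: a function $x(\cdot)\in\mathrm{AC}^\alpha[0,T]$ with $x(\tau)=w(\tau)$ for all $\tau\in[0,t]$ and $({}^CD^\alpha_{0+}x)(\tau)=f(\tau,x(\tau))$ for a.e. $\tau\in[t,T]$. Under the stated assumptions on $f$ such a solution exists and is unique (known). $\frac{\partial f}{\partial\tau}$ and $\frac{\partial f}{\partial x}$ are the partial derivatives of $f$; at $\tau=0$ or $\tau=T$, $\frac{\partial f}{\partial\tau}$ is the corresponding one-sided derivative. $\mathrm{C}^{1-\alpha}(t,T]$ is the space of all continuous functions $p\colon(t,T]\to\mathbb{R}$ such that $(t,T]\ni\tau\mapsto(\tau-t)^{1-\alpha}p(\tau)$ is bounded. A solution of either integral equation is a function in $\mathrm{C}^{1-\alpha}(t,T]$ satisfying it for every $\tau\in(t,T]$. $ci$-differentiability of order $\alpha$: for $(t,w(\cdot))\in G$ put $\Lambda(t,w(\cdot))=\{\lambda(\cdot)\in\mathrm{AC}^\alpha[0,T]\colon\lambda_t(\cdot)=w(\cdot)\}$, where $\lambda_t(\cdot)$ denotes the restriction of $\lambda(\cdot)$ to $[0,t]$. A functional $\varphi\colon G\to\mathbb{R}$ is $ci$-differentiable of order $\alpha$ at $(t,w(\cdot))$ if there are $\partial_t^\alpha\varphi(t,w(\cdot)),\nabla^\alpha\varphi(t,w(\cdot))\in\mathbb{R}$ such that for every $\lambda(\cdot)\in\Lambda(t,w(\cdot))$ and every $\tau\in(t,T)$ $$\varphi(\tau,\lambda_\tau(\cdot))-\varphi(t,w(\cdot))=\partial_t^\alpha\varphi(t,w(\cdot))(\tau-t)+\nabla^\alpha\varphi(t,w(\cdot))\int_t^\tau({}^CD^\alpha_{0+}\lambda)(\xi)\,d\xi+o(\tau-t),$$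 where $o\colon(0,\infty)\to\mathbb{R}$ may depend on $t$ and $\lambda(\cdot)$ and satisfies $o(\delta)/\delta\to0$ as $\delta\to0^+$. These two numbers are then called the $ci$-derivatives of order $\alpha$ of $\varphi$ at $(t,w(\cdot))$. *)

theory Defs
  imports "HOL-Analysis.Analysis"
begin

text \<open>
  A real function on a set \<open>S\<close> is an element of \<open>extensional S\<close>, so that equality of such functions,
  and hence uniqueness of solutions, refers to the values on \<open>S\<close> only.
\<close>

definition AC :: "real \<Rightarrow> real \<Rightarrow> real \<Rightarrow> (real \<Rightarrow> real) set" where
  "AC \<alpha> T t = {x \<in> extensional {0..t}.
     \<exists>l. l \<in> borel_measurable (lebesgue_on {0..T}) \<and>
         (\<exists>C. AE \<xi> in lebesgue_on {0..T}. \<bar>l \<xi>\<bar> \<le> C) \<and>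
         (\<forall>\<tau>\<in>{0..t}. x \<tau> = x 0 + 1 / Gamma \<alpha> *
            (LINT \<xi>:{0..\<tau>}|lebesgue. l \<xi> / (\<tau> - \<xi>) powr (1 - \<alpha>)))}"

text \<open>
  For \<open>x \<in> AC \<alpha> T t\<close> the derivative below exists for almost every \<open>\<tau> \<in> {0..t}\<close>; the
  unspecified value of \<open>deriv\<close> on the exceptional null set is never relevant.
\<close>

definition caputo_deriv :: "real \<Rightarrow> (real \<Rightarrow> real) \<Rightarrow> real \<Rightarrow> real" where
  "caputo_deriv \<alpha> x \<tau> = 1 / Gamma (1 - \<alpha>) *
     deriv (\<lambda>s. LINT \<xi>:{0..s}|lebesgue. (x \<xi> - x 0) / (s - \<xi>) powr \<alpha>) \<tau>"

definition initial_data :: "real \<Rightarrow> real \<Rightarrow> (real \<times> (real \<Rightarrow> real)) set" where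
  "initial_data \<alpha> T = (SIGMA t:{0..<T}. AC \<alpha> T t)"

definition cauchy_solution ::
    "real \<Rightarrow> real \<Rightarrow> (real \<Rightarrow> real \<Rightarrow> real) \<Rightarrow> real \<Rightarrow> (real \<Rightarrow> real) \<Rightarrow> (real \<Rightarrow> real) \<Rightarrow> bool" where
  "cauchy_solution \<alpha> T f t w x \<longleftrightarrow>
     x \<in> AC \<alpha> T T \<and> (\<forall>\<tau>\<in>{0..t}. x \<tau> = w \<tau>) \<and>
     (AE \<tau> in lebesgue_on {t..T}. caputo_deriv \<alpha> x \<tau> = f \<tau> (x \<tau>))"

definition the_solution ::
    "real \<Rightarrow> real \<Rightarrow> (real \<Rightarrow> real \<Rightarrow> real) \<Rightarrow> real \<Rightarrow> (real \<Rightarrow> real) \<Rightarrow> real \<Rightarrow> real" where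
  "the_solution \<alpha> T f t w = (THE x. cauchy_solution \<alpha> T f t w x)"

definition rho ::
    "real \<Rightarrow> real \<Rightarrow> (real \<Rightarrow> real \<Rightarrow> real) \<Rightarrow> real \<times> (real \<Rightarrow> real) \<Rightarrow> real" where
  "rho \<alpha> T f = (\<lambda>(t, w). the_solution \<alpha> T f t w T)"

definition extensions :: "real \<Rightarrow> real \<Rightarrow> real \<Rightarrow> (real \<Rightarrow> real) \<Rightarrow> (real \<Rightarrow> real) set" where
  "extensions \<alpha> T t w = {y \<in> AC \<alpha> T T. restrict y {0..t} = w}"

definition has_ci_derivatives ::
    "real \<Rightarrow> real \<Rightarrow> (real \<times> (real \<Rightarrow> real) \<Rightarrow> real) \<Rightarrow> real \<Rightarrow> (real \<Rightarrow> real) \<Rightarrow>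
     real \<Rightarrow> real \<Rightarrow> bool" where
  "has_ci_derivatives \<alpha> T \<phi> t w dt grad \<longleftrightarrow>
     (\<forall>y\<in>extensions \<alpha> T t w. \<exists>r :: real \<Rightarrow> real.
        ((\<lambda>\<delta>. r \<delta> / \<delta>) \<longlongrightarrow> 0) (at_right 0) \<and>
        (\<forall>\<tau>\<in>{t<..<T}.
           \<phi> (\<tau>, restrict y {0..\<tau>}) - \<phi> (t, w) =
             dt * (\<tau> - t) + grad * (LINT \<xi>:{t..\<tau>}|lebesgue. caputo_deriv \<alpha> y \<xi>) + r (\<tau> - t)))"

definition ci_differentiable ::
    "real \<Rightarrow> real \<Rightarrow> (real \<times> (real \<Rightarrow> real) \<Rightarrow> real) \<Rightarrow> real \<Rightarrow> (real \<Rightarrow> real) \<Rightarrow> bool" where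
  "ci_differentiable \<alpha> T \<phi> t w \<longleftrightarrow> (\<exists>dt grad. has_ci_derivatives \<alpha> T \<phi> t w dt grad)"

definition C_weighted :: "real \<Rightarrow> real \<Rightarrow> real \<Rightarrow> (real \<Rightarrow> real) set" where
  "C_weighted \<alpha> t T = {p \<in> extensional {t<..T}.
     continuous_on {t<..T} p \<and> bounded ((\<lambda>\<tau>. (\<tau> - t) powr (1 - \<alpha>) * p \<tau>) ` {t<..T})}"

text \<open>The equation \<open>p = g + I\<^sup>\<alpha> h(\<cdot>, p)\<close> on \<open>{t<..T}\<close>, where \<open>I\<^sup>\<alpha>\<close> is the Riemann-Liouville
  integral of order \<open>\<alpha>\<close> with base point \<open>t\<close>.\<close>

definition integral_eq_solution ::
    "real \<Rightarrow> real \<Rightarrow> real \<Rightarrow> (real \<Rightarrow> real) \<Rightarrow> (real \<Rightarrow> real \<Rightarrow> real) \<Rightarrow> (real \<Rightarrow> real) \<Rightarrow> bool" where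
  "integral_eq_solution \<alpha> t T g h p \<longleftrightarrow>
     p \<in> C_weighted \<alpha> t T \<and>
     (\<forall>\<tau>\<in>{t<..T}. p \<tau> = g \<tau> + 1 / Gamma \<alpha> *
        (LINT \<xi>:{t<..\<tau>}|lebesgue. h \<xi> (p \<xi>) / (\<tau> - \<xi>) powr (1 - \<alpha>)))"

text \<open>
  For \<open>T > 0\<close> this determines \<open>ft\<close> and \<open>fx\<close> on \<open>{0..T} \<times> UNIV\<close>; \<open>at \<tau> within {0..T}\<close> yields the one-sided derivatives at \<open>\<tau> = 0\<close> and \<open>\<tau> = T\<close>.
\<close>

definition C1_with_partials ::
    "real \<Rightarrow> (real \<Rightarrow> real \<Rightarrow> real) \<Rightarrow> (real \<Rightarrow> real \<Rightarrow> real) \<Rightarrow> (real \<Rightarrow> real \<Rightarrow> real) \<Rightarrow> bool" where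
  "C1_with_partials T f ft fx \<longleftrightarrow>
     (\<forall>\<tau>\<in>{0..T}. \<forall>x. ((\<lambda>s. f s x) has_real_derivative ft \<tau> x) (at \<tau> within {0..T})) \<and>
     (\<forall>\<tau>\<in>{0..T}. \<forall>x. (f \<tau> has_real_derivative fx \<tau> x) (at x)) \<and>
     continuous_on ({0..T} \<times> UNIV) (\<lambda>(\<tau>, x). ft \<tau> x) \<and>
     continuous_on ({0..T} \<times> UNIV) (\<lambda>(\<tau>, x). fx \<tau> x)"

end

theory Submission
  imports Defs
begin

text \<open>Write \<open>X\<^sub>s\<close> for the solution that starts at time \<open>s\<close> from an extension \<open>y\<close> of \<open>w\<close>, and \<open>l\<close> for the
  Caputo derivative of \<open>y\<close>.  By definition \<open>\<rho>(s, y) = X\<^sub>s(T)\<close>, so the claim is a first order expansion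
  of \<open>X\<^sub>s(T) - X\<^sub>t(T)\<close> in \<open>s - t\<close>.  Every function in \<open>AC\<^sup>\<alpha>\<close> is a constant plus the Riemann-Liouville
  integral of its Caputo derivative (\<open>caputo_deriv_AE\<close>); hence \<open>X\<^sub>s\<close> solves on \<open>(s, T]\<close> a Volterra
  equation whose forcing term is the memory of the density \<open>l\<close> on \<open>[0, s]\<close>
  (\<open>the_solution_integral_equation\<close>).

  The derivative of a solution is singular at its starting time, so \<open>X\<^sub>s\<close> and \<open>X\<^sub>t\<close> are not compared at
  the same instant.  The affine map \<open>\<psi>\<^sub>s\<close> takes \<open>[t, T]\<close> onto \<open>[s, T]\<close> and fixes \<open>T\<close>; it turns both
  equations into Volterra equations on the same interval, and the quotient
  \<open>(X\<^sub>s(\<psi>\<^sub>s(\<tau>)) - X\<^sub>t(\<tau>)) / (s - t)\<close>, which at \<open>\<tau> = T\<close> is the quotient of \<open>\<rho>\<close>, satisfies an equation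
  of the form \<open>u = g + I\<^sup>\<alpha> h\<close> (\<open>sol_quot_eq\<close>).  The formal limit of that equation is linear.  Its forcing
  term consists of the derivative of the old memory along \<open>\<psi>\<close>, which gives \<open>p\<close>, and of the kernel
  \<open>(\<tau> - t)\<^bsup>\<alpha>-1\<^esup>/\<Gamma>(\<alpha>)\<close> times the mean of \<open>l\<close> over \<open>[t, s]\<close>, which gives \<open>q\<close>.  The factor
  \<open>(T - \<tau>)/(T - t)\<close> in the data of \<open>p\<close> is the speed \<open>\<partial>\<psi>\<^sub>s(\<tau>)/\<partial>s\<close>, and the term
  \<open>-\<alpha> f/(T - t)\<close> comes from the scaling factor of the kernel under \<open>\<psi>\<^sub>s\<close>.

  The convergence rests on one principle: \<open>I\<^sup>\<alpha>\<close> shrinks the exponentially weighted \<open>L\<^sup>1\<close> norm by the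
  factor \<open>L\<^bsup>-\<alpha>\<^esup>\<close> (\<open>nRL_exp_weighted_L1\<close>), so that an integrable \<open>S \<ge> 0\<close> with \<open>S \<le> M I\<^sup>\<alpha> S\<close> vanishes
  (\<open>nRL_subsolution_zero\<close>).  Together with explicit supersolutions this gives the singular Gronwall bound
  \<open>volterra_bound\<close>, with a constant that does not depend on the base point.  That bound yields uniqueness, an
  a priori bound for all \<open>X\<^sub>s\<close> at once, and a domination of the quotients by \<open>(\<tau> - t)\<^bsup>\<alpha>-1\<^esup>\<close>.  The same
  vanishing principle, applied to the upper limit of the errors by means of Fatou's lemma, shows that
  vanishing residuals force vanishing errors at every time, including \<open>T\<close>
  (\<open>volterra_perturbation_null\<close>).  Existence is by Picard iteration in the weighted space.\<close>

section \<open>Fractional integrals of nonnegative functions\<close>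

text \<open>The Riemann-Liouville integral of order \<open>\<alpha>\<close> with base point \<open>t\<close>.  At \<open>\<xi> = \<tau>\<close> the kernel takes the
  value \<open>0 powr (\<alpha> - 1) = 0\<close>, so including that end point is harmless.\<close>

definition RL :: "real \<Rightarrow> real \<Rightarrow> (real \<Rightarrow> real) \<Rightarrow> real \<Rightarrow> real" where
  "RL \<alpha> t g \<tau> = (LBINT \<xi>:{t<..\<tau>}. g \<xi> * (\<tau> - \<xi>) powr (\<alpha> - 1)) / Gamma \<alpha>"

text \<open>The same operator on functions with values in \<open>[0, \<infinity>]\<close>, for which Tonelli's theorem applies and no
  integrability has to be checked.\<close>

definition nRL :: "real \<Rightarrow> real \<Rightarrow> (real \<Rightarrow> ennreal) \<Rightarrow> real \<Rightarrow> ennreal" where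
  "nRL \<alpha> t u \<tau> =
     (\<integral>\<^sup>+\<xi>. u \<xi> * ennreal ((\<tau> - \<xi>) powr (\<alpha> - 1) / Gamma \<alpha>) * indicator {t<..\<tau>} \<xi> \<partial>lborel)"

lemma nRL_measurable [measurable]:
  assumes [measurable]: "u \<in> borel_measurable borel"
  shows "nRL \<alpha> t u \<in> borel_measurable borel"
  unfolding nRL_def indicator_def greaterThanAtMost_iff by measurable

lemma nRL_mono:
  assumes "\<And>\<xi>. t < \<xi> \<Longrightarrow> \<xi> \<le> \<tau> \<Longrightarrow> u \<xi> \<le> v \<xi>"
  shows "nRL \<alpha> t u \<tau> \<le> nRL \<alpha> t v \<tau>"
  unfolding nRL_def
  by (intro nn_integral_mono) (auto simp: indicator_def intro!: mult_right_mono assms)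

lemma nRL_cong:
  assumes "\<And>\<xi>. t < \<xi> \<Longrightarrow> \<xi> \<le> \<tau> \<Longrightarrow> u \<xi> = v \<xi>"
  shows "nRL \<alpha> t u \<tau> = nRL \<alpha> t v \<tau>"
  by (intro antisym nRL_mono) (simp_all add: assms)

lemma nRL_add:
  assumes [measurable]: "u \<in> borel_measurable borel" "v \<in> borel_measurable borel"
  shows "nRL \<alpha> t (\<lambda>\<xi>. u \<xi> + v \<xi>) \<tau> = nRL \<alpha> t u \<tau> + nRL \<alpha> t v \<tau>"
  unfolding nRL_def
  by (subst nn_integral_add[symmetric]) (auto intro!: nn_integral_cong simp: algebra_simps)

lemma nRL_cmult:
  assumes [measurable]: "u \<in> borel_measurable borel"
  shows "nRL \<alpha> t (\<lambda>\<xi>. c * u \<xi>) \<tau> = c * nRL \<alpha> t u \<tau>"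
  unfolding nRL_def
  by (subst nn_integral_cmult[symmetric]) (auto intro!: nn_integral_cong simp: algebra_simps)

text \<open>The Laplace transform of the kernel \<open>r\<^bsup>\<alpha>-1\<^esup>/\<Gamma>(\<alpha>)\<close> is \<open>L\<^bsup>-\<alpha>\<^esup>\<close>.\<close>

lemma nn_integral_exp_kernel:
  assumes "\<alpha> > 0" "L > 0"
  shows "(\<integral>\<^sup>+r. ennreal (exp (- L * r) * (r powr (\<alpha> - 1) / Gamma \<alpha>)) * indicator {0..} r \<partial>lborel)
    = ennreal (L powr (-\<alpha>))"
proof -
  have G: "Gamma \<alpha> > 0" using assms by (simp add: Gamma_real_pos)
  have "(\<integral>\<^sup>+r. ennreal (exp (- L * r) * (r powr (\<alpha> - 1) / Gamma \<alpha>)) * indicator {0..} r \<partial>lborel)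
     = \<bar>1/L\<bar> * (\<integral>\<^sup>+r. ennreal (exp (- L * (0 + (1/L) * r)) * ((0 + (1/L) * r) powr (\<alpha> - 1) / Gamma \<alpha>))
          * indicator {0..} (0 + (1/L) * r) \<partial>lborel)"
    by (rule nn_integral_real_affine) (use assms in auto)
  also have "(\<integral>\<^sup>+r. ennreal (exp (- L * (0 + (1/L) * r)) * ((0 + (1/L) * r) powr (\<alpha> - 1) / Gamma \<alpha>))
          * indicator {0..} (0 + (1/L) * r) \<partial>lborel)
     = (\<integral>\<^sup>+r. ennreal (L powr (1-\<alpha>) / Gamma \<alpha>) * ennreal (indicator {0..} r * r powr (\<alpha> - 1) / exp r) \<partial>lborel)"
  proof (intro nn_integral_cong)
    fix r :: real
    show "ennreal (exp (- L * (0 + (1/L) * r)) * ((0 + (1/L) * r) powr (\<alpha> - 1) / Gamma \<alpha>))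
          * indicator {0..} (0 + (1/L) * r) =
        ennreal (L powr (1-\<alpha>) / Gamma \<alpha>) * ennreal (indicator {0..} r * r powr (\<alpha> - 1) / exp r)"
    proof (cases "r \<ge> 0")
      case True
      have "(r / L) powr (\<alpha> - 1) = r powr (\<alpha> - 1) * L powr (1 - \<alpha>)"
        using assms True powr_minus[of L "1 - \<alpha>"]
        by (simp add: powr_divide field_simps)
      then show ?thesis using True assms G
        by (simp add: ennreal_mult[symmetric] exp_minus field_simps)
    next
      case False
      then show ?thesis using assms by (simp add: indicator_def zero_le_divide_iff)
    qed
  qed
  also have "\<dots> = ennreal (L powr (1-\<alpha>) / Gamma \<alpha>) * ennreal (Gamma \<alpha>)"
    by (subst nn_integral_cmult) (use Gamma_conv_nn_integral_real[OF assms(1)] in auto)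
  also have "ennreal \<bar>1/L\<bar> * \<dots> = ennreal (L powr (-\<alpha>))"
    using G assms less_imp_neq[OF G]
    by (simp add: ennreal_mult[symmetric] powr_diff powr_minus_divide field_simps)
  finally show ?thesis .
qed

lemma nn_integral_exp_kernel_shift:
  assumes "\<alpha> > 0" "L > 0"
  shows "(\<integral>\<^sup>+\<tau>. ennreal (exp (- L * (\<tau> - \<xi>)) * ((\<tau> - \<xi>) powr (\<alpha> - 1) / Gamma \<alpha>)) * indicator {\<xi>..} \<tau> \<partial>lborel)
    = ennreal (L powr (-\<alpha>))"
    and "(\<integral>\<^sup>+\<xi>. ennreal (exp (- L * (\<tau> - \<xi>)) * ((\<tau> - \<xi>) powr (\<alpha> - 1) / Gamma \<alpha>)) * indicator {..\<tau>} \<xi> \<partial>lborel)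
    = ennreal (L powr (-\<alpha>))"
proof -
  have "(\<integral>\<^sup>+\<tau>. ennreal (exp (- L * (\<tau> - \<xi>)) * ((\<tau> - \<xi>) powr (\<alpha> - 1) / Gamma \<alpha>)) * indicator {\<xi>..} \<tau> \<partial>lborel)
    = (\<integral>\<^sup>+r. ennreal (exp (- L * r) * (r powr (\<alpha> - 1) / Gamma \<alpha>)) * indicator {0..} r \<partial>lborel)"
    by (subst nn_integral_real_affine[where c=1 and t=\<xi>]) (auto intro!: nn_integral_cong simp: indicator_def)
  then show "(\<integral>\<^sup>+\<tau>. ennreal (exp (- L * (\<tau> - \<xi>)) * ((\<tau> - \<xi>) powr (\<alpha> - 1) / Gamma \<alpha>)) * indicator {\<xi>..} \<tau> \<partial>lborel)
    = ennreal (L powr (-\<alpha>))" using nn_integral_exp_kernel[OF assms] by simp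
  have "(\<integral>\<^sup>+\<xi>. ennreal (exp (- L * (\<tau> - \<xi>)) * ((\<tau> - \<xi>) powr (\<alpha> - 1) / Gamma \<alpha>)) * indicator {..\<tau>} \<xi> \<partial>lborel)
    = (\<integral>\<^sup>+r. ennreal (exp (- L * r) * (r powr (\<alpha> - 1) / Gamma \<alpha>)) * indicator {0..} r \<partial>lborel)"
    by (subst nn_integral_real_affine[where c="-1" and t=\<tau>]) (auto intro!: nn_integral_cong simp: indicator_def)
  then show "(\<integral>\<^sup>+\<xi>. ennreal (exp (- L * (\<tau> - \<xi>)) * ((\<tau> - \<xi>) powr (\<alpha> - 1) / Gamma \<alpha>)) * indicator {..\<tau>} \<xi> \<partial>lborel)
    = ennreal (L powr (-\<alpha>))" using nn_integral_exp_kernel[OF assms] by simp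
qed

text \<open>Exchanging the integrals leaves the Laplace transform of the kernel as inner integral.  For large \<open>L\<close> the
  operator is therefore a contraction in the norm with weight \<open>e\<^bsup>-L\<tau>\<^esup>\<close>.\<close>

lemma nRL_exp_weighted_L1:
  assumes "\<alpha> > 0" "L > 0" and [measurable]: "u \<in> borel_measurable borel"
  shows "(\<integral>\<^sup>+\<tau>. ennreal (exp (- L * \<tau>)) * nRL \<alpha> t u \<tau> * indicator {t<..T} \<tau> \<partial>lborel)
    \<le> ennreal (L powr (-\<alpha>)) * (\<integral>\<^sup>+\<xi>. ennreal (exp (- L * \<xi>)) * u \<xi> * indicator {t<..T} \<xi> \<partial>lborel)"
proof -
  have G: "Gamma \<alpha> > 0" using assms by (simp add: Gamma_real_pos)
  have "(\<integral>\<^sup>+\<tau>. ennreal (exp (- L * \<tau>)) * nRL \<alpha> t u \<tau> * indicator {t<..T} \<tau> \<partial>lborel)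
    = (\<integral>\<^sup>+\<tau>. \<integral>\<^sup>+\<xi>. ennreal (exp (- L * \<tau>)) * indicator {t<..T} \<tau> *
        (u \<xi> * ennreal ((\<tau> - \<xi>) powr (\<alpha> - 1) / Gamma \<alpha>) * indicator {t<..\<tau>} \<xi>) \<partial>lborel \<partial>lborel)"
    unfolding nRL_def
    by (intro nn_integral_cong) (subst nn_integral_cmult, auto simp: ac_simps)
  also have "\<dots> = (\<integral>\<^sup>+\<xi>. \<integral>\<^sup>+\<tau>. ennreal (exp (- L * \<tau>)) * indicator {t<..T} \<tau> *
        (u \<xi> * ennreal ((\<tau> - \<xi>) powr (\<alpha> - 1) / Gamma \<alpha>) * indicator {t<..\<tau>} \<xi>) \<partial>lborel \<partial>lborel)"
    unfolding indicator_def greaterThanAtMost_iff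
    by (rule lborel_pair.Fubini') measurable
  also have "\<dots> \<le> (\<integral>\<^sup>+\<xi>. \<integral>\<^sup>+\<tau>. (ennreal (exp (- L * \<xi>)) * u \<xi> * indicator {t<..T} \<xi>) *
        (ennreal (exp (- L * (\<tau> - \<xi>)) * ((\<tau> - \<xi>) powr (\<alpha> - 1) / Gamma \<alpha>)) * indicator {\<xi>..} \<tau>) \<partial>lborel \<partial>lborel)"
  proof (intro nn_integral_mono)
    fix \<xi> \<tau> :: real
    have e: "exp (- L * \<tau>) = exp (- L * \<xi>) * exp (- L * (\<tau> - \<xi>))"
      by (simp add: exp_add[symmetric] algebra_simps)
    show "ennreal (exp (- L * \<tau>)) * indicator {t<..T} \<tau> *
        (u \<xi> * ennreal ((\<tau> - \<xi>) powr (\<alpha> - 1) / Gamma \<alpha>) * indicator {t<..\<tau>} \<xi>) \<le>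
        (ennreal (exp (- L * \<xi>)) * u \<xi> * indicator {t<..T} \<xi>) *
        (ennreal (exp (- L * (\<tau> - \<xi>)) * ((\<tau> - \<xi>) powr (\<alpha> - 1) / Gamma \<alpha>)) * indicator {\<xi>..} \<tau>)"
    proof (cases "t < \<xi> \<and> \<xi> \<le> \<tau> \<and> \<tau> \<le> T")
      case True
      then show ?thesis unfolding e using G
        by (simp add: ennreal_mult'[symmetric] mult.assoc mult.left_commute[of _ "u \<xi>"])
    next
      case False
      then show ?thesis by (auto simp: indicator_def)
    qed
  qed
  also have "\<dots> = (\<integral>\<^sup>+\<xi>. (ennreal (exp (- L * \<xi>)) * u \<xi> * indicator {t<..T} \<xi>) * ennreal (L powr (-\<alpha>)) \<partial>lborel)"
  proof (intro nn_integral_cong)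
    fix \<xi> :: real
    show "(\<integral>\<^sup>+\<tau>. (ennreal (exp (- L * \<xi>)) * u \<xi> * indicator {t<..T} \<xi>) *
        (ennreal (exp (- L * (\<tau> - \<xi>)) * ((\<tau> - \<xi>) powr (\<alpha> - 1) / Gamma \<alpha>)) * indicator {\<xi>..} \<tau>) \<partial>lborel)
      = (ennreal (exp (- L * \<xi>)) * u \<xi> * indicator {t<..T} \<xi>) * ennreal (L powr (-\<alpha>))"
      unfolding nn_integral_exp_kernel_shift(1)[OF assms(1,2), of \<xi>, symmetric]
      by (rule nn_integral_cmult) measurable
  qed
  also have "\<dots> = ennreal (L powr (-\<alpha>)) * (\<integral>\<^sup>+\<xi>. ennreal (exp (- L * \<xi>)) * u \<xi> * indicator {t<..T} \<xi> \<partial>lborel)"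
    by (subst nn_integral_cmult[symmetric]) (auto simp: ac_simps)
  finally show ?thesis .
qed

lemma powr_minus_small:
  assumes "\<alpha> > 0" "M \<ge> (0::real)"
  shows "(2 * M + 1) powr (1/\<alpha>) > 0" "M * ((2 * M + 1) powr (1/\<alpha>)) powr (-\<alpha>) \<le> 1/2"
proof -
  show "(2 * M + 1) powr (1/\<alpha>) > 0" using assms by simp
  have "((2 * M + 1) powr (1/\<alpha>)) powr (-\<alpha>) = (2*M+1) powr (-1)"
    using assms by (simp add: powr_powr)
  also have "\<dots> = 1 / (2*M+1)" using assms by (simp add: powr_minus_divide)
  finally show "M * ((2 * M + 1) powr (1/\<alpha>)) powr (-\<alpha>) \<le> 1/2"
    using assms by simp
qed

text \<open>A contraction has no nontrivial nonnegative subsolution of finite norm; this gives \<open>S = 0\<close> almost everywhere,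
  and the inequality itself upgrades it to every point.\<close>

lemma nRL_subsolution_zero:
  assumes "\<alpha> > 0" "M \<ge> 0" and S[measurable]: "S \<in> borel_measurable borel"
    and fin: "(\<integral>\<^sup>+\<tau>. S \<tau> * indicator {t<..T} \<tau> \<partial>lborel) < \<infinity>"
    and le: "\<And>\<tau>. t < \<tau> \<Longrightarrow> \<tau> \<le> T \<Longrightarrow> S \<tau> \<le> ennreal M * nRL \<alpha> t S \<tau>"
    and "t < \<tau>" "\<tau> \<le> T"
  shows "S \<tau> = 0"
proof -
  obtain L where L: "L > 0" "M * L powr (-\<alpha>) \<le> 1/2" using powr_minus_small[OF assms(1,2)] by blast
  define I where "I = (\<integral>\<^sup>+\<tau>. ennreal (exp (- L * \<tau>)) * S \<tau> * indicator {t<..T} \<tau> \<partial>lborel)"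
  have "I \<le> (\<integral>\<^sup>+\<tau>. ennreal (exp (- L * t)) * (S \<tau> * indicator {t<..T} \<tau>) \<partial>lborel)"
    unfolding I_def using L by (intro nn_integral_mono) (auto simp: indicator_def intro!: mult_right_mono)
  also have "\<dots> = ennreal (exp (- L * t)) * (\<integral>\<^sup>+\<tau>. S \<tau> * indicator {t<..T} \<tau> \<partial>lborel)"
    by (rule nn_integral_cmult) simp
  also have "\<dots> < \<infinity>" using fin by (simp add: ennreal_mult_less_top)
  finally have Ifin: "I < \<infinity>" .
  have "I \<le> (\<integral>\<^sup>+\<tau>. ennreal M * (ennreal (exp (- L * \<tau>)) * nRL \<alpha> t S \<tau> * indicator {t<..T} \<tau>) \<partial>lborel)"
    unfolding I_def
  proof (intro nn_integral_mono)
    fix \<tau> show "ennreal (exp (- L * \<tau>)) * S \<tau> * indicator {t<..T} \<tau>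
        \<le> ennreal M * (ennreal (exp (- L * \<tau>)) * nRL \<alpha> t S \<tau> * indicator {t<..T} \<tau>)"
      using mult_left_mono[OF le[of \<tau>], of "ennreal (exp (- L * \<tau>))"]
      by (auto simp: indicator_def ac_simps)
  qed
  also have "\<dots> = ennreal M * (\<integral>\<^sup>+\<tau>. (ennreal (exp (- L * \<tau>)) * nRL \<alpha> t S \<tau> * indicator {t<..T} \<tau>) \<partial>lborel)"
    by (rule nn_integral_cmult) simp
  also have "\<dots> \<le> ennreal M * (ennreal (L powr (-\<alpha>)) * I)"
    unfolding I_def by (intro mult_left_mono nRL_exp_weighted_L1 assms L) simp
  also have "\<dots> = ennreal (M * L powr (-\<alpha>)) * I"
    using assms by (simp add: ennreal_mult ac_simps)
  also have "\<dots> \<le> ennreal (1/2) * I"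
    by (intro mult_right_mono ennreal_leI L) simp
  finally have II: "I \<le> ennreal (1/2) * I" .
  have "I = 0"
  proof (cases I)
    case (real r)
    then have "ennreal r \<le> ennreal (1/2 * r)" using II by (subst ennreal_mult) auto
    then have "r \<le> 1/2 * r" using real by (subst (asm) ennreal_le_iff) auto
    with real show ?thesis by simp
  next
    case top then show ?thesis using Ifin by simp
  qed
  then have "AE \<tau> in lborel. ennreal (exp (- L * \<tau>)) * S \<tau> * indicator {t<..T} \<tau> = 0"
    unfolding I_def by (subst (asm) nn_integral_0_iff_AE) auto
  then have "AE \<xi> in lborel. S \<xi> * ennreal ((\<tau> - \<xi>) powr (\<alpha> - 1) / Gamma \<alpha>) * indicator {t<..\<tau>} \<xi> = 0"
    by eventually_elim (use assms in \<open>auto simp: indicator_def split: if_splits\<close>)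
  then have "nRL \<alpha> t S \<tau> = 0"
    unfolding nRL_def by (subst nn_integral_0_iff_AE) auto
  then show ?thesis using le[of \<tau>] assms by simp
qed

text \<open>The positive part of \<open>u - W\<close> is a subsolution of the homogeneous equation, hence zero.\<close>

lemma nRL_comparison:
  assumes "\<alpha> > 0" "M \<ge> 0"
    and [measurable]: "u \<in> borel_measurable borel" "W \<in> borel_measurable borel"
    and fin: "(\<integral>\<^sup>+\<tau>. u \<tau> * indicator {t<..T} \<tau> \<partial>lborel) < \<infinity>"
    and u: "\<And>\<tau>. t < \<tau> \<Longrightarrow> \<tau> \<le> T \<Longrightarrow> u \<tau> \<le> e \<tau> + ennreal M * nRL \<alpha> t u \<tau>"
    and W: "\<And>\<tau>. t < \<tau> \<Longrightarrow> \<tau> \<le> T \<Longrightarrow> e \<tau> + ennreal M * nRL \<alpha> t W \<tau> \<le> W \<tau>"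
    and Wfin: "\<And>\<tau>. t < \<tau> \<Longrightarrow> \<tau> \<le> T \<Longrightarrow> W \<tau> < \<infinity>"
    and "t < \<tau>" "\<tau> \<le> T"
  shows "u \<tau> \<le> W \<tau>"
proof -
  define v where "v = (\<lambda>\<tau>. u \<tau> - W \<tau>)"
  have [measurable]: "v \<in> borel_measurable borel" unfolding v_def by measurable
  have "v \<tau> = 0"
  proof (rule nRL_subsolution_zero[OF assms(1,2) _ _ _ assms(9,10)])
    have "(\<integral>\<^sup>+\<tau>. v \<tau> * indicator {t<..T} \<tau> \<partial>lborel) \<le> (\<integral>\<^sup>+\<tau>. u \<tau> * indicator {t<..T} \<tau> \<partial>lborel)"
      unfolding v_def by (intro nn_integral_mono mult_right_mono) (auto simp: diff_le_self_ennreal)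
    then show "(\<integral>\<^sup>+\<tau>. v \<tau> * indicator {t<..T} \<tau> \<partial>lborel) < \<infinity>" using fin by (rule le_less_trans)
  next
    fix \<tau> assume \<tau>: "t < \<tau>" "\<tau> \<le> T"
    have "nRL \<alpha> t u \<tau> \<le> nRL \<alpha> t (\<lambda>\<xi>. v \<xi> + W \<xi>) \<tau>"
      unfolding v_def using Wfin \<tau>
      by (intro nRL_mono) (metis ennreal_minus_le_iff dual_order.refl add.commute less_irrefl infinity_ennreal_def)
    also have "\<dots> = nRL \<alpha> t v \<tau> + nRL \<alpha> t W \<tau>" by (rule nRL_add) auto
    finally have "u \<tau> \<le> e \<tau> + ennreal M * (nRL \<alpha> t v \<tau> + nRL \<alpha> t W \<tau>)"
      using u[OF \<tau>] by (meson add_left_mono mult_left_mono order_trans zero_le)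
    also have "\<dots> = ennreal M * nRL \<alpha> t v \<tau> + (e \<tau> + ennreal M * nRL \<alpha> t W \<tau>)"
      by (simp add: algebra_simps)
    also have "\<dots> \<le> ennreal M * nRL \<alpha> t v \<tau> + W \<tau>" using W[OF \<tau>] by (intro add_left_mono)
    finally show "v \<tau> \<le> ennreal M * nRL \<alpha> t v \<tau>"
      unfolding v_def using Wfin[OF \<tau>] by (auto simp: ennreal_minus_le_iff add.commute less_top)
  qed measurable
  then show ?thesis unfolding v_def using Wfin[OF assms(9,10)]
    by (simp add: ennreal_minus_eq_0)
qed

lemma nn_integral_powr_shift:
  assumes "\<beta> > 0" "\<sigma> \<ge> 0"
  shows "(\<integral>\<^sup>+\<xi>. ennreal ((\<xi> - t) powr (\<beta> - 1)) * indicator {t<..t+\<sigma>} \<xi> \<partial>lborel) = ennreal (\<sigma> powr \<beta> / \<beta>)"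
proof -
  have hi: "((\<lambda>x. x powr (\<beta> - 1)) has_integral (\<sigma> powr (\<beta>-1+1) / (\<beta>-1+1))) {0..\<sigma>}"
    by (rule has_integral_powr_from_0) (use assms in auto)
  have "(\<integral>\<^sup>+\<xi>. ennreal ((\<xi> - t) powr (\<beta> - 1)) * indicator {t<..t+\<sigma>} \<xi> \<partial>lborel)
    = (\<integral>\<^sup>+x. ennreal (x powr (\<beta> - 1)) * indicator {0<..\<sigma>} x \<partial>lborel)"
    by (subst nn_integral_real_affine[where c=1 and t=t]) (auto intro!: nn_integral_cong simp: indicator_def)
  also have "\<dots> = (\<integral>\<^sup>+x. ennreal (indicator {0..\<sigma>} x * x powr (\<beta> - 1)) \<partial>lborel)"
    by (intro nn_integral_cong) (auto simp: indicator_def)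
  also have "\<dots> = ennreal (\<sigma> powr \<beta> / \<beta>)"
    by (subst nn_integral_has_integral_lebesgue[OF _ hi]) auto
  finally show ?thesis .
qed

text \<open>With \<open>v = L\<sigma>\<close> this is \<open>v\<^bsup>\<alpha>\<^esup> \<le> e\<^bsup>v\<^esup>\<close>.\<close>

lemma powr_exp_le:
  assumes "0 < \<alpha>" "\<alpha> \<le> 1" "L > 0" "\<sigma> \<ge> (0::real)"
  shows "\<sigma> powr \<alpha> * exp (- L * \<sigma>) \<le> L powr (-\<alpha>)"
proof -
  define v where "v = L * \<sigma>"
  have v: "v \<ge> 0" using assms by (simp add: v_def)
  have "v powr \<alpha> \<le> exp v"
  proof (cases "v \<le> 1")
    case True then have "v powr \<alpha> \<le> 1" using v assms by (simp add: powr_le1)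
    also have "1 \<le> exp v" using v by simp
    finally show ?thesis .
  next
    case False then have "v powr \<alpha> \<le> v powr 1" using assms by (intro powr_mono) auto
    also have "\<dots> \<le> exp v" using False exp_ge_add_one_self[of v] v by simp (use exp_ge_add_one_self[of v] in linarith)
    finally show ?thesis .
  qed
  then have "v powr \<alpha> * exp (-v) \<le> 1" by (simp add: exp_minus field_simps)
  moreover have "v powr \<alpha> = L powr \<alpha> * \<sigma> powr \<alpha>" unfolding v_def using assms by (simp add: powr_mult)
  ultimately show ?thesis using assms by (simp add: v_def powr_minus field_simps)
qed

text \<open>The weights \<open>e\<^bsup>L(\<tau>-t)\<^esup>(\<tau> - t)\<^bsup>\<beta>-1\<^esup>\<close> are reproduced by the fractional integral up to a factor of order \<open>L\<^bsup>-\<alpha>\<^esup>\<close>.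
  The exponent \<open>\<beta> = \<alpha>\<close> suits the singular solutions \<open>p\<close> and \<open>q\<close>, and \<open>\<beta> = 1\<close> bounded solutions.\<close>

lemma nRL_weight:
  assumes "0 < \<alpha>" "\<alpha> \<le> 1" "0 < \<beta>" "\<beta> \<le> 1" "L > 0" "t < \<tau>"
  shows "nRL \<alpha> t (\<lambda>\<xi>. ennreal (exp (L * (\<xi> - t)) * (\<xi> - t) powr (\<beta> - 1))) \<tau>
    \<le> ennreal ((2 * (1 + 1 / (\<beta> * Gamma \<alpha>)) * L powr (-\<alpha>)) * (exp (L * (\<tau> - t)) * (\<tau> - t) powr (\<beta> - 1)))"
proof -
  have G: "Gamma \<alpha> > 0" using assms by (simp add: Gamma_real_pos)
  \<comment> \<open>The interval is split at its midpoint: on each half only one of the two singular factors is unbounded.\<close>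
  define \<sigma> where "\<sigma> = (\<tau> - t) / 2"
  have \<sigma>: "\<sigma> > 0" "\<tau> = t + 2 * \<sigma>" using assms by (auto simp: \<sigma>_def field_simps)
  define A where "A = exp (L * (\<tau> - t))"
  have A: "A > 0" by (simp add: A_def)
  let ?f = "\<lambda>\<xi>. ennreal (A * \<sigma> powr (\<beta>-1)) *
     (ennreal (exp (- L * (\<tau> - \<xi>)) * ((\<tau> - \<xi>) powr (\<alpha> - 1) / Gamma \<alpha>)) * indicator {..\<tau>} \<xi>)"
  let ?g = "\<lambda>\<xi>. ennreal (A * exp (- L * \<sigma>) * \<sigma> powr (\<alpha>-1) / Gamma \<alpha>) *
     (ennreal ((\<xi> - t) powr (\<beta> - 1)) * indicator {t<..t+\<sigma>} \<xi>)"
  have "nRL \<alpha> t (\<lambda>\<xi>. ennreal (exp (L * (\<xi> - t)) * (\<xi> - t) powr (\<beta> - 1))) \<tau> \<le> (\<integral>\<^sup>+\<xi>. ?f \<xi> + ?g \<xi> \<partial>lborel)"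
    unfolding nRL_def
  proof (intro nn_integral_mono)
    fix \<xi> :: real
    have e: "exp (L * (\<xi> - t)) = A * exp (- L * (\<tau> - \<xi>))"
      by (simp add: A_def exp_add[symmetric] algebra_simps)
    consider "\<xi> \<le> t \<or> \<xi> > \<tau>" | "t < \<xi>" "\<xi> \<le> t + \<sigma>" | "t + \<sigma> < \<xi>" "\<xi> \<le> \<tau>" by linarith
    then show "ennreal (exp (L * (\<xi> - t)) * (\<xi> - t) powr (\<beta> - 1)) * ennreal ((\<tau> - \<xi>) powr (\<alpha> - 1) / Gamma \<alpha>)
        * indicator {t<..\<tau>} \<xi> \<le> ?f \<xi> + ?g \<xi>"
    proof cases
      case 1 then show ?thesis by (auto simp: indicator_def)
    next
      case 2
      have "exp (- L * (\<tau> - \<xi>)) \<le> exp (- L * \<sigma>)" using 2 \<sigma> assms by auto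
      moreover have "(\<tau> - \<xi>) powr (\<alpha> - 1) \<le> \<sigma> powr (\<alpha> - 1)" using 2 \<sigma> assms by (intro powr_mono2') auto
      ultimately have "exp (- L * (\<tau> - \<xi>)) * (\<tau> - \<xi>) powr (\<alpha> - 1) \<le> exp (- L * \<sigma>) * \<sigma> powr (\<alpha> - 1)"
        by (intro mult_mono) auto
      then have "(A * (\<xi> - t) powr (\<beta> - 1) / Gamma \<alpha>) * (exp (- L * (\<tau> - \<xi>)) * (\<tau> - \<xi>) powr (\<alpha> - 1))
         \<le> (A * (\<xi> - t) powr (\<beta> - 1) / Gamma \<alpha>) * (exp (- L * \<sigma>) * \<sigma> powr (\<alpha> - 1))"
        using A G by (intro mult_left_mono) auto
      then have "exp (L * (\<xi> - t)) * (\<xi> - t) powr (\<beta> - 1) * ((\<tau> - \<xi>) powr (\<alpha> - 1) / Gamma \<alpha>)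
         \<le> (A * exp (- L * \<sigma>) * \<sigma> powr (\<alpha>-1) / Gamma \<alpha>) * (\<xi> - t) powr (\<beta> - 1)"
        unfolding e by (simp only: mult_ac times_divide_eq_right times_divide_eq_left)
      then have "ennreal (exp (L * (\<xi> - t)) * (\<xi> - t) powr (\<beta> - 1)) * ennreal ((\<tau> - \<xi>) powr (\<alpha> - 1) / Gamma \<alpha>)
        * indicator {t<..\<tau>} \<xi> \<le> ?g \<xi>"
        using 2 \<sigma> A G by (simp add: ennreal_mult[symmetric])
      then show ?thesis by (simp add: add_increasing)
    next
      case 3
      have "(\<xi> - t) powr (\<beta> - 1) \<le> \<sigma> powr (\<beta> - 1)" using 3 \<sigma> assms by (intro powr_mono2') auto
      then have "(A * exp (- L * (\<tau> - \<xi>)) * ((\<tau> - \<xi>) powr (\<alpha> - 1) / Gamma \<alpha>)) * (\<xi> - t) powr (\<beta> - 1)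
         \<le> (A * exp (- L * (\<tau> - \<xi>)) * ((\<tau> - \<xi>) powr (\<alpha> - 1) / Gamma \<alpha>)) * \<sigma> powr (\<beta>-1)"
        using A G by (intro mult_left_mono) auto
      then have "exp (L * (\<xi> - t)) * (\<xi> - t) powr (\<beta> - 1) * ((\<tau> - \<xi>) powr (\<alpha> - 1) / Gamma \<alpha>)
         \<le> (A * \<sigma> powr (\<beta>-1)) * (exp (- L * (\<tau> - \<xi>)) * ((\<tau> - \<xi>) powr (\<alpha> - 1) / Gamma \<alpha>))"
        unfolding e by (simp only: mult_ac times_divide_eq_right times_divide_eq_left)
      then have "ennreal (exp (L * (\<xi> - t)) * (\<xi> - t) powr (\<beta> - 1)) * ennreal ((\<tau> - \<xi>) powr (\<alpha> - 1) / Gamma \<alpha>)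
        * indicator {t<..\<tau>} \<xi> \<le> ?f \<xi>"
        using 3 \<sigma> A G by (simp add: ennreal_mult[symmetric])
      then show ?thesis by (simp add: add_increasing2)
    qed
  qed
  also have "\<dots> = (\<integral>\<^sup>+\<xi>. ?f \<xi> \<partial>lborel) + (\<integral>\<^sup>+\<xi>. ?g \<xi> \<partial>lborel)"
    by (intro nn_integral_add) auto
  also have "(\<integral>\<^sup>+\<xi>. ?f \<xi> \<partial>lborel) = ennreal (A * \<sigma> powr (\<beta>-1)) * ennreal (L powr (-\<alpha>))"
    by (subst nn_integral_cmult, simp) (simp only: nn_integral_exp_kernel_shift[OF assms(1,5)])
  also have "(\<integral>\<^sup>+\<xi>. ?g \<xi> \<partial>lborel) = ennreal (A * exp (- L * \<sigma>) * \<sigma> powr (\<alpha>-1) / Gamma \<alpha>) * ennreal (\<sigma> powr \<beta> / \<beta>)"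
    by (subst nn_integral_cmult, simp) (use nn_integral_powr_shift assms \<sigma> in simp)
  also have "ennreal (A * \<sigma> powr (\<beta>-1)) * ennreal (L powr (-\<alpha>)) + \<dots> =
     ennreal (A * \<sigma> powr (\<beta>-1) * (L powr (-\<alpha>) + \<sigma> powr \<alpha> * exp (- L * \<sigma>) / (\<beta> * Gamma \<alpha>)))"
  proof -
    have "\<sigma> powr (\<alpha>-1) * \<sigma> powr \<beta> = \<sigma> powr (\<beta>-1) * \<sigma> powr \<alpha>"
      by (simp add: powr_add[symmetric] algebra_simps)
    then show ?thesis using A G \<sigma> assms
      by (simp add: ennreal_mult[symmetric] ennreal_plus[symmetric] del: ennreal_plus) (simp add: field_simps)
  qed
  also have "\<dots> \<le> ennreal (A * (2 * (\<tau> - t) powr (\<beta>-1)) * (L powr (-\<alpha>) + L powr (-\<alpha>) / (\<beta> * Gamma \<alpha>)))"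
  proof (intro ennreal_leI mult_mono)
    have two: "2 powr (1-\<beta>) \<le> 2 powr (1::real)" using assms by (intro powr_mono) auto
    have "\<sigma> powr (\<beta>-1) = (\<tau> - t) powr (\<beta>-1) * 2 powr (1-\<beta>)"
      unfolding \<sigma>_def using assms powr_minus[of 2 "1-\<beta>"] by (simp add: powr_divide field_simps)
    also have "\<dots> \<le> (\<tau> - t) powr (\<beta>-1) * 2"
      using two by (intro mult_left_mono) auto
    finally show "\<sigma> powr (\<beta>-1) \<le> 2 * (\<tau> - t) powr (\<beta>-1)" by (simp add: mult.commute)
    show "L powr (-\<alpha>) + \<sigma> powr \<alpha> * exp (- L * \<sigma>) / (\<beta> * Gamma \<alpha>) \<le> L powr (-\<alpha>) + L powr (-\<alpha>) / (\<beta> * Gamma \<alpha>)"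
      using powr_exp_le[OF assms(1,2,5), of \<sigma>] \<sigma> G assms by (intro add_left_mono divide_right_mono) auto
  qed (use A G assms in auto)
  finally show ?thesis unfolding A_def by (simp add: algebra_simps)
qed

text \<open>A rate for which \<open>M\<close> times the fractional integral of the weight is at most half of the weight.  It depends
  neither on the base point nor on the length of the interval.\<close>

definition weight_rate :: "real \<Rightarrow> real \<Rightarrow> real \<Rightarrow> real" where
  "weight_rate \<alpha> \<beta> M = (2 * (M * (2 * (1 + 1 / (\<beta> * Gamma \<alpha>)))) + 1) powr (1 / \<alpha>)"

lemma nRL_weight_half:
  assumes "0 < \<alpha>" "\<alpha> \<le> 1" "0 < \<beta>" "\<beta> \<le> 1" "M \<ge> 0" and L: "L = weight_rate \<alpha> \<beta> M" and "t < \<tau>"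
  shows "ennreal M * nRL \<alpha> t (\<lambda>\<xi>. ennreal (exp (L * (\<xi> - t)) * (\<xi> - t) powr (\<beta> - 1))) \<tau>
    \<le> ennreal (1/2 * (exp (L * (\<tau> - t)) * (\<tau> - t) powr (\<beta> - 1)))"
proof -
  have G: "Gamma \<alpha> > 0" using assms by (simp add: Gamma_real_pos)
  have L1: "L > 0" "(M * (2 * (1 + 1 / (\<beta> * Gamma \<alpha>)))) * L powr (-\<alpha>) \<le> 1/2"
    unfolding L weight_rate_def by (rule powr_minus_small; use assms G in simp)+
  have "ennreal M * nRL \<alpha> t (\<lambda>\<xi>. ennreal (exp (L * (\<xi> - t)) * (\<xi> - t) powr (\<beta> - 1))) \<tau>
    \<le> ennreal M * ennreal ((2 * (1 + 1 / (\<beta> * Gamma \<alpha>)) * L powr (-\<alpha>)) * (exp (L * (\<tau> - t)) * (\<tau> - t) powr (\<beta> - 1)))"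
    by (intro mult_left_mono nRL_weight assms L1) auto
  also have "\<dots> = ennreal (((M * (2 * (1 + 1 / (\<beta> * Gamma \<alpha>)))) * L powr (-\<alpha>)) * (exp (L * (\<tau> - t)) * (\<tau> - t) powr (\<beta> - 1)))"
    using assms G by (simp add: ennreal_mult[symmetric] algebra_simps)
  also have "\<dots> \<le> ennreal (1/2 * (exp (L * (\<tau> - t)) * (\<tau> - t) powr (\<beta> - 1)))"
    by (intro ennreal_leI mult_right_mono L1) auto
  finally show ?thesis .
qed

text \<open>This covers every function, because a divergent Bochner integral has the value \<open>0\<close>.\<close>

lemma abs_RL_le:
  assumes "\<alpha> > 0"
  shows "ennreal \<bar>RL \<alpha> t g \<tau>\<bar> \<le> nRL \<alpha> t (\<lambda>\<xi>. ennreal \<bar>g \<xi>\<bar>) \<tau>"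
proof -
  have G: "Gamma \<alpha> > 0" using assms by (simp add: Gamma_real_pos)
  define f where "f = (\<lambda>\<xi>. indicat_real {t<..\<tau>} \<xi> * (g \<xi> * (\<tau> - \<xi>) powr (\<alpha> - 1)) / Gamma \<alpha>)"
  have RL: "RL \<alpha> t g \<tau> = (\<integral>\<xi>. f \<xi> \<partial>lborel)"
    unfolding RL_def f_def set_lebesgue_integral_def by simp
  have "ennreal \<bar>\<integral>\<xi>. f \<xi> \<partial>lborel\<bar> \<le> (\<integral>\<^sup>+\<xi>. ennreal \<bar>f \<xi>\<bar> \<partial>lborel)"
  proof (cases "integrable lborel f")
    case True
    then show ?thesis using integral_norm_bound_ennreal[OF True] by simp
  next
    case False
    then show ?thesis by (simp add: not_integrable_integral_eq)
  qed
  also have "\<dots> = nRL \<alpha> t (\<lambda>\<xi>. ennreal \<bar>g \<xi>\<bar>) \<tau>"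
    unfolding nRL_def f_def using G
    by (intro nn_integral_cong) (auto simp: indicator_def ennreal_mult[symmetric] abs_mult)
  finally show ?thesis unfolding RL .
qed

definition RL_const :: "real \<Rightarrow> real \<Rightarrow> real \<Rightarrow> real" where
  "RL_const \<alpha> \<beta> T0 = 2 * (1 + 1 / (\<beta> * Gamma \<alpha>)) * exp T0"

lemma RL_const_nonneg: "0 < \<alpha> \<Longrightarrow> 0 < \<beta> \<Longrightarrow> 0 \<le> RL_const \<alpha> \<beta> T0"
  by (simp add: RL_const_def)

lemma nRL_powr_le:
  assumes "0 < \<alpha>" "\<alpha> \<le> 1" "0 < \<beta>" "\<beta> \<le> 1" and *: "t < \<tau>" "\<tau> - t \<le> T0" "0 \<le> C"
  shows "nRL \<alpha> t (\<lambda>\<xi>. ennreal (C * (\<xi> - t) powr (\<beta> - 1))) \<tau> \<le> ennreal (RL_const \<alpha> \<beta> T0 * C * (\<tau> - t) powr (\<beta> - 1))"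
proof -
  have G: "Gamma \<alpha> > 0" using assms by (simp add: Gamma_real_pos)
  have "nRL \<alpha> t (\<lambda>\<xi>. ennreal (C * (\<xi> - t) powr (\<beta> - 1))) \<tau>
    \<le> nRL \<alpha> t (\<lambda>\<xi>. ennreal C * ennreal (exp (1 * (\<xi> - t)) * (\<xi> - t) powr (\<beta> - 1))) \<tau>"
    using * by (intro nRL_mono) (auto simp: ennreal_mult[symmetric] intro!: ennreal_leI mult_left_mono mult_right_mono)
  also have "\<dots> = ennreal C * nRL \<alpha> t (\<lambda>\<xi>. ennreal (exp (1 * (\<xi> - t)) * (\<xi> - t) powr (\<beta> - 1))) \<tau>"
    by (rule nRL_cmult) measurable
  also have "\<dots> \<le> ennreal C * ennreal ((2 * (1 + 1 / (\<beta> * Gamma \<alpha>)) * 1 powr (-\<alpha>)) * (exp (1 * (\<tau> - t)) * (\<tau> - t) powr (\<beta> - 1)))"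
    using * by (intro mult_left_mono nRL_weight assms) auto
  also have "\<dots> = ennreal (C * ((2 * (1 + 1 / (\<beta> * Gamma \<alpha>))) * (exp (\<tau> - t) * (\<tau> - t) powr (\<beta> - 1))))"
    using * by (simp add: ennreal_mult')
  also have "\<dots> \<le> ennreal (C * ((2 * (1 + 1 / (\<beta> * Gamma \<alpha>))) * (exp T0 * (\<tau> - t) powr (\<beta> - 1))))"
    using * G assms by (intro ennreal_leI mult_left_mono mult_right_mono) auto
  also have "\<dots> = ennreal (RL_const \<alpha> \<beta> T0 * C * (\<tau> - t) powr (\<beta> - 1))" by (simp add: RL_const_def mult_ac)
  finally show ?thesis .
qed

lemma RL_set_integrable:
  fixes \<alpha> \<beta> t \<tau> C :: real
  assumes "0 < \<alpha>" "\<alpha> \<le> 1" "0 < \<beta>" "\<beta> \<le> 1" "t < \<tau>"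
    and m: "set_borel_measurable borel {t<..\<tau>} g"
    and b: "\<And>\<xi>. t < \<xi> \<Longrightarrow> \<xi> \<le> \<tau> \<Longrightarrow> \<bar>g \<xi>\<bar> \<le> C * (\<xi> - t) powr (\<beta> - 1)"
  shows "set_integrable lborel {t<..\<tau>} (\<lambda>\<xi>. g \<xi> * (\<tau> - \<xi>) powr (\<alpha> - 1))"
proof -
  have G: "Gamma \<alpha> > 0" using assms by (simp add: Gamma_real_pos)
  have C: "C \<ge> 0" using b[of \<tau>] assms by (smt (verit) mult_less_0_iff powr_gt_zero)
  have [measurable]: "(\<lambda>\<xi>. indicat_real {t<..\<tau>} \<xi> * g \<xi>) \<in> borel_measurable borel"
    using m unfolding set_borel_measurable_def by simp
  note K = nRL_powr_le[OF assms(1-5) order_refl C]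
  have eq: "indicat_real {t<..\<tau>} \<xi> *\<^sub>R (g \<xi> * (\<tau> - \<xi>) powr (\<alpha> - 1))
      = (indicat_real {t<..\<tau>} \<xi> * g \<xi>) * (\<tau> - \<xi>) powr (\<alpha> - 1)" for \<xi> by simp
  show ?thesis
    unfolding set_integrable_def eq
  proof (rule integrableI_bounded)
    have "(\<integral>\<^sup>+\<xi>. ennreal (norm ((indicat_real {t<..\<tau>} \<xi> * g \<xi>) * (\<tau> - \<xi>) powr (\<alpha> - 1))) \<partial>lborel)
      \<le> (\<integral>\<^sup>+\<xi>. ennreal (Gamma \<alpha>) * (ennreal (C * (\<xi> - t) powr (\<beta> - 1)) *
           ennreal ((\<tau> - \<xi>) powr (\<alpha> - 1) / Gamma \<alpha>) * indicator {t<..\<tau>} \<xi>) \<partial>lborel)"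
      using G C b by (intro nn_integral_mono)
        (auto simp: indicator_def ennreal_mult[symmetric] abs_mult intro!: ennreal_leI mult_right_mono)
    also have "\<dots> = ennreal (Gamma \<alpha>) * nRL \<alpha> t (\<lambda>\<xi>. ennreal (C * (\<xi> - t) powr (\<beta> - 1))) \<tau>"
      unfolding nRL_def by (rule nn_integral_cmult) measurable
    also have "\<dots> < \<infinity>" using K by (auto simp: ennreal_mult_less_top intro: le_less_trans)
    finally show "(\<integral>\<^sup>+\<xi>. ennreal (norm ((indicat_real {t<..\<tau>} \<xi> * g \<xi>) * (\<tau> - \<xi>) powr (\<alpha> - 1))) \<partial>lborel) < \<infinity>" .
  qed measurable
qed

definition volterra_const :: "real \<Rightarrow> real \<Rightarrow> real \<Rightarrow> real \<Rightarrow> real" where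
  "volterra_const \<alpha> \<beta> M T0 = 4 * exp (weight_rate \<alpha> \<beta> M * T0)"

lemma volterra_const_nonneg: "0 \<le> volterra_const \<alpha> \<beta> M T0"
  by (simp add: volterra_const_def)

text \<open>The singular Gronwall inequality: \<open>4C\<close> times the weight is a supersolution for \<open>|u| + C(\<tau> - t)\<^bsup>\<beta>-1\<^esup>\<close>.  The
  bound by \<open>B\<close> serves only to make \<open>u\<close> integrable and does not enter the conclusion.  The constant is the same for
  all base points, which later yields bounds that are uniform in the starting time.\<close>

lemma volterra_bound:
  assumes "0 < \<alpha>" "\<alpha> \<le> 1" "0 < \<beta>" "\<beta> \<le> 1" "M \<ge> 0"
    and T0: "T - t \<le> T0" and C: "0 \<le> C" and m: "set_borel_measurable borel {t<..T} u"
    and B: "\<And>\<tau>. t < \<tau> \<Longrightarrow> \<tau> \<le> T \<Longrightarrow> \<bar>u \<tau>\<bar> \<le> B * (\<tau> - t) powr (\<alpha> - 1)"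
    and u: "\<And>\<tau>. t < \<tau> \<Longrightarrow> \<tau> \<le> T \<Longrightarrow> u \<tau> = g \<tau> + RL \<alpha> t h \<tau>"
    and g: "\<And>\<tau>. t < \<tau> \<Longrightarrow> \<tau> \<le> T \<Longrightarrow> \<bar>g \<tau>\<bar> \<le> C * (\<tau> - t) powr (\<beta> - 1)"
    and h: "\<And>\<tau>. t < \<tau> \<Longrightarrow> \<tau> \<le> T \<Longrightarrow> \<bar>h \<tau>\<bar> \<le> M * (\<bar>u \<tau>\<bar> + C * (\<tau> - t) powr (\<beta> - 1))"
    and \<tau>: "t < \<tau>" "\<tau> \<le> T"
  shows "\<bar>u \<tau>\<bar> \<le> volterra_const \<alpha> \<beta> M T0 * C * (\<tau> - t) powr (\<beta> - 1)"
proof -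
  have G: "Gamma \<alpha> > 0" using assms by (simp add: Gamma_real_pos)
  define L where "L = weight_rate \<alpha> \<beta> M"
  have L: "L > 0" using assms G unfolding L_def weight_rate_def by (intro powr_minus_small) auto
  have [measurable]: "(\<lambda>\<xi>. indicat_real {t<..T} \<xi> * u \<xi>) \<in> borel_measurable borel"
    using m unfolding set_borel_measurable_def by simp
  define v where "v = (\<lambda>\<xi>. ennreal (\<bar>indicat_real {t<..T} \<xi> * u \<xi>\<bar> + C * (\<xi> - t) powr (\<beta> - 1)))"
  define w where "w = (\<lambda>\<xi>. exp (L * (\<xi> - t)) * (\<xi> - t) powr (\<beta> - 1))"
  have w0: "w \<xi> \<ge> 0" for \<xi> by (simp add: w_def)
  have [measurable]: "v \<in> borel_measurable borel" "w \<in> borel_measurable borel"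
    unfolding v_def w_def by measurable
  have "v \<tau> \<le> ennreal (4 * C) * ennreal (w \<tau>)"
  proof (rule nRL_comparison[OF assms(1,5) _ _ _ _ _ _ \<tau>, where e = "\<lambda>\<tau>. ennreal (2 * C * (\<tau> - t) powr (\<beta> - 1))"])
    show "v \<in> borel_measurable borel" "(\<lambda>\<tau>. ennreal (4 * C) * ennreal (w \<tau>)) \<in> borel_measurable borel" by measurable
    show "ennreal (4 * C) * ennreal (w \<tau>) < \<infinity>" for \<tau> by (simp add: ennreal_mult_less_top)
    have B0: "B \<ge> 0" using B[OF \<tau>] \<tau> by (smt (verit) mult_less_0_iff powr_gt_zero)
    have "(\<integral>\<^sup>+\<tau>. v \<tau> * indicator {t<..T} \<tau> \<partial>lborel)
      \<le> (\<integral>\<^sup>+\<tau>. ennreal B * (ennreal ((\<tau> - t) powr (\<alpha> - 1)) * indicator {t<..t+(T-t)} \<tau>)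
          + ennreal C * (ennreal ((\<tau> - t) powr (\<beta> - 1)) * indicator {t<..t+(T-t)} \<tau>) \<partial>lborel)"
      unfolding v_def using B B0 C
      by (intro nn_integral_mono) (auto simp: indicator_def ennreal_mult[symmetric] ennreal_plus[symmetric]
           simp del: ennreal_plus intro!: ennreal_leI)
    also have "\<dots> = ennreal B * ennreal ((T-t) powr \<alpha> / \<alpha>) + ennreal C * ennreal ((T-t) powr \<beta> / \<beta>)"
    proof -
      have Tt: "T - t \<ge> 0" using \<tau> by simp
      show ?thesis
        unfolding nn_integral_powr_shift[OF assms(1) Tt, of t, symmetric] nn_integral_powr_shift[OF assms(3) Tt, of t, symmetric]
        by (subst nn_integral_add, measurable) (simp add: nn_integral_cmult)
    qed
    also have "\<dots> < \<infinity>" by (simp add: ennreal_mult_less_top)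
    finally show "(\<integral>\<^sup>+\<tau>. v \<tau> * indicator {t<..T} \<tau> \<partial>lborel) < \<infinity>" .
  next
    fix \<tau> assume \<tau>: "t < \<tau>" "\<tau> \<le> T"
    have "ennreal \<bar>RL \<alpha> t h \<tau>\<bar> \<le> nRL \<alpha> t (\<lambda>\<xi>. ennreal \<bar>h \<xi>\<bar>) \<tau>" by (rule abs_RL_le) fact
    also have "\<dots> \<le> nRL \<alpha> t (\<lambda>\<xi>. ennreal M * v \<xi>) \<tau>"
      unfolding v_def using h assms C \<tau>
      by (intro nRL_mono) (auto simp: ennreal_mult[symmetric] simp del: ennreal_plus intro!: ennreal_leI)
    also have "\<dots> = ennreal M * nRL \<alpha> t v \<tau>" by (rule nRL_cmult) measurable
    finally have *: "ennreal \<bar>RL \<alpha> t h \<tau>\<bar> \<le> ennreal M * nRL \<alpha> t v \<tau>" .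
    have "v \<tau> \<le> ennreal (2 * C * (\<tau> - t) powr (\<beta> - 1) + \<bar>RL \<alpha> t h \<tau>\<bar>)"
      unfolding v_def using u[OF \<tau>] g[OF \<tau>] \<tau> by (intro ennreal_leI) auto
    also have "\<dots> = ennreal (2 * C * (\<tau> - t) powr (\<beta> - 1)) + ennreal \<bar>RL \<alpha> t h \<tau>\<bar>"
      using C by (intro ennreal_plus) auto
    also have "\<dots> \<le> ennreal (2 * C * (\<tau> - t) powr (\<beta> - 1)) + ennreal M * nRL \<alpha> t v \<tau>"
      by (intro add_left_mono *)
    finally show "v \<tau> \<le> ennreal (2 * C * (\<tau> - t) powr (\<beta> - 1)) + ennreal M * nRL \<alpha> t v \<tau>" .
    have "ennreal M * nRL \<alpha> t (\<lambda>\<tau>. ennreal (4 * C) * ennreal (w \<tau>)) \<tau>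
       = ennreal (4 * C) * (ennreal M * nRL \<alpha> t (\<lambda>\<xi>. ennreal (w \<xi>)) \<tau>)"
      by (subst nRL_cmult) (auto simp: ac_simps)
    also have "\<dots> \<le> ennreal (4 * C) * ennreal (1/2 * w \<tau>)"
      unfolding w_def by (intro mult_left_mono nRL_weight_half assms(1-5) L_def \<tau>) auto
    also have "\<dots> = ennreal (2 * C * w \<tau>)" using C w0 by (simp add: ennreal_mult[symmetric])
    finally have "ennreal (2 * C * (\<tau> - t) powr (\<beta> - 1)) + ennreal M * nRL \<alpha> t (\<lambda>\<tau>. ennreal (4 * C) * ennreal (w \<tau>)) \<tau>
       \<le> ennreal (2 * C * w \<tau>) + ennreal (2 * C * w \<tau>)"
      using C L \<tau> unfolding w_def
      by (intro add_mono ennreal_leI) (auto intro!: mult_left_mono)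
    also have "\<dots> = ennreal (4 * C) * ennreal (w \<tau>)"
      using C w0 by (simp add: ennreal_mult[symmetric] ennreal_plus[symmetric] del: ennreal_plus)
    finally show "ennreal (2 * C * (\<tau> - t) powr (\<beta> - 1)) + ennreal M * nRL \<alpha> t (\<lambda>\<tau>. ennreal (4 * C) * ennreal (w \<tau>)) \<tau>
       \<le> ennreal (4 * C) * ennreal (w \<tau>)" .
  qed
  also have "\<dots> = ennreal (4 * C * w \<tau>)" using C w0 by (simp add: ennreal_mult[symmetric])
  finally have "ennreal (\<bar>u \<tau>\<bar> + C * (\<tau> - t) powr (\<beta> - 1)) \<le> ennreal (4 * C * w \<tau>)"
    unfolding v_def using \<tau> by simp
  then have "\<bar>u \<tau>\<bar> + C * (\<tau> - t) powr (\<beta> - 1) \<le> 4 * C * w \<tau>"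
    using C w0 by (subst (asm) ennreal_le_iff) auto
  then have "\<bar>u \<tau>\<bar> \<le> 4 * C * w \<tau>" using C by (smt (verit) mult_nonneg_nonneg powr_ge_zero)
  also have "\<dots> \<le> 4 * C * (exp (L * T0) * (\<tau> - t) powr (\<beta> - 1))"
    unfolding w_def using C L T0 \<tau> by (intro mult_left_mono mult_right_mono) auto
  finally show ?thesis by (simp add: volterra_const_def L_def mult_ac)
qed

section \<open>The weighted Volterra equation\<close>

lemma powr_coeff_nonneg:
  fixes C y a :: real
  assumes "\<bar>x :: real\<bar> \<le> C * y powr a" "0 < y"
  shows "0 \<le> C"
proof -
  have "0 \<le> C * y powr a" using assms(1) by linarith
  then show ?thesis using assms(2) by (simp add: zero_le_mult_iff)
qed

lemma set_borel_measurable_continuous':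
  fixes g :: "real \<Rightarrow> real"
  assumes "continuous_on {t<..T} g" "\<tau> \<le> T"
  shows "set_borel_measurable borel {t<..\<tau>} g"
  by (rule set_measurable_continuous_on) (use assms in \<open>auto intro: continuous_on_subset\<close>)

lemma RL_diff:
  fixes \<alpha> \<beta> t \<tau> C C' :: real
  assumes "0 < \<alpha>" "\<alpha> \<le> 1" "0 < \<beta>" "\<beta> \<le> 1" "t < \<tau>"
    and "set_borel_measurable borel {t<..\<tau>} g" "\<And>\<xi>. t < \<xi> \<Longrightarrow> \<xi> \<le> \<tau> \<Longrightarrow> \<bar>g \<xi>\<bar> \<le> C * (\<xi> - t) powr (\<beta> - 1)"
    and "set_borel_measurable borel {t<..\<tau>} h" "\<And>\<xi>. t < \<xi> \<Longrightarrow> \<xi> \<le> \<tau> \<Longrightarrow> \<bar>h \<xi>\<bar> \<le> C' * (\<xi> - t) powr (\<beta> - 1)"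
  shows "RL \<alpha> t g \<tau> - RL \<alpha> t h \<tau> = RL \<alpha> t (\<lambda>\<xi>. g \<xi> - h \<xi>) \<tau>"
proof -
  note 1 = RL_set_integrable[OF assms(1-7)] RL_set_integrable[OF assms(1-5,8,9)]
  show ?thesis
    using set_integral_diff(2)[OF 1] by (simp add: RL_def diff_divide_distrib left_diff_distrib)
qed

lemma RL_cmult: "RL \<alpha> t (\<lambda>\<xi>. c * g \<xi>) \<tau> = c * RL \<alpha> t g \<tau>"
  unfolding RL_def by (simp add: mult.assoc)

lemma RL_cong:
  assumes "\<And>\<xi>. t < \<xi> \<Longrightarrow> \<xi> \<le> \<tau> \<Longrightarrow> g \<xi> = h \<xi>"
  shows "RL \<alpha> t g \<tau> = RL \<alpha> t h \<tau>"
  unfolding RL_def by (subst set_lebesgue_integral_cong[where g="\<lambda>\<xi>. h \<xi> * (\<tau> - \<xi>) powr (\<alpha> - 1)"]) (auto simp: assms)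

lemma RL_powr_bound:
  assumes "0 < \<alpha>" "\<alpha> \<le> 1" "0 < \<beta>" "\<beta> \<le> 1" and a: "t < \<tau>" "\<tau> - t \<le> T0" "0 \<le> C"
    and g: "\<And>\<xi>. t < \<xi> \<Longrightarrow> \<xi> \<le> \<tau> \<Longrightarrow> \<bar>g \<xi>\<bar> \<le> C * (\<xi> - t) powr (\<beta> - 1)"
  shows "\<bar>RL \<alpha> t g \<tau>\<bar> \<le> RL_const \<alpha> \<beta> T0 * C * (\<tau> - t) powr (\<beta> - 1)"
proof -
  have "ennreal \<bar>RL \<alpha> t g \<tau>\<bar> \<le> nRL \<alpha> t (\<lambda>\<xi>. ennreal \<bar>g \<xi>\<bar>) \<tau>" by (rule abs_RL_le) fact
  also have "\<dots> \<le> nRL \<alpha> t (\<lambda>\<xi>. ennreal (C * (\<xi> - t) powr (\<beta> - 1))) \<tau>"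
    by (intro nRL_mono ennreal_leI g)
  also have "\<dots> \<le> ennreal (RL_const \<alpha> \<beta> T0 * C * (\<tau> - t) powr (\<beta> - 1))" by (rule nRL_powr_le) fact+
  finally show ?thesis
    using RL_const_nonneg[OF assms(1,3), of T0] a by (subst (asm) ennreal_le_iff) auto
qed

lemma RL_dominated_convergence:
  fixes \<alpha> \<beta> t \<tau> C :: real
  assumes "0 < \<alpha>" "\<alpha> \<le> 1" "0 < \<beta>" "\<beta> \<le> 1" "t < \<tau>"
    and Gm: "\<And>n. set_borel_measurable borel {t<..\<tau>} (G n)"
    and b: "\<And>n \<xi>. t < \<xi> \<Longrightarrow> \<xi> \<le> \<tau> \<Longrightarrow> \<bar>G n \<xi>\<bar> \<le> C * (\<xi> - t) powr (\<beta> - 1)"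
    and gm: "set_borel_measurable borel {t<..\<tau>} g"
    and lim: "\<And>\<xi>. t < \<xi> \<Longrightarrow> \<xi> \<le> \<tau> \<Longrightarrow> (\<lambda>n. G n \<xi>) \<longlonglongrightarrow> g \<xi>"
  shows "(\<lambda>n. RL \<alpha> t (G n) \<tau>) \<longlonglongrightarrow> RL \<alpha> t g \<tau>"
proof -
  have G: "Gamma \<alpha> > 0" using assms by (simp add: Gamma_real_pos)
  have [measurable]: "(\<lambda>\<xi>. indicat_real {t<..\<tau>} \<xi> * g \<xi>) \<in> borel_measurable borel"
     "(\<lambda>\<xi>. indicat_real {t<..\<tau>} \<xi> * G n \<xi>) \<in> borel_measurable borel" for n
    using Gm gm unfolding set_borel_measurable_def by simp_all
  have eq: "indicat_real {t<..\<tau>} \<xi> *\<^sub>R (f \<xi> * (\<tau> - \<xi>) powr (\<alpha> - 1))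
      = (indicat_real {t<..\<tau>} \<xi> * f \<xi>) * (\<tau> - \<xi>) powr (\<alpha> - 1)" for f \<xi> by simp
  have C: "C \<ge> 0" using powr_coeff_nonneg[OF b[of \<tau>]] \<open>t < \<tau>\<close> by simp
  have "set_integrable lborel {t<..\<tau>} (\<lambda>\<xi>. (C * (\<xi> - t) powr (\<beta> - 1)) * (\<tau> - \<xi>) powr (\<alpha> - 1))"
    by (rule RL_set_integrable[OF assms(1-5), where C=C])
       (use C in \<open>auto simp: set_borel_measurable_def\<close>)
  then have w: "integrable lborel (\<lambda>\<xi>. indicat_real {t<..\<tau>} \<xi> * (C * (\<xi> - t) powr (\<beta> - 1) * (\<tau> - \<xi>) powr (\<alpha> - 1)))"
    unfolding set_integrable_def by simp
  have "(\<lambda>n. \<integral>\<xi>. (indicat_real {t<..\<tau>} \<xi> * G n \<xi>) * (\<tau> - \<xi>) powr (\<alpha> - 1) \<partial>lborel)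
     \<longlonglongrightarrow> (\<integral>\<xi>. (indicat_real {t<..\<tau>} \<xi> * g \<xi>) * (\<tau> - \<xi>) powr (\<alpha> - 1) \<partial>lborel)"
  proof (rule integral_dominated_convergence[OF _ _ w])
    show "AE \<xi> in lborel. (\<lambda>n. (indicat_real {t<..\<tau>} \<xi> * G n \<xi>) * (\<tau> - \<xi>) powr (\<alpha> - 1))
       \<longlonglongrightarrow> (indicat_real {t<..\<tau>} \<xi> * g \<xi>) * (\<tau> - \<xi>) powr (\<alpha> - 1)"
      using lim by (intro AE_I2) (auto simp: indicator_def intro!: tendsto_intros)
    show "AE \<xi> in lborel. norm ((indicat_real {t<..\<tau>} \<xi> * G n \<xi>) * (\<tau> - \<xi>) powr (\<alpha> - 1))
       \<le> indicat_real {t<..\<tau>} \<xi> * (C * (\<xi> - t) powr (\<beta> - 1) * (\<tau> - \<xi>) powr (\<alpha> - 1))" for n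
      using b by (intro AE_I2) (auto simp: indicator_def abs_mult intro!: mult_right_mono)
  qed measurable
  then show ?thesis
    unfolding RL_def set_lebesgue_integral_def eq using G by (intro tendsto_divide tendsto_const) auto
qed

text \<open>The substitution \<open>\<xi> = t + (\<tau> - t)u\<close> moves the integral to the fixed interval \<open>[0, 1]\<close>, where the Beta kernel
  dominates.  The factor \<open>(\<tau> - t)\<^bsup>1-\<alpha>\<^esup>\<close> is put under the integral to cancel the singularity of \<open>g\<close>.\<close>

lemma continuous_on_RL:
  fixes \<alpha> t T C :: real
  assumes "0 < \<alpha>" "\<alpha> \<le> 1"
    and g: "continuous_on {t<..T} g"
    and b: "\<And>\<xi>. t < \<xi> \<Longrightarrow> \<xi> \<le> T \<Longrightarrow> \<bar>g \<xi>\<bar> \<le> C * (\<xi> - t) powr (\<alpha> - 1)"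
  shows "continuous_on {t<..T} (RL \<alpha> t g)"
proof (cases "t < T")
  case True
  have G: "Gamma \<alpha> > 0" using assms by (simp add: Gamma_real_pos)
  have [measurable]: "(\<lambda>\<xi>. indicat_real {t<..T} \<xi> * g \<xi>) \<in> borel_measurable borel"
    using set_borel_measurable_continuous'[OF g order_refl] unfolding set_borel_measurable_def by simp
  define F where "F = (\<lambda>\<tau> u. indicat_real {0<..1} u * ((\<tau> - t) powr (1 - \<alpha>) *
     (indicat_real {t<..T} (t + (\<tau> - t) * u) * g (t + (\<tau> - t) * u)) * (1 - u) powr (\<alpha> - 1)))"
  have [measurable]: "F \<tau> \<in> borel_measurable borel" for \<tau> unfolding F_def
    by measurable
  have in_iv: "t < t + (\<tau> - t) * u" "t + (\<tau> - t) * u \<le> T" if "\<tau> \<in> {t<..T}" "u \<in> {0<..1}" for \<tau> u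
  proof -
    have "t + (\<tau> - t) * u \<le> t + (\<tau> - t) * 1" using that by (intro add_left_mono mult_left_mono) auto
    also have "\<dots> \<le> T" using that by simp
    finally show "t + (\<tau> - t) * u \<le> T" .
    show "t < t + (\<tau> - t) * u" using that by auto
  qed
  have eq: "RL \<alpha> t g \<tau> = (\<tau> - t) powr (2 * \<alpha> - 1) * (\<integral>u. F \<tau> u \<partial>lborel) / Gamma \<alpha>" if "\<tau> \<in> {t<..T}" for \<tau>
  proof -
    have c: "\<tau> - t > 0" using that by simp
    have "(LBINT \<xi>:{t<..\<tau>}. g \<xi> * (\<tau> - \<xi>) powr (\<alpha> - 1))
      = \<bar>\<tau> - t\<bar> *\<^sub>R (\<integral>u. indicat_real {t<..\<tau>} (t + (\<tau> - t) * u) *\<^sub>R (g (t + (\<tau> - t) * u) * (\<tau> - (t + (\<tau> - t) * u)) powr (\<alpha> - 1)) \<partial>lborel)"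
      unfolding set_lebesgue_integral_def by (rule lborel_integral_real_affine) (use c in simp)
    also have "(\<integral>u. indicat_real {t<..\<tau>} (t + (\<tau> - t) * u) *\<^sub>R (g (t + (\<tau> - t) * u) * (\<tau> - (t + (\<tau> - t) * u)) powr (\<alpha> - 1)) \<partial>lborel)
       = (\<integral>u. (\<tau> - t) powr (2 * \<alpha> - 2) * F \<tau> u \<partial>lborel)"
    proof (rule Bochner_Integration.integral_cong[OF refl])
      fix u :: real
      show "indicat_real {t<..\<tau>} (t + (\<tau> - t) * u) *\<^sub>R (g (t + (\<tau> - t) * u) * (\<tau> - (t + (\<tau> - t) * u)) powr (\<alpha> - 1))
        = (\<tau> - t) powr (2 * \<alpha> - 2) * F \<tau> u"
      proof (cases "u \<in> {0<..1}")
        case True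
        have "\<tau> - (t + (\<tau> - t) * u) = (\<tau> - t) * (1 - u)" by (simp add: algebra_simps)
        then have "(\<tau> - (t + (\<tau> - t) * u)) powr (\<alpha> - 1) = (\<tau> - t) powr (\<alpha> - 1) * (1 - u) powr (\<alpha> - 1)"
          using True c by (simp add: powr_mult)
        moreover have "(\<tau> - t) powr (2 * \<alpha> - 2) * (\<tau> - t) powr (1 - \<alpha>) = (\<tau> - t) powr (\<alpha> - 1)"
          by (simp add: powr_add[symmetric])
        moreover have "t + (\<tau> - t) * u \<in> {t<..\<tau>}" using True c mult_left_mono[of u 1 "\<tau> - t"]
          by (simp only: greaterThanAtMost_iff) (auto simp: algebra_simps)
        moreover have "t + (\<tau> - t) * u \<in> {t<..T}" using in_iv[OF that True] by simp
        ultimately show ?thesis unfolding F_def using True by (simp add: mult_ac)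
      next
        case False
        then have "t + (\<tau> - t) * u \<notin> {t<..\<tau>}" using c
          by (auto simp: mult_le_cancel_left1 zero_less_mult_iff add.commute[of t] le_diff_eq[symmetric])
        then show ?thesis using False by (simp add: F_def)
      qed
    qed
    also have "\<bar>\<tau> - t\<bar> *\<^sub>R \<dots> = (\<tau> - t) powr (2 * \<alpha> - 1) * (\<integral>u. F \<tau> u \<partial>lborel)"
      using c powr_add[of "\<tau> - t" 1 "2 * \<alpha> - 2"] by simp
    finally show ?thesis unfolding RL_def by simp
  qed
  have "continuous_on {t<..T} (\<lambda>\<tau>. \<integral>u. F \<tau> u \<partial>lborel)"
    unfolding continuous_on_sequentially
  proof (intro allI ballI impI, elim conjE)
    fix x a assume a: "a \<in> {t<..T}" and xn: "\<forall>n. x n \<in> {t<..T}" and x: "x \<longlonglongrightarrow> a"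
    have w: "integrable lborel (\<lambda>u. C * (indicat_real {0..1} u * (u powr (\<alpha> - 1) * (1 - u) powr (\<alpha> - 1))))"
      using integrable_Beta[OF assms(1) assms(1)] unfolding set_integrable_def by simp
    have "(\<lambda>n. \<integral>u. F (x n) u \<partial>lborel) \<longlonglongrightarrow> (\<integral>u. F a u \<partial>lborel)"
    proof (rule integral_dominated_convergence[OF _ _ w])
      show "AE u in lborel. (\<lambda>n. F (x n) u) \<longlonglongrightarrow> F a u"
      proof (intro AE_I2)
        fix u
        show "(\<lambda>n. F (x n) u) \<longlonglongrightarrow> F a u"
        proof (cases "u \<in> {0<..1}")
          case True
          have "(\<lambda>n. g (t + (x n - t) * u)) \<longlonglongrightarrow> g (t + (a - t) * u)"
            by (rule continuous_on_tendsto_compose[OF g])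
               (use x in_iv[OF _ True] a xn in \<open>auto intro!: tendsto_intros\<close>)
          then have "(\<lambda>n. (x n - t) powr (1 - \<alpha>) * g (t + (x n - t) * u) * (1 - u) powr (\<alpha> - 1))
             \<longlonglongrightarrow> (a - t) powr (1 - \<alpha>) * g (t + (a - t) * u) * (1 - u) powr (\<alpha> - 1)"
            using x a by (intro tendsto_intros) auto
          moreover have "F (x n) u = (x n - t) powr (1 - \<alpha>) * g (t + (x n - t) * u) * (1 - u) powr (\<alpha> - 1)" for n
            using True in_iv[OF xn[rule_format, of n] True] by (simp add: F_def)
          moreover have "F a u = (a - t) powr (1 - \<alpha>) * g (t + (a - t) * u) * (1 - u) powr (\<alpha> - 1)"
            using True in_iv[OF a True] by (simp add: F_def)
          ultimately show ?thesis by simp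
        qed (simp add: F_def)
      qed
      show "AE u in lborel. norm (F (x n) u) \<le> C * (indicat_real {0..1} u * (u powr (\<alpha> - 1) * (1 - u) powr (\<alpha> - 1)))" for n
      proof (intro AE_I2)
        fix u
        show "norm (F (x n) u) \<le> C * (indicat_real {0..1} u * (u powr (\<alpha> - 1) * (1 - u) powr (\<alpha> - 1)))"
        proof (cases "u \<in> {0<..1}")
          case True
          have c: "x n - t > 0" using xn by (auto dest: spec[of _ n])
          note iv = in_iv[OF xn[rule_format, of n] True]
          have "\<bar>g (t + (x n - t) * u)\<bar> \<le> C * ((x n - t) * u) powr (\<alpha> - 1)"
            using b[OF iv] by simp
          also have "\<dots> = C * (x n - t) powr (\<alpha> - 1) * u powr (\<alpha> - 1)"
            using c True by (simp add: powr_mult)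
          finally have "(x n - t) powr (1 - \<alpha>) * \<bar>g (t + (x n - t) * u)\<bar>
             \<le> (x n - t) powr (1 - \<alpha>) * (C * (x n - t) powr (\<alpha> - 1) * u powr (\<alpha> - 1))"
            by (intro mult_left_mono) auto
          also have "\<dots> = C * u powr (\<alpha> - 1)"
            using c powr_add[of "x n - t" "1-\<alpha>" "\<alpha> - 1"] by simp
          finally have "(x n - t) powr (1 - \<alpha>) * \<bar>g (t + (x n - t) * u)\<bar> * (1 - u) powr (\<alpha> - 1)
             \<le> C * u powr (\<alpha> - 1) * (1 - u) powr (\<alpha> - 1)" by (intro mult_right_mono) auto
          then show ?thesis using True iv by (simp add: F_def abs_mult mult_ac)
        next
          case False
          have "C \<ge> 0" using powr_coeff_nonneg[OF b[of T]] \<open>t < T\<close> by simp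
          then show ?thesis using False by (simp add: F_def)
        qed
      qed
    qed measurable
    then show "((\<lambda>\<tau>. \<integral>u. F \<tau> u \<partial>lborel) \<circ> x) \<longlonglongrightarrow> (\<integral>u. F a u \<partial>lborel)" by (simp add: o_def)
  qed
  then have "continuous_on {t<..T} (\<lambda>\<tau>. (\<tau> - t) powr (2 * \<alpha> - 1) * (\<integral>u. F \<tau> u \<partial>lborel) / Gamma \<alpha>)"
    using G by (intro continuous_intros) auto
  then show ?thesis by (rule continuous_on_eq) (simp add: eq)
qed simp

lemma LINT_lebesgue_eq_RL:
  assumes "set_borel_measurable borel {t<..\<tau>} g"
  shows "1 / Gamma \<alpha> * (LINT \<xi>:{t<..\<tau>}|lebesgue. g \<xi> / (\<tau> - \<xi>) powr (1 - \<alpha>)) = RL \<alpha> t g \<tau>"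
proof -
  have [measurable]: "(\<lambda>\<xi>. indicat_real {t<..\<tau>} \<xi> * g \<xi>) \<in> borel_measurable borel"
    using assms unfolding set_borel_measurable_def by simp
  have eq: "indicat_real {t<..\<tau>} \<xi> *\<^sub>R (g \<xi> / (\<tau> - \<xi>) powr (1 - \<alpha>))
      = (indicat_real {t<..\<tau>} \<xi> * g \<xi>) * (\<tau> - \<xi>) powr (\<alpha> - 1)"
     "indicat_real {t<..\<tau>} \<xi> *\<^sub>R (g \<xi> * (\<tau> - \<xi>) powr (\<alpha> - 1))
      = (indicat_real {t<..\<tau>} \<xi> * g \<xi>) * (\<tau> - \<xi>) powr (\<alpha> - 1)" for \<xi>
    using powr_minus_divide[of "\<tau> - \<xi>" "1 - \<alpha>"] by simp_all
  show ?thesis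
    unfolding RL_def set_lebesgue_integral_def eq
    by (subst integral_completion) simp_all
qed

text \<open>The equation \<open>u = g + I\<^sup>\<alpha> h(\<cdot>, u)\<close> with data that may be as singular as \<open>(\<tau> - t)\<^bsup>\<alpha>-1\<^esup>\<close> at the base point.
  It covers the Cauchy problem, with a truncated right-hand side, as well as both linear equations of the theorem.\<close>

locale weighted_volterra =
  fixes \<alpha> t T M C :: real and g :: "real \<Rightarrow> real" and h :: "real \<Rightarrow> real \<Rightarrow> real"
  assumes alpha: "0 < \<alpha>" "\<alpha> \<le> 1" and tT: "t < T" and M0: "0 \<le> M"
    and g_cont: "continuous_on {t<..T} g"
    and g_bound: "\<And>\<tau>. t < \<tau> \<Longrightarrow> \<tau> \<le> T \<Longrightarrow> \<bar>g \<tau>\<bar> \<le> C * (\<tau> - t) powr (\<alpha> - 1)"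
    and h_cont: "\<And>u. continuous_on {t<..T} u \<Longrightarrow> continuous_on {t<..T} (\<lambda>\<xi>. h \<xi> (u \<xi>))"
    and h_lip: "\<And>\<xi> y z. t < \<xi> \<Longrightarrow> \<xi> \<le> T \<Longrightarrow> \<bar>h \<xi> y - h \<xi> z\<bar> \<le> M * \<bar>y - z\<bar>"
    and h_zero: "\<And>\<xi>. t < \<xi> \<Longrightarrow> \<xi> \<le> T \<Longrightarrow> \<bar>h \<xi> 0\<bar> \<le> C * (\<xi> - t) powr (\<alpha> - 1)"
begin

definition solution :: "(real \<Rightarrow> real) \<Rightarrow> bool" where
  "solution u \<longleftrightarrow> continuous_on {t<..T} u \<and>
     (\<exists>B. \<forall>\<tau>\<in>{t<..T}. \<bar>u \<tau>\<bar> \<le> B * (\<tau> - t) powr (\<alpha> - 1)) \<and>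
     (\<forall>\<tau>\<in>{t<..T}. u \<tau> = g \<tau> + RL \<alpha> t (\<lambda>\<xi>. h \<xi> (u \<xi>)) \<tau>)"

lemma C0: "0 \<le> C"
  using powr_coeff_nonneg[OF g_bound[of T]] tT by simp

lemma h_bound:
  assumes "t < \<xi>" "\<xi> \<le> T" "\<bar>y\<bar> \<le> B * (\<xi> - t) powr (\<alpha> - 1)"
  shows "\<bar>h \<xi> y\<bar> \<le> (M * B + C) * (\<xi> - t) powr (\<alpha> - 1)"
proof -
  have "\<bar>h \<xi> y\<bar> \<le> M * \<bar>y - 0\<bar> + C * (\<xi> - t) powr (\<alpha> - 1)"
    using h_lip[OF assms(1,2), of y 0] h_zero[OF assms(1,2)] by linarith
  also have "\<dots> \<le> M * (B * (\<xi> - t) powr (\<alpha> - 1)) + C * (\<xi> - t) powr (\<alpha> - 1)"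
    using mult_left_mono[OF assms(3) M0] by simp
  finally show ?thesis by (simp add: algebra_simps)
qed

fun picard :: "nat \<Rightarrow> real \<Rightarrow> real" where
  "picard 0 = (\<lambda>_. 0)"
| "picard (Suc n) = (\<lambda>\<tau>. g \<tau> + RL \<alpha> t (\<lambda>\<xi>. h \<xi> (picard n \<xi>)) \<tau>)"

lemma picard_bound_continuous:
  "continuous_on {t<..T} (picard n) \<and> (\<exists>B\<ge>0. \<forall>\<tau>\<in>{t<..T}. \<bar>picard n \<tau>\<bar> \<le> B * (\<tau> - t) powr (\<alpha> - 1))"
proof (induction n)
  case 0
  then show ?case by (auto intro!: exI[of _ 0])
next
  case (Suc n)
  then obtain B where B: "B \<ge> 0" "\<And>\<tau>. t < \<tau> \<Longrightarrow> \<tau> \<le> T \<Longrightarrow> \<bar>picard n \<tau>\<bar> \<le> B * (\<tau> - t) powr (\<alpha> - 1)"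
    by auto
  have hc: "continuous_on {t<..T} (\<lambda>\<xi>. h \<xi> (picard n \<xi>))" using Suc h_cont by blast
  have hb: "\<bar>h \<xi> (picard n \<xi>)\<bar> \<le> (M * B + C) * (\<xi> - t) powr (\<alpha> - 1)" if "t < \<xi>" "\<xi> \<le> T" for \<xi>
    using h_bound[OF that B(2)] that by simp
  define K where "K = RL_const \<alpha> \<alpha> (T - t)"
  have K: "K \<ge> 0" unfolding K_def using alpha by (intro RL_const_nonneg)
  have "continuous_on {t<..T} (picard (Suc n))"
    unfolding picard.simps using continuous_on_RL[OF alpha hc hb] g_cont by (intro continuous_on_add) auto
  moreover have "\<bar>picard (Suc n) \<tau>\<bar> \<le> (C + K * (M * B + C)) * (\<tau> - t) powr (\<alpha> - 1)" if "\<tau> \<in> {t<..T}" for \<tau>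
  proof -
    have "\<bar>RL \<alpha> t (\<lambda>\<xi>. h \<xi> (picard n \<xi>)) \<tau>\<bar> \<le> K * (M * B + C) * (\<tau> - t) powr (\<alpha> - 1)"
      unfolding K_def using that hb M0 B C0 alpha by (intro RL_powr_bound) auto
    then show ?thesis using g_bound[of \<tau>] that by (simp add: algebra_simps)
  qed
  moreover have "C + K * (M * B + C) \<ge> 0" using K C0 M0 B by simp
  ultimately show ?case by blast
qed

text \<open>In the weight of \<open>nRL_weight_half\<close> consecutive Picard iterates differ by a quantity of order \<open>2\<^bsup>-n\<^esup>\<close>, so that they converge
  uniformly relative to the weight.\<close>

lemma ex_solution: "\<exists>u. solution u"
proof -
  define L where "L = weight_rate \<alpha> \<alpha> M"
  have L: "L > 0" using alpha M0 unfolding L_def weight_rate_def by (intro powr_minus_small) auto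
  define w where "w = (\<lambda>\<tau>. exp (L * (\<tau> - t)) * (\<tau> - t) powr (\<alpha> - 1))"
  have w0: "w \<tau> > 0" if "t < \<tau>" for \<tau> using that by (simp add: w_def)
  have w_ge: "(\<tau> - t) powr (\<alpha> - 1) \<le> w \<tau>" if "t < \<tau>" for \<tau>
    using that L mult_right_mono[of 1 "exp (L * (\<tau> - t))" "(\<tau> - t) powr (\<alpha> - 1)"] by (simp add: w_def)
  obtain B where B: "B \<ge> 0" "\<And>\<tau>. t < \<tau> \<Longrightarrow> \<tau> \<le> T \<Longrightarrow> \<bar>picard 1 \<tau>\<bar> \<le> B * (\<tau> - t) powr (\<alpha> - 1)"
    using picard_bound_continuous[of 1] by auto
  have pc: "continuous_on {t<..T} (picard n)" for n using picard_bound_continuous by blast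
  have hpm: "set_borel_measurable borel {t<..\<tau>} (\<lambda>\<xi>. h \<xi> (picard n \<xi>))" if "\<tau> \<le> T" for n \<tau>
    by (rule set_borel_measurable_continuous'[OF h_cont[OF pc] that])
  have diff: "\<bar>picard (Suc n) \<tau> - picard n \<tau>\<bar> \<le> (1/2)^n * B * w \<tau>" if "t < \<tau>" "\<tau> \<le> T" for n \<tau>
    using that
  proof (induction n arbitrary: \<tau>)
    case 0
    have "\<bar>picard 1 \<tau>\<bar> \<le> B * (\<tau> - t) powr (\<alpha> - 1)" using B 0 by blast
    also have "\<dots> \<le> B * w \<tau>" using w_ge 0 B by (intro mult_left_mono) auto
    finally show ?case by simp
  next
    case (Suc n)
    obtain B1 where "\<forall>\<tau>\<in>{t<..T}. \<bar>picard (Suc n) \<tau>\<bar> \<le> B1 * (\<tau> - t) powr (\<alpha> - 1)"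
      using picard_bound_continuous[of "Suc n"] by blast
    then have B1: "\<bar>picard (Suc n) \<tau>\<bar> \<le> B1 * (\<tau> - t) powr (\<alpha> - 1)" if "t < \<tau>" "\<tau> \<le> T" for \<tau>
      using that by (simp del: picard.simps)
    obtain B2 where "\<forall>\<tau>\<in>{t<..T}. \<bar>picard n \<tau>\<bar> \<le> B2 * (\<tau> - t) powr (\<alpha> - 1)"
      using picard_bound_continuous[of n] by blast
    then have B2: "\<bar>picard n \<tau>\<bar> \<le> B2 * (\<tau> - t) powr (\<alpha> - 1)" if "t < \<tau>" "\<tau> \<le> T" for \<tau>
      using that by (simp del: picard.simps)
    have "picard (Suc (Suc n)) \<tau> - picard (Suc n) \<tau>
      = RL \<alpha> t (\<lambda>\<xi>. h \<xi> (picard (Suc n) \<xi>)) \<tau> - RL \<alpha> t (\<lambda>\<xi>. h \<xi> (picard n \<xi>)) \<tau>"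
      by (subst picard.simps, subst (2) picard.simps) simp
    also have "\<dots> = RL \<alpha> t (\<lambda>\<xi>. h \<xi> (picard (Suc n) \<xi>) - h \<xi> (picard n \<xi>)) \<tau>"
      by (rule RL_diff[OF alpha alpha, where C="M * B1 + C" and C'="M * B2 + C"])
         (use Suc.prems hpm B1 B2 h_bound in \<open>auto simp del: picard.simps\<close>)
    finally have "ennreal \<bar>picard (Suc (Suc n)) \<tau> - picard (Suc n) \<tau>\<bar>
      \<le> nRL \<alpha> t (\<lambda>\<xi>. ennreal \<bar>h \<xi> (picard (Suc n) \<xi>) - h \<xi> (picard n \<xi>)\<bar>) \<tau>"
      using abs_RL_le[OF alpha(1)] by simp
    also have "\<dots> \<le> nRL \<alpha> t (\<lambda>\<xi>. ennreal ((1/2)^n * B) * (ennreal M * ennreal (w \<xi>))) \<tau>"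
    proof (rule nRL_mono)
      fix \<xi> assume \<xi>: "t < \<xi>" "\<xi> \<le> \<tau>"
      then have \<xi>T: "\<xi> \<le> T" using Suc.prems by simp
      have "\<bar>h \<xi> (picard (Suc n) \<xi>) - h \<xi> (picard n \<xi>)\<bar> \<le> M * \<bar>picard (Suc n) \<xi> - picard n \<xi>\<bar>"
        by (rule h_lip) (use \<xi> \<xi>T in auto)
      also have "\<dots> \<le> M * ((1/2)^n * B * w \<xi>)"
        using Suc.IH[OF \<xi>(1) \<xi>T] M0 by (rule mult_left_mono)
      finally show "ennreal \<bar>h \<xi> (picard (Suc n) \<xi>) - h \<xi> (picard n \<xi>)\<bar>
         \<le> ennreal ((1/2)^n * B) * (ennreal M * ennreal (w \<xi>))"
        using M0 B w0[OF \<xi>(1)] by (simp add: ennreal_mult[symmetric] mult_ac ennreal_leI del: picard.simps)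
    qed
    also have "\<dots> = ennreal ((1/2)^n * B) * (ennreal M * nRL \<alpha> t (\<lambda>\<xi>. ennreal (w \<xi>)) \<tau>)"
      unfolding w_def by (subst nRL_cmult, measurable)+
    also have "\<dots> \<le> ennreal ((1/2)^n * B) * ennreal (1/2 * w \<tau>)"
      unfolding w_def by (intro mult_left_mono nRL_weight_half alpha M0 L_def Suc.prems) simp
    also have "\<dots> = ennreal ((1/2)^Suc n * B * w \<tau>)"
      using B w0[OF Suc.prems(1)] by (simp add: ennreal_mult[symmetric] mult_ac)
    finally show ?case using B w0[OF Suc.prems(1)]
      by (subst (asm) ennreal_le_iff) (auto simp del: picard.simps)
  qed
  define S where "S = {t<..T}"
  define s where "s = (\<lambda>n \<tau>. (picard (Suc n) \<tau> - picard n \<tau>) / w \<tau>)"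
  have sb: "norm (s n \<tau>) \<le> B * (1/2)^n" if "\<tau> \<in> S" for n \<tau>
    using diff[of \<tau> n] that w0[of \<tau>] unfolding s_def S_def
    by (simp add: abs_div divide_le_eq mult_ac del: picard.simps)
  have summ: "summable (\<lambda>n. B * (1/2::real)^n)" by (intro summable_mult summable_geometric) simp
  have "uniform_limit S (\<lambda>n x. \<Sum>i<n. s i x) (\<lambda>x. suminf (\<lambda>i. s i x)) sequentially"
    by (rule Weierstrass_m_test[OF sb summ])
  moreover have sums: "(\<Sum>i<n. s i \<tau>) = picard n \<tau> / w \<tau>" for n \<tau>
    unfolding s_def by (subst sum_divide_distrib[symmetric], subst sum_lessThan_telescope) simp
  ultimately have ul: "uniform_limit S (\<lambda>n \<tau>. picard n \<tau> / w \<tau>) (\<lambda>x. suminf (\<lambda>i. s i x)) sequentially"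
    by simp
  define u where "u = (\<lambda>\<tau>. w \<tau> * suminf (\<lambda>i. s i \<tau>))"
  have wc: "continuous_on S w" unfolding w_def S_def by (intro continuous_intros) auto
  have "continuous_on S (\<lambda>x. suminf (\<lambda>i. s i x))"
    by (rule uniform_limit_theorem[OF _ ul])
       (use pc wc in \<open>auto simp: S_def w_def intro!: always_eventually continuous_on_divide\<close>)
  then have uc: "continuous_on {t<..T} u" unfolding u_def using wc S_def by (auto intro: continuous_on_mult)
  have lim: "(\<lambda>n. picard n \<tau>) \<longlonglongrightarrow> u \<tau>" if "\<tau> \<in> S" for \<tau>
  proof -
    have "(\<lambda>n. picard n \<tau> / w \<tau>) \<longlonglongrightarrow> suminf (\<lambda>i. s i \<tau>)" by (rule tendsto_uniform_limitI[OF ul that])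
    then have "(\<lambda>n. w \<tau> * (picard n \<tau> / w \<tau>)) \<longlonglongrightarrow> u \<tau>" unfolding u_def by (intro tendsto_intros)
    then show ?thesis using w0[of \<tau>] that by (simp add: S_def)
  qed
  have pb: "\<bar>picard n \<tau>\<bar> \<le> (2 * B * exp (L * (T - t))) * (\<tau> - t) powr (\<alpha> - 1)" if "t < \<tau>" "\<tau> \<le> T" for n \<tau>
  proof -
    have "\<bar>\<Sum>i<n. s i \<tau>\<bar> \<le> (\<Sum>i<n. B * (1/2)^i)"
      using sb[of \<tau>] that by (intro order_trans[OF sum_abs] sum_mono) (auto simp: S_def)
    also have "\<dots> \<le> (\<Sum>i. B * (1/2)^i)" by (rule sum_le_suminf[OF summ]) (use B in auto)
    also have "\<dots> = B * 2" by (subst suminf_mult) (auto simp: suminf_geometric)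
    finally have "\<bar>picard n \<tau>\<bar> \<le> 2 * B * w \<tau>"
      using w0[OF that(1)] unfolding sums by (simp add: abs_div divide_le_eq mult_ac)
    also have "\<dots> \<le> 2 * B * (exp (L * (T - t)) * (\<tau> - t) powr (\<alpha> - 1))"
      unfolding w_def using B L that by (intro mult_left_mono mult_right_mono) auto
    finally show ?thesis by (simp add: mult_ac)
  qed
  have ub: "\<bar>u \<tau>\<bar> \<le> (2 * B * exp (L * (T - t))) * (\<tau> - t) powr (\<alpha> - 1)" if "t < \<tau>" "\<tau> \<le> T" for \<tau>
    by (rule tendsto_upperbound[OF tendsto_rabs[OF lim]]) (use that pb in \<open>auto simp: S_def\<close>)
  have "u \<tau> = g \<tau> + RL \<alpha> t (\<lambda>\<xi>. h \<xi> (u \<xi>)) \<tau>" if "\<tau> \<in> {t<..T}" for \<tau>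
  proof -
    have "(\<lambda>n. RL \<alpha> t (\<lambda>\<xi>. h \<xi> (picard n \<xi>)) \<tau>) \<longlonglongrightarrow> RL \<alpha> t (\<lambda>\<xi>. h \<xi> (u \<xi>)) \<tau>"
    proof (rule RL_dominated_convergence[OF alpha alpha])
      show "t < \<tau>" using that by simp
      show "set_borel_measurable borel {t<..\<tau>} (\<lambda>\<xi>. h \<xi> (picard n \<xi>))" for n using hpm that by simp
      show "set_borel_measurable borel {t<..\<tau>} (\<lambda>\<xi>. h \<xi> (u \<xi>))"
        using set_borel_measurable_continuous'[OF h_cont[OF uc]] that by simp
      show "\<bar>h \<xi> (picard n \<xi>)\<bar> \<le> (M * (2 * B * exp (L * (T - t))) + C) * (\<xi> - t) powr (\<alpha> - 1)"
        if "t < \<xi>" "\<xi> \<le> \<tau>" for n \<xi>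
        using h_bound[OF _ _ pb] that \<open>\<tau> \<in> {t<..T}\<close> by simp
      fix \<xi> assume \<xi>: "t < \<xi>" "\<xi> \<le> \<tau>"
      have "(\<lambda>n. picard n \<xi> - u \<xi>) \<longlonglongrightarrow> 0"
        using lim[of \<xi>] \<xi> that by (auto simp: S_def LIM_zero_iff)
      then have l0: "(\<lambda>n. M * \<bar>picard n \<xi> - u \<xi>\<bar>) \<longlonglongrightarrow> 0"
        by (intro tendsto_mult_right_zero tendsto_rabs_zero)
      have "(\<lambda>n. h \<xi> (picard n \<xi>) - h \<xi> (u \<xi>)) \<longlonglongrightarrow> 0"
        by (rule Lim_null_comparison[OF _ l0])
           (use h_lip[of \<xi>] \<xi> that in \<open>auto intro!: always_eventually\<close>)
      then show "(\<lambda>n. h \<xi> (picard n \<xi>)) \<longlonglongrightarrow> h \<xi> (u \<xi>)" by (simp add: LIM_zero_iff)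
    qed
    then have "(\<lambda>n. picard (Suc n) \<tau>) \<longlonglongrightarrow> g \<tau> + RL \<alpha> t (\<lambda>\<xi>. h \<xi> (u \<xi>)) \<tau>"
      by (auto intro: tendsto_add)
    moreover have "(\<lambda>n. picard (Suc n) \<tau>) \<longlonglongrightarrow> u \<tau>"
      using lim[of \<tau>] that unfolding S_def by (intro LIMSEQ_Suc) auto
    ultimately show ?thesis by (metis LIMSEQ_unique)
  qed
  moreover have "\<forall>\<tau>\<in>{t<..T}. \<bar>u \<tau>\<bar> \<le> (2 * B * exp (L * (T - t))) * (\<tau> - t) powr (\<alpha> - 1)"
    using ub by simp
  ultimately have "solution u" unfolding solution_def using uc by blast
  then show ?thesis by blast
qed

text \<open>The difference of two solutions satisfies the hypotheses of \<open>volterra_bound\<close> with \<open>C = 0\<close>.\<close>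

lemma solution_unique:
  assumes "solution u" "solution v" "\<tau> \<in> {t<..T}"
  shows "u \<tau> = v \<tau>"
proof -
  obtain B where "\<forall>\<tau>\<in>{t<..T}. \<bar>u \<tau>\<bar> \<le> B * (\<tau> - t) powr (\<alpha> - 1)"
    using assms(1) unfolding solution_def by blast
  then have B: "\<bar>u \<tau>\<bar> \<le> B * (\<tau> - t) powr (\<alpha> - 1)" if "t < \<tau>" "\<tau> \<le> T" for \<tau> using that by simp
  obtain B' where "\<forall>\<tau>\<in>{t<..T}. \<bar>v \<tau>\<bar> \<le> B' * (\<tau> - t) powr (\<alpha> - 1)"
    using assms(2) unfolding solution_def by blast
  then have B': "\<bar>v \<tau>\<bar> \<le> B' * (\<tau> - t) powr (\<alpha> - 1)" if "t < \<tau>" "\<tau> \<le> T" for \<tau> using that by simp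
  have uc: "continuous_on {t<..T} u" and vc: "continuous_on {t<..T} v"
    using assms unfolding solution_def by auto
  have "\<bar>u \<tau> - v \<tau>\<bar> \<le> volterra_const \<alpha> \<alpha> M (T - t) * 0 * (\<tau> - t) powr (\<alpha> - 1)"
  proof (rule volterra_bound[OF alpha alpha M0 order_refl,
        where B="B + B'" and g="\<lambda>_. 0" and h="\<lambda>\<xi>. h \<xi> (u \<xi>) - h \<xi> (v \<xi>)"])
    show "set_borel_measurable borel {t<..T} (\<lambda>\<tau>. u \<tau> - v \<tau>)"
      by (rule set_borel_measurable_continuous'[OF continuous_on_diff[OF uc vc] order_refl])
  next
    fix \<tau> assume \<tau>: "t < \<tau>" "\<tau> \<le> T"
    show "\<bar>u \<tau> - v \<tau>\<bar> \<le> (B + B') * (\<tau> - t) powr (\<alpha> - 1)"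
      using B[OF \<tau>] B'[OF \<tau>] by (simp add: algebra_simps)
    show "\<bar>h \<tau> (u \<tau>) - h \<tau> (v \<tau>)\<bar> \<le> M * (\<bar>u \<tau> - v \<tau>\<bar> + 0 * (\<tau> - t) powr (\<alpha> - 1))"
      using h_lip[OF \<tau>] by simp
    have "u \<tau> - v \<tau> = RL \<alpha> t (\<lambda>\<xi>. h \<xi> (u \<xi>)) \<tau> - RL \<alpha> t (\<lambda>\<xi>. h \<xi> (v \<xi>)) \<tau>"
      using assms \<tau> unfolding solution_def by (metis add_diff_cancel_left greaterThanAtMost_iff)
    also have "\<dots> = RL \<alpha> t (\<lambda>\<xi>. h \<xi> (u \<xi>) - h \<xi> (v \<xi>)) \<tau>"
      by (rule RL_diff[OF alpha alpha, where C="M * B + C" and C'="M * B' + C"])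
         (use \<tau> set_borel_measurable_continuous'[OF h_cont[OF uc]] set_borel_measurable_continuous'[OF h_cont[OF vc]]
           B B' h_bound in auto)
    finally show "u \<tau> - v \<tau> = 0 + RL \<alpha> t (\<lambda>\<xi>. h \<xi> (u \<xi>) - h \<xi> (v \<xi>)) \<tau>" by simp
  qed (use assms in auto)
  then show ?thesis by simp
qed

lemma integral_eq_solution_iff:
  "integral_eq_solution \<alpha> t T g h p \<longleftrightarrow> p \<in> extensional {t<..T} \<and> solution p"
proof -
  have b: "bounded ((\<lambda>\<tau>. (\<tau> - t) powr (1 - \<alpha>) * p \<tau>) ` {t<..T})
    \<longleftrightarrow> (\<exists>B. \<forall>\<tau>\<in>{t<..T}. \<bar>p \<tau>\<bar> \<le> B * (\<tau> - t) powr (\<alpha> - 1))"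
  proof -
    have "\<bar>(\<tau> - t) powr (1 - \<alpha>) * p \<tau>\<bar> \<le> B \<longleftrightarrow> \<bar>p \<tau>\<bar> \<le> B * (\<tau> - t) powr (\<alpha> - 1)" if "\<tau> \<in> {t<..T}" for \<tau> B
    proof -
      have e: "(\<tau> - t) powr (\<alpha> - 1) = 1 / (\<tau> - t) powr (1 - \<alpha>)"
        using powr_minus_divide[of "\<tau> - t" "1 - \<alpha>"] by simp
      show ?thesis unfolding e using that by (simp add: abs_mult field_simps)
    qed
    then show ?thesis unfolding bounded_iff by (auto simp: ball_simps)
  qed
  have "continuous_on {t<..T} p \<Longrightarrow>
     (\<forall>\<tau>\<in>{t<..T}. p \<tau> = g \<tau> + 1 / Gamma \<alpha> * (LINT \<xi>:{t<..\<tau>}|lebesgue. h \<xi> (p \<xi>) / (\<tau> - \<xi>) powr (1 - \<alpha>)))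
     \<longleftrightarrow> (\<forall>\<tau>\<in>{t<..T}. p \<tau> = g \<tau> + RL \<alpha> t (\<lambda>\<xi>. h \<xi> (p \<xi>)) \<tau>)"
    by (intro ball_cong refl) (subst LINT_lebesgue_eq_RL, rule set_borel_measurable_continuous'[OF h_cont], auto)
  then show ?thesis
    unfolding integral_eq_solution_def C_weighted_def solution_def using b by blast
qed

lemma integral_eq_solution_ex1: "\<exists>!p. integral_eq_solution \<alpha> t T g h p"
proof -
  obtain u where u: "solution u" using ex_solution by blast
  have eq: "RL \<alpha> t (\<lambda>\<xi>. h \<xi> (restrict u {t<..T} \<xi>)) \<tau> = RL \<alpha> t (\<lambda>\<xi>. h \<xi> (u \<xi>)) \<tau>" if "\<tau> \<le> T" for \<tau>
    by (rule RL_cong) (use that in auto)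
  have "continuous_on {t<..T} (restrict u {t<..T})"
    using u unfolding solution_def by (subst continuous_on_cong[where g=u]) auto
  moreover have "restrict u {t<..T} \<tau> = u \<tau>" if "\<tau> \<in> {t<..T}" for \<tau> using that by simp
  moreover have "RL \<alpha> t (\<lambda>\<xi>. h \<xi> (restrict u {t<..T} \<xi>)) \<tau> = RL \<alpha> t (\<lambda>\<xi>. h \<xi> (u \<xi>)) \<tau>"
    if "\<tau> \<in> {t<..T}" for \<tau> using eq that by simp
  ultimately have "solution (restrict u {t<..T})"
    using u unfolding solution_def by (metis (no_types, lifting))
  then have "integral_eq_solution \<alpha> t T g h (restrict u {t<..T})"
    unfolding integral_eq_solution_iff by simp
  moreover have "p = q" if "integral_eq_solution \<alpha> t T g h p" "integral_eq_solution \<alpha> t T g h q" for p q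
    using that unfolding integral_eq_solution_iff
    by (intro extensionalityI[of _ "{t<..T}"]) (auto intro: solution_unique)
  ultimately show ?thesis by blast
qed

end

section \<open>Densities and Caputo derivatives\<close>

text \<open>The Lebesgue measure is complete, so a function that agrees almost everywhere with a Borel function is measurable.
  This is how Caputo derivatives, which are unspecified on a null set, are replaced by Borel densities.\<close>

lemma set_lebesgue_integral_AE_eq:
  fixes f g :: "real \<Rightarrow> real"
  assumes g: "set_borel_measurable borel B g"
    and ae: "AE \<xi> in lborel. indicat_real A \<xi> * f \<xi> = indicat_real B \<xi> * g \<xi>"
  shows "(LINT \<xi>:A|lebesgue. f \<xi>) = (LBINT \<xi>:B. g \<xi>)"
proof -
  have gm: "(\<lambda>\<xi>. indicat_real B \<xi> * g \<xi>) \<in> borel_measurable borel"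
    using g unfolding set_borel_measurable_def by simp
  then have gl: "(\<lambda>\<xi>. indicat_real B \<xi> * g \<xi>) \<in> borel_measurable lebesgue"
    by (simp add: measurable_completion)
  have ae': "AE \<xi> in lebesgue. indicat_real B \<xi> * g \<xi> = indicat_real A \<xi> * f \<xi>"
    using ae by (simp add: AE_completion_iff eq_commute)
  have fl: "(\<lambda>\<xi>. indicat_real A \<xi> * f \<xi>) \<in> borel_measurable lebesgue"
    by (rule borel_measurable_AE[OF gl ae'])
  have "(LINT \<xi>:A|lebesgue. f \<xi>) = (\<integral>\<xi>. indicat_real B \<xi> * g \<xi> \<partial>lebesgue)"
    unfolding set_lebesgue_integral_def real_scaleR_def
    using integral_cong_AE[OF gl fl ae'] by simp
  also have "\<dots> = (LBINT \<xi>:B. g \<xi>)"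
    unfolding set_lebesgue_integral_def real_scaleR_def by (rule integral_completion) (use gm in simp)
  finally show ?thesis .
qed

lemma LINT_lebesgue_Icc_eq_RL:
  fixes f g :: "real \<Rightarrow> real"
  assumes g: "set_borel_measurable borel {t<..\<tau>} g"
    and ae: "AE \<xi> in lborel. t < \<xi> \<and> \<xi> \<le> \<tau> \<longrightarrow> f \<xi> = g \<xi>"
  shows "1 / Gamma \<alpha> * (LINT \<xi>:{t..\<tau>}|lebesgue. f \<xi> / (\<tau> - \<xi>) powr (1 - \<alpha>)) = RL \<alpha> t g \<tau>"
proof -
  have [measurable]: "(\<lambda>\<xi>. indicat_real {t<..\<tau>} \<xi> * g \<xi>) \<in> borel_measurable borel"
    using g unfolding set_borel_measurable_def by simp
  have "(LINT \<xi>:{t..\<tau>}|lebesgue. f \<xi> / (\<tau> - \<xi>) powr (1 - \<alpha>)) = (LBINT \<xi>:{t<..\<tau>}. g \<xi> * (\<tau> - \<xi>) powr (\<alpha> - 1))"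
  proof (rule set_lebesgue_integral_AE_eq)
    show "set_borel_measurable borel {t<..\<tau>} (\<lambda>\<xi>. g \<xi> * (\<tau> - \<xi>) powr (\<alpha> - 1))"
      unfolding set_borel_measurable_def real_scaleR_def mult.assoc[symmetric] by measurable
    have "AE \<xi> in lborel. \<xi> \<noteq> t" by (rule AE_lborel_singleton)
    with ae show "AE \<xi> in lborel. indicat_real {t..\<tau>} \<xi> * (f \<xi> / (\<tau> - \<xi>) powr (1 - \<alpha>))
       = indicat_real {t<..\<tau>} \<xi> * (g \<xi> * (\<tau> - \<xi>) powr (\<alpha> - 1))"
    proof eventually_elim
      case (elim \<xi>)
      have "1 / (\<tau> - \<xi>) powr (1 - \<alpha>) = (\<tau> - \<xi>) powr (\<alpha> - 1)"
        using powr_minus_divide[of "\<tau> - \<xi>" "1 - \<alpha>"] by simp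
      then show ?case using elim by (auto simp: indicator_def divide_inverse)
    qed
  qed
  then show ?thesis unfolding RL_def by simp
qed

lemma AC_borel_density:
  assumes y: "y \<in> AC \<alpha> T t" and t: "t \<le> T"
  obtains l C where "l \<in> borel_measurable borel" "0 \<le> C" "\<And>\<xi>. \<bar>l \<xi>\<bar> \<le> C"
    "\<And>\<tau>. 0 \<le> \<tau> \<Longrightarrow> \<tau> \<le> t \<Longrightarrow> y \<tau> = y 0 + RL \<alpha> 0 l \<tau>"
proof -
  obtain l0 C0 where l0: "l0 \<in> borel_measurable (lebesgue_on {0..T})"
    and C0: "AE \<xi> in lebesgue_on {0..T}. \<bar>l0 \<xi>\<bar> \<le> C0"
    and y: "\<forall>\<tau>\<in>{0..t}. y \<tau> = y 0 + 1 / Gamma \<alpha> * (LINT \<xi>:{0..\<tau>}|lebesgue. l0 \<xi> / (\<tau> - \<xi>) powr (1 - \<alpha>))"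
    using y unfolding AC_def by blast
  have "(\<lambda>\<xi>. indicat_real {0..T} \<xi> * l0 \<xi>) \<in> borel_measurable lebesgue"
    using l0 by (subst (asm) borel_measurable_restrict_space_iff) (auto simp: mult.commute)
  then obtain l2 where l2: "l2 \<in> borel_measurable lborel" "AE \<xi> in lborel. indicat_real {0..T} \<xi> * l0 \<xi> = l2 \<xi>"
    using completion_ex_borel_measurable_real by blast
  define C where "C = max C0 0"
  define l where "l = (\<lambda>\<xi>. max (-C) (min C (l2 \<xi>)))"
  have lm[measurable]: "l \<in> borel_measurable borel" using l2(1) unfolding l_def by simp
  have lb: "\<bar>l \<xi>\<bar> \<le> C" for \<xi> unfolding l_def C_def by auto
  have "AE \<xi> in lborel. \<xi> \<in> {0..T} \<longrightarrow> \<bar>l0 \<xi>\<bar> \<le> C0"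
    using C0 by (subst (asm) AE_restrict_space_iff) (auto simp: AE_completion_iff)
  with l2(2) have ae: "AE \<xi> in lborel. \<xi> \<in> {0..T} \<longrightarrow> l0 \<xi> = l \<xi>"
    by eventually_elim (auto simp: l_def C_def indicator_def)
  have yl: "y \<tau> = y 0 + RL \<alpha> 0 l \<tau>" if "0 \<le> \<tau>" "\<tau> \<le> t" for \<tau>
  proof -
    have "1 / Gamma \<alpha> * (LINT \<xi>:{0..\<tau>}|lebesgue. l0 \<xi> / (\<tau> - \<xi>) powr (1 - \<alpha>)) = RL \<alpha> 0 l \<tau>"
    proof (rule LINT_lebesgue_Icc_eq_RL)
      show "set_borel_measurable borel {0<..\<tau>} l" unfolding set_borel_measurable_def by measurable
      show "AE \<xi> in lborel. 0 < \<xi> \<and> \<xi> \<le> \<tau> \<longrightarrow> l0 \<xi> = l \<xi>"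
        using ae by eventually_elim (use that t in auto)
    qed
    then show ?thesis using bspec[OF y, of \<tau>] that by simp
  qed
  have "0 \<le> C" by (simp add: C_def)
  then show thesis by (rule that[OF lm _ lb]) (rule yl)
qed

lemma AC_I:
  assumes l: "l \<in> borel_measurable borel" "\<And>\<xi>. \<bar>l \<xi>\<bar> \<le> C" and y: "y \<in> extensional {0..t}"
    "\<And>\<tau>. 0 \<le> \<tau> \<Longrightarrow> \<tau> \<le> t \<Longrightarrow> y \<tau> = x0 + RL \<alpha> 0 l \<tau>" and t: "0 \<le> t"
  shows "y \<in> AC \<alpha> T t"
proof -
  have "RL \<alpha> 0 l 0 = 0" unfolding RL_def set_lebesgue_integral_def by simp
  then have x0: "y 0 = x0" using y(2)[of 0] t by simp
  have "l \<in> borel_measurable (lebesgue_on {0..T})"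
    using l(1) by (intro measurable_restrict_space1 measurable_completion) simp
  moreover have "\<exists>C. AE \<xi> in lebesgue_on {0..T}. \<bar>l \<xi>\<bar> \<le> C" using l(2) by auto
  moreover have "y \<tau> = y 0 + 1 / Gamma \<alpha> * (LINT \<xi>:{0..\<tau>}|lebesgue. l \<xi> / (\<tau> - \<xi>) powr (1 - \<alpha>))"
    if "\<tau> \<in> {0..t}" for \<tau>
    using y(2)[of \<tau>] that l(1) unfolding x0
    by (subst LINT_lebesgue_Icc_eq_RL[where g=l]) (auto simp: set_borel_measurable_def)
  ultimately show ?thesis using y(1) unfolding AC_def by blast
qed

lemma nn_integral_Beta:
  assumes "0 < a" "0 < (b::real)"
  shows "(\<integral>\<^sup>+v. ennreal (v powr (a - 1) * (1 - v) powr (b - 1)) * indicator {0..1} v \<partial>lborel) = ennreal (Beta a b)"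
proof -
  have "(\<integral>\<^sup>+v. ennreal (v powr (a - 1) * (1 - v) powr (b - 1)) * indicator {0..1} v \<partial>lborel)
    = (\<integral>\<^sup>+v. ennreal (indicator {0..1} v * (v powr (a - 1) * (1 - v) powr (b - 1))) \<partial>lborel)"
    by (intro nn_integral_cong) (auto simp: indicator_def)
  also have "\<dots> = ennreal (Beta a b)"
    by (rule nn_integral_has_integral_lebesgue[OF _ has_integral_Beta_real[OF assms]]) auto
  finally show ?thesis .
qed

text \<open>After rescaling to \<open>[0, 1]\<close> this is the Beta integral.\<close>

lemma nn_integral_kernel_convolution:
  assumes ab: "0 < a" "0 < (b::real)" and \<eta>s: "\<eta> < s"
  shows "(\<integral>\<^sup>+\<xi>. ennreal ((\<xi> - \<eta>) powr (a - 1) / Gamma a) * ennreal ((s - \<xi>) powr (b - 1) / Gamma b) * indicator {\<eta>..s} \<xi> \<partial>lborel)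
    = ennreal ((s - \<eta>) powr (a + b - 1) / Gamma (a + b))"
proof -
  have G: "Gamma a > 0" "Gamma b > 0" "Gamma (a + b) > 0" using ab by (simp_all add: Gamma_real_pos)
  have c: "s - \<eta> > 0" using \<eta>s by simp
  have "(\<integral>\<^sup>+\<xi>. ennreal ((\<xi> - \<eta>) powr (a - 1) / Gamma a) * ennreal ((s - \<xi>) powr (b - 1) / Gamma b) * indicator {\<eta>..s} \<xi> \<partial>lborel)
     = ennreal \<bar>s - \<eta>\<bar> * (\<integral>\<^sup>+v. ennreal (((\<eta> + (s - \<eta>) * v) - \<eta>) powr (a - 1) / Gamma a) * ennreal ((s - (\<eta> + (s - \<eta>) * v)) powr (b - 1) / Gamma b)
         * indicator {\<eta>..s} (\<eta> + (s - \<eta>) * v) \<partial>lborel)"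
    by (rule nn_integral_real_affine) (use c in auto)
  also have "(\<integral>\<^sup>+v. ennreal (((\<eta> + (s - \<eta>) * v) - \<eta>) powr (a - 1) / Gamma a) * ennreal ((s - (\<eta> + (s - \<eta>) * v)) powr (b - 1) / Gamma b)
         * indicator {\<eta>..s} (\<eta> + (s - \<eta>) * v) \<partial>lborel)
     = (\<integral>\<^sup>+v. ennreal ((s - \<eta>) powr (a + b - 2) / (Gamma a * Gamma b)) *
          (ennreal (v powr (a - 1) * (1 - v) powr (b - 1)) * indicator {0..1} v) \<partial>lborel)"
  proof (intro nn_integral_cong)
    fix v :: real
    have ind: "\<eta> + (s - \<eta>) * v \<in> {\<eta>..s} \<longleftrightarrow> v \<in> {0..1}"
    proof -
      have "\<eta> + (s - \<eta>) * v \<le> s \<longleftrightarrow> (s - \<eta>) * v \<le> (s - \<eta>) * 1" by (simp add: algebra_simps)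
      also have "\<dots> \<longleftrightarrow> v \<le> 1" using c by (intro mult_le_cancel_left_pos)
      finally show ?thesis using c by (auto simp: zero_le_mult_iff)
    qed
    show "ennreal (((\<eta> + (s - \<eta>) * v) - \<eta>) powr (a - 1) / Gamma a) * ennreal ((s - (\<eta> + (s - \<eta>) * v)) powr (b - 1) / Gamma b)
         * indicator {\<eta>..s} (\<eta> + (s - \<eta>) * v)
       = ennreal ((s - \<eta>) powr (a + b - 2) / (Gamma a * Gamma b)) *
          (ennreal (v powr (a - 1) * (1 - v) powr (b - 1)) * indicator {0..1} v)"
    proof (cases "v \<in> {0..1}")
      case True
      have "s - (\<eta> + (s - \<eta>) * v) = (s - \<eta>) * (1 - v)" by (simp add: algebra_simps)
      then have "(s - (\<eta> + (s - \<eta>) * v)) powr (b - 1) = (s - \<eta>) powr (b - 1) * (1 - v) powr (b - 1)"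
        using True c by (simp add: powr_mult)
      moreover have "((\<eta> + (s - \<eta>) * v) - \<eta>) powr (a - 1) = (s - \<eta>) powr (a - 1) * v powr (a - 1)"
        using True c by (simp add: powr_mult)
      moreover have "(s - \<eta>) powr (a + b - 2) = (s - \<eta>) powr (a - 1) * (s - \<eta>) powr (b - 1)"
        by (simp add: powr_add[symmetric] algebra_simps)
      ultimately show ?thesis using True ind G by (simp add: ennreal_mult[symmetric] mult_ac)
    next
      case False
      then have "\<eta> + (s - \<eta>) * v \<notin> {\<eta>..s}" using ind by blast
      then have "indicator {\<eta>..s} (\<eta> + (s - \<eta>) * v) = (0::ennreal)" by (rule indicator_simps(2))
      moreover have "indicator {0..1} v = (0::ennreal)" using False by (rule indicator_simps(2))
      ultimately show ?thesis by (simp only: mult_zero_right)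
    qed
  qed
  also have "\<dots> = ennreal ((s - \<eta>) powr (a + b - 2) / (Gamma a * Gamma b)) * ennreal (Beta a b)"
    by (subst nn_integral_cmult, measurable) (simp only: nn_integral_Beta[OF ab])
  also have "ennreal \<bar>s - \<eta>\<bar> * \<dots> = ennreal ((s - \<eta>) powr (a + b - 1) / Gamma (a + b))"
  proof -
    have "(s - \<eta>) * (s - \<eta>) powr (a + b - 2) = (s - \<eta>) powr (a + b - 1)"
      using powr_add[of "s - \<eta>" 1 "a + b - 2"] c by simp
    then show ?thesis using c G by (simp add: ennreal_mult[symmetric] Beta_def field_simps)
  qed
  finally show ?thesis .
qed

lemma nRL_semigroup:
  assumes ab: "0 < a" "0 < (b::real)" and [measurable]: "u \<in> borel_measurable borel"
  shows "nRL b t (nRL a t u) s = nRL (a + b) t u s"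
proof -
  have "nRL b t (nRL a t u) s = (\<integral>\<^sup>+\<xi>. \<integral>\<^sup>+\<eta>. u \<eta> * ennreal ((\<xi> - \<eta>) powr (a - 1) / Gamma a) * indicator {t<..\<xi>} \<eta> *
       (ennreal ((s - \<xi>) powr (b - 1) / Gamma b) * indicator {t<..s} \<xi>) \<partial>lborel \<partial>lborel)"
    unfolding nRL_def by (intro nn_integral_cong) (subst nn_integral_multc, auto simp: mult_ac)
  also have "\<dots> = (\<integral>\<^sup>+\<eta>. \<integral>\<^sup>+\<xi>. u \<eta> * ennreal ((\<xi> - \<eta>) powr (a - 1) / Gamma a) * indicator {t<..\<xi>} \<eta> *
       (ennreal ((s - \<xi>) powr (b - 1) / Gamma b) * indicator {t<..s} \<xi>) \<partial>lborel \<partial>lborel)"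
    unfolding indicator_def greaterThanAtMost_iff by (rule lborel_pair.Fubini') measurable
  also have "\<dots> = (\<integral>\<^sup>+\<eta>. u \<eta> * ennreal ((s - \<eta>) powr (a + b - 1) / Gamma (a + b)) * indicator {t<..s} \<eta> \<partial>lborel)"
  proof (intro nn_integral_cong)
    fix \<eta> :: real
    have "(\<integral>\<^sup>+\<xi>. u \<eta> * ennreal ((\<xi> - \<eta>) powr (a - 1) / Gamma a) * indicator {t<..\<xi>} \<eta> *
       (ennreal ((s - \<xi>) powr (b - 1) / Gamma b) * indicator {t<..s} \<xi>) \<partial>lborel)
      = (\<integral>\<^sup>+\<xi>. u \<eta> * indicator {t<..s} \<eta> * (ennreal ((\<xi> - \<eta>) powr (a - 1) / Gamma a) *
          ennreal ((s - \<xi>) powr (b - 1) / Gamma b) * indicator {\<eta>..s} \<xi>) \<partial>lborel)"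
      by (intro nn_integral_cong) (auto simp: indicator_def mult_ac)
    also have "\<dots> = u \<eta> * indicator {t<..s} \<eta> * (\<integral>\<^sup>+\<xi>. ennreal ((\<xi> - \<eta>) powr (a - 1) / Gamma a) *
          ennreal ((s - \<xi>) powr (b - 1) / Gamma b) * indicator {\<eta>..s} \<xi> \<partial>lborel)"
      by (rule nn_integral_cmult) measurable
    also have "\<dots> = u \<eta> * ennreal ((s - \<eta>) powr (a + b - 1) / Gamma (a + b)) * indicator {t<..s} \<eta>"
    proof (cases "\<eta> < s")
      case True
      show ?thesis unfolding nn_integral_kernel_convolution[OF ab True] by (simp add: mult_ac)
    next
      case False
      have "(\<integral>\<^sup>+\<xi>. ennreal ((\<xi> - \<eta>) powr (a - 1) / Gamma a) *
          ennreal ((s - \<xi>) powr (b - 1) / Gamma b) * indicator {\<eta>..s} \<xi> \<partial>lborel) = (\<integral>\<^sup>+(\<xi>::real). 0 \<partial>lborel)"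
      proof (intro nn_integral_cong)
        fix \<xi>
        have "\<xi> = \<eta>" if "\<eta> \<le> \<xi>" "\<xi> \<le> s" using that False by linarith
        then show "ennreal ((\<xi> - \<eta>) powr (a - 1) / Gamma a) *
          ennreal ((s - \<xi>) powr (b - 1) / Gamma b) * indicator {\<eta>..s} \<xi> = 0"
          by (auto simp: indicator_def)
      qed
      then show ?thesis using False by (auto simp: indicator_def)
    qed
    finally show "(\<integral>\<^sup>+\<xi>. u \<eta> * ennreal ((\<xi> - \<eta>) powr (a - 1) / Gamma a) * indicator {t<..\<xi>} \<eta> *
       (ennreal ((s - \<xi>) powr (b - 1) / Gamma b) * indicator {t<..s} \<xi>) \<partial>lborel)
      = u \<eta> * ennreal ((s - \<eta>) powr (a + b - 1) / Gamma (a + b)) * indicator {t<..s} \<eta>" .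
  qed
  finally show ?thesis unfolding nRL_def .
qed

lemma ennreal_RL:
  assumes "0 < \<alpha>" "\<alpha> \<le> 1" "0 \<le> C" and [measurable]: "g \<in> borel_measurable borel"
    and g: "\<And>\<xi>. 0 \<le> g \<xi>" "\<And>\<xi>. g \<xi> \<le> C" and "t < \<tau>"
  shows "ennreal (RL \<alpha> t g \<tau>) = nRL \<alpha> t (\<lambda>\<xi>. ennreal (g \<xi>)) \<tau>" "0 \<le> RL \<alpha> t g \<tau>"
proof -
  have G: "Gamma \<alpha> > 0" using assms by (simp add: Gamma_real_pos)
  have i: "set_integrable lborel {t<..\<tau>} (\<lambda>\<xi>. g \<xi> * (\<tau> - \<xi>) powr (\<alpha> - 1))"
    by (rule RL_set_integrable[where \<beta>=1 and C=C]) (use assms in \<open>auto simp: set_borel_measurable_def\<close>)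
  have "ennreal (RL \<alpha> t g \<tau>) = ennreal (\<integral>\<xi>. indicat_real {t<..\<tau>} \<xi> *\<^sub>R (g \<xi> * (\<tau> - \<xi>) powr (\<alpha> - 1)) / Gamma \<alpha> \<partial>lborel)"
    unfolding RL_def set_lebesgue_integral_def by simp
  also have "\<dots> = (\<integral>\<^sup>+\<xi>. ennreal (indicat_real {t<..\<tau>} \<xi> *\<^sub>R (g \<xi> * (\<tau> - \<xi>) powr (\<alpha> - 1)) / Gamma \<alpha>) \<partial>lborel)"
    using i g G unfolding set_integrable_def
    by (intro nn_integral_eq_integral[symmetric] integrable_divide) auto
  also have "\<dots> = nRL \<alpha> t (\<lambda>\<xi>. ennreal (g \<xi>)) \<tau>"
    unfolding nRL_def using g G
    by (intro nn_integral_cong) (auto simp: indicator_def ennreal_mult[symmetric])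
  finally show "ennreal (RL \<alpha> t g \<tau>) = nRL \<alpha> t (\<lambda>\<xi>. ennreal (g \<xi>)) \<tau>" .
  show "0 \<le> RL \<alpha> t g \<tau>"
    unfolding RL_def set_lebesgue_integral_def using g G
    by (intro divide_nonneg_pos Bochner_Integration.integral_nonneg) auto
qed

lemma RL_measurable [measurable]:
  assumes [measurable]: "g \<in> borel_measurable borel"
  shows "RL \<alpha> t g \<in> borel_measurable borel"
  unfolding RL_def set_lebesgue_integral_def indicator_def greaterThanAtMost_iff by measurable

lemma RL_empty: "\<tau> \<le> t \<Longrightarrow> RL \<alpha> t g \<tau> = 0"
  unfolding RL_def set_lebesgue_integral_def by simp

lemma RL_bounded:
  assumes "0 < \<alpha>" "\<alpha> \<le> 1" "0 \<le> C" "\<And>\<xi>. t < \<xi> \<Longrightarrow> \<xi> \<le> \<tau> \<Longrightarrow> \<bar>g \<xi>\<bar> \<le> C" "\<tau> - t \<le> T0"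
  shows "\<bar>RL \<alpha> t g \<tau>\<bar> \<le> RL_const \<alpha> 1 T0 * C"
proof (cases "t < \<tau>")
  case True
  then show ?thesis using RL_powr_bound[of \<alpha> 1 t \<tau> T0 C g] assms by simp
next
  case False
  then show ?thesis using RL_const_nonneg[of \<alpha> 1 T0] assms by (simp add: RL_empty)
qed

text \<open>The semigroup law \<open>I\<^bsup>1-a\<^esup> I\<^sup>a = I\<^sup>1\<close>, transferred from nonnegative functions.  The indicator makes the inner
  integral a globally bounded Borel function.\<close>

lemma RL_semigroup_nonneg:
  assumes a: "0 < a" "a < 1" and "0 \<le> C" and [measurable]: "g \<in> borel_measurable borel"
    and g: "\<And>\<xi>. 0 \<le> g \<xi>" "\<And>\<xi>. g \<xi> \<le> C" and "t < s"
  shows "RL (1 - a) t (\<lambda>\<xi>. indicator {t<..s} \<xi> * RL a t g \<xi>) s = RL 1 t g s"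
proof -
  let ?h = "\<lambda>\<xi>. indicat_real {t<..s} \<xi> * RL a t g \<xi>"
  have h: "0 \<le> ?h \<xi>" "?h \<xi> \<le> RL_const a 1 (s - t) * C" for \<xi>
    using ennreal_RL(2)[OF a(1) _ assms(3,4) g, of t \<xi>] RL_bounded[OF a(1) _ assms(3), of t \<xi> g "s - t"] a g
      RL_const_nonneg[of a 1 "s-t"] \<open>0 \<le> C\<close>
    by (auto simp: indicator_def)
  have "ennreal (RL (1 - a) t ?h s) = nRL (1 - a) t (\<lambda>\<xi>. ennreal (?h \<xi>)) s"
    by (rule ennreal_RL(1)[OF _ _ _ _ h \<open>t < s\<close>]) (use a RL_const_nonneg[of a 1 "s-t"] assms in auto)
  also have "\<dots> = nRL (1 - a) t (nRL a t (\<lambda>\<xi>. ennreal (g \<xi>))) s"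
    by (intro nRL_cong) (use ennreal_RL(1)[OF a(1) _ assms(3,4) g] a in auto)
  also have "\<dots> = nRL 1 t (\<lambda>\<xi>. ennreal (g \<xi>)) s"
    using nRL_semigroup[of a "1 - a" "\<lambda>\<xi>. ennreal (g \<xi>)"] a by simp
  also have "\<dots> = ennreal (RL 1 t g s)"
    using ennreal_RL(1)[of 1 C g t s] assms by simp
  finally have "ennreal (RL (1 - a) t ?h s) = ennreal (RL 1 t g s)" .
  moreover have "0 \<le> RL 1 t g s" using ennreal_RL(2)[of 1 C g t s] assms by simp
  moreover have "0 \<le> RL (1 - a) t ?h s"
    by (rule ennreal_RL(2)[OF _ _ _ _ h \<open>t < s\<close>]) (use a RL_const_nonneg[of a 1 "s-t"] assms in auto)
  ultimately show ?thesis by simp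
qed

text \<open>A bounded density becomes nonnegative after adding a constant.\<close>

lemma RL_semigroup:
  assumes a: "0 < a" "a < 1" and C: "0 \<le> C" and [measurable]: "l \<in> borel_measurable borel"
    and l: "\<And>\<xi>. \<bar>l \<xi>\<bar> \<le> C" and s: "t < s"
  shows "RL (1 - a) t (\<lambda>\<xi>. indicator {t<..s} \<xi> * RL a t l \<xi>) s = (LBINT \<xi>:{t<..s}. l \<xi>)"
proof -
  have l': "0 \<le> l \<xi> + C" "l \<xi> + C \<le> 2 * C" for \<xi> using l[of \<xi>] by linarith+
  have m: "set_borel_measurable borel A (\<lambda>\<xi>. f \<xi> :: real)"
    if "f \<in> borel_measurable borel" "A \<in> sets borel" for A f
    using that unfolding set_borel_measurable_def by simp
  have RLd: "RL a t l \<xi> = RL a t (\<lambda>\<xi>. l \<xi> + C) \<xi> - RL a t (\<lambda>_. C) \<xi>" if "t < \<xi>" "0 < a" "a \<le> 1" for a \<xi> :: real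
    by (subst RL_diff[where \<beta>=1 and C="2*C" and C'=C]) (use that l' C in \<open>auto intro!: m\<close>)
  let ?h1 = "\<lambda>\<xi>. indicat_real {t<..s} \<xi> * RL a t (\<lambda>\<xi>. l \<xi> + C) \<xi>" and ?h2 = "\<lambda>\<xi>. indicat_real {t<..s} \<xi> * RL a t (\<lambda>_. C) \<xi>"
  have "RL (1 - a) t (\<lambda>\<xi>. indicator {t<..s} \<xi> * RL a t l \<xi>) s = RL (1 - a) t (\<lambda>\<xi>. ?h1 \<xi> - ?h2 \<xi>) s"
    by (rule RL_cong) (use RLd[of _ a] a in \<open>auto simp: algebra_simps\<close>)
  also have "\<dots> = RL (1 - a) t ?h1 s - RL (1 - a) t ?h2 s"
  proof (rule RL_diff[symmetric, where \<beta>=1 and C="RL_const a 1 (s - t) * (2*C)" and C'="RL_const a 1 (s - t) * C"])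
    fix \<xi> assume "t < \<xi>" "\<xi> \<le> s"
    then show "\<bar>?h1 \<xi>\<bar> \<le> RL_const a 1 (s - t) * (2*C) * (\<xi> - t) powr (1 - 1)"
      "\<bar>?h2 \<xi>\<bar> \<le> RL_const a 1 (s - t) * C * (\<xi> - t) powr (1 - 1)"
      using RL_bounded[of a "2*C" t \<xi> "\<lambda>\<xi>. l \<xi> + C" "s - t"] RL_bounded[of a C t \<xi> "\<lambda>\<xi>. C" "s - t"] l' a C by auto
  qed (use a s in \<open>auto intro!: m\<close>)
  also have "\<dots> = RL 1 t (\<lambda>\<xi>. l \<xi> + C) s - RL 1 t (\<lambda>_. C) s"
    using RL_semigroup_nonneg[OF a _ _ l' s] RL_semigroup_nonneg[OF a C _ _ _ s, of "\<lambda>_. C"] C by simp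
  also have "\<dots> = RL 1 t l s" using RLd[of s 1] s by simp
  also have "\<dots> = (LBINT \<xi>:{t<..s}. l \<xi>)"
  proof -
    have "(LINT \<xi>:{t<..s}|lborel. l \<xi> * (s - \<xi>) powr (1 - 1)) = (LBINT \<xi>:{t<..s}. l \<xi>)"
      unfolding set_lebesgue_integral_def
    proof (rule integral_cong_AE)
      have "AE \<xi> in lborel. \<xi> \<noteq> s" by (rule AE_lborel_singleton)
      then show "AE \<xi> in lborel. indicat_real {t<..s} \<xi> *\<^sub>R (l \<xi> * (s - \<xi>) powr (1 - 1)) = indicat_real {t<..s} \<xi> *\<^sub>R l \<xi>"
        by eventually_elim (auto simp: indicator_def)
    qed measurable
    then show ?thesis unfolding RL_def by simp
  qed
  finally show ?thesis .
qed

text \<open>The one-sided differentiation theorem is applied to \<open>l\<close> and to its reflection, which gives the right and the left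
  derivative.\<close>

lemma bounded_indefinite_integral_deriv_AE:
  fixes l :: "real \<Rightarrow> real"
  assumes [measurable]: "l \<in> borel_measurable borel" and l: "\<And>\<xi>. \<bar>l \<xi>\<bar> \<le> C"
  shows "AE x in lborel. 0 < x \<longrightarrow> ((\<lambda>s. LBINT \<xi>:{0<..s}. l \<xi>) has_real_derivative l x) (at x)"
proof -
  have si: "set_integrable lborel {a..b} f" if [measurable]: "f \<in> borel_measurable borel" and "\<And>\<xi>. \<bar>f \<xi>\<bar> \<le> C"
    for a b and f :: "real \<Rightarrow> real"
    unfolding set_integrable_def
    by (rule integrableI_bounded_set_indicator[where B=C]) (use that in \<open>auto simp: emeasure_lborel_Icc_eq\<close>)
  have io: "f integrable_on {a..b}" if "f \<in> borel_measurable borel" "\<And>\<xi>. \<bar>f \<xi>\<bar> \<le> C" for a b and f :: "real \<Rightarrow> real"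
    using set_borel_integral_eq_integral(1)[OF si] that by blast
  obtain N where N: "negligible N" "\<And>x e. x \<notin> N \<Longrightarrow> 0 < e \<Longrightarrow>
      \<exists>d>0. \<forall>h. 0 < h \<and> h < d \<longrightarrow> norm (integral (cbox x (x + h *\<^sub>R One)) l /\<^sub>R h ^ DIM(real) - l x) < e"
    using integrable_ccontinuous_explicit[of l] io[of l] l by auto
  obtain N' where N': "negligible N'" "\<And>x e. x \<notin> N' \<Longrightarrow> 0 < e \<Longrightarrow>
      \<exists>d>0. \<forall>h. 0 < h \<and> h < d \<longrightarrow> norm (integral (cbox x (x + h *\<^sub>R One)) (\<lambda>\<xi>. l (-\<xi>)) /\<^sub>R h ^ DIM(real) - l (-x)) < e"
    using integrable_ccontinuous_explicit[of "\<lambda>\<xi>. l (-\<xi>)"] io[of "\<lambda>\<xi>. l (-\<xi>)"] l by auto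
  have "negligible (uminus ` N')"
    by (rule negligible_differentiable_image_negligible[OF order_refl N'(1)])
      (intro linear_imp_differentiable_on linear_uminus)
  then have "N \<union> uminus ` N' \<in> null_sets lebesgue"
    using N(1) by (simp add: negligible_iff_null_sets[symmetric])
  then have "AE x in lebesgue. x \<notin> N \<union> uminus ` N'" by (rule AE_not_in)
  then have "AE x in lborel. x \<notin> N \<union> uminus ` N'" by (simp only: AE_completion_iff)
  then show ?thesis
  proof eventually_elim
    case (elim x)
    show ?case
    proof
      assume x: "0 < x"
      have F: "(LBINT \<xi>:{0<..s}. l \<xi>) = integral {0..s} l" if "0 < s" for s
      proof -
        have "(LBINT \<xi>:{0<..s}. l \<xi>) = (LBINT \<xi>:{0..s}. l \<xi>)"
          unfolding set_lebesgue_integral_def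
        proof (rule integral_cong_AE)
          have "AE \<xi> in lborel. \<xi> \<noteq> (0::real)" by (rule AE_lborel_singleton)
          then show "AE \<xi> in lborel. indicat_real {0<..s} \<xi> *\<^sub>R l \<xi> = indicat_real {0..s} \<xi> *\<^sub>R l \<xi>"
            by eventually_elim (auto simp: indicator_def)
        qed measurable
        also have "\<dots> = integral {0..s} l" using set_borel_integral_eq_integral(2)[OF si] l by simp
        finally show ?thesis .
      qed
      have D: "((\<lambda>s. integral {0..s} l) has_real_derivative l x) (at x)"
        unfolding has_field_derivative_iff LIM_def
      proof (intro allI impI)
        fix e :: real assume e: "0 < e"
        obtain d where d: "d > 0" "\<And>h. 0 < h \<Longrightarrow> h < d \<Longrightarrow> \<bar>integral {x..x + h} l / h - l x\<bar> < e"
          using N(2)[of x e] elim e by (auto simp: divide_inverse mult.commute)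
        have "- x \<notin> N'" using elim by force
        then obtain d' where d': "d' > 0" "\<And>h. 0 < h \<Longrightarrow> h < d' \<Longrightarrow> \<bar>integral {-x..-x + h} (\<lambda>\<xi>. l (-\<xi>)) / h - l x\<bar> < e"
          using N'(2)[of "-x" e] e by (auto simp: divide_inverse mult.commute)
        show "\<exists>s>0. \<forall>y. y \<noteq> x \<and> dist y x < s \<longrightarrow> dist ((integral {0..y} l - integral {0..x} l) / (y - x)) (l x) < e"
        proof (intro exI[of _ "min x (min d d')"] conjI allI impI)
          show "0 < min x (min d d')" using x d d' by simp
          fix y assume y: "y \<noteq> x \<and> dist y x < min x (min d d')"
          consider "x < y" | "y < x" using y by linarith
          then show "dist ((integral {0..y} l - integral {0..x} l) / (y - x)) (l x) < e"
          proof cases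
            case 1
            have "integral {0..x} l + integral {x..y} l = integral {0..y} l"
              using 1 x by (intro Henstock_Kurzweil_Integration.integral_combine io l) auto
            then have "(integral {0..y} l - integral {0..x} l) / (y - x) = integral {x..x + (y - x)} l / (y - x)"
              by (simp add: field_simps)
            then show ?thesis using d(2)[of "y - x"] y 1 by (simp add: dist_real_def)
          next
            case 2
            have "0 < y" using y 2 by (simp add: dist_real_def)
            then have "integral {0..y} l + integral {y..x} l = integral {0..x} l"
              using 2 by (intro Henstock_Kurzweil_Integration.integral_combine io l) auto
            moreover have "integral {-x..-y} (\<lambda>\<xi>. l (-\<xi>)) = integral {y..x} l"
              using integral_reflect_real[of x y l] by simp
            ultimately have "integral {0..y} l - integral {0..x} l = - integral {-x..-x + (x - y)} (\<lambda>\<xi>. l (-\<xi>))"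
              by simp
            then have "(integral {0..y} l - integral {0..x} l) / (y - x)
                = integral {-x..-x + (x - y)} (\<lambda>\<xi>. l (-\<xi>)) / (x - y)"
              by (metis minus_diff_eq minus_divide_divide)
            then show ?thesis using d'(2)[of "x - y"] y 2 by (simp add: dist_real_def)
          qed
        qed
      qed
      show "((\<lambda>s. LBINT \<xi>:{0<..s}. l \<xi>) has_real_derivative l x) (at x)"
        by (rule has_field_derivative_transform_within_open[OF D, of "{0<..}"]) (use x F in auto)
    qed
  qed
qed

text \<open>By the semigroup law the integral under the derivative in the Caputo derivative is \<open>\<Gamma>(1 - \<alpha>)\<close> times the
  indefinite integral of \<open>l\<close>.\<close>

lemma caputo_deriv_AE:
  assumes a: "0 < \<alpha>" "\<alpha> < 1" and C: "0 \<le> C" and [measurable]: "l \<in> borel_measurable borel"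
    and l: "\<And>\<xi>. \<bar>l \<xi>\<bar> \<le> C" and y: "\<And>\<tau>. 0 \<le> \<tau> \<Longrightarrow> \<tau> \<le> t \<Longrightarrow> y \<tau> = y 0 + RL \<alpha> 0 l \<tau>"
  shows "AE \<tau> in lborel. 0 \<le> \<tau> \<and> \<tau> \<le> t \<longrightarrow> caputo_deriv \<alpha> y \<tau> = l \<tau>"
proof -
  have G: "Gamma (1 - \<alpha>) > 0" using a by (simp add: Gamma_real_pos)
  have eq: "(LINT \<xi>:{0..s}|lebesgue. (y \<xi> - y 0) / (s - \<xi>) powr \<alpha>) = Gamma (1 - \<alpha>) * (LBINT \<xi>:{0<..s}. l \<xi>)"
    if "0 < s" "s \<le> t" for s
  proof -
    have "1 / Gamma (1 - \<alpha>) * (LINT \<xi>:{0..s}|lebesgue. (y \<xi> - y 0) / (s - \<xi>) powr (1 - (1 - \<alpha>)))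
      = RL (1 - \<alpha>) 0 (\<lambda>\<xi>. indicator {0<..s} \<xi> * RL \<alpha> 0 l \<xi>) s"
    proof (rule LINT_lebesgue_Icc_eq_RL)
      show "set_borel_measurable borel {0<..s} (\<lambda>\<xi>. indicator {0<..s} \<xi> * RL \<alpha> 0 l \<xi>)"
        unfolding set_borel_measurable_def by measurable
      show "AE \<xi> in lborel. 0 < \<xi> \<and> \<xi> \<le> s \<longrightarrow> y \<xi> - y 0 = indicator {0<..s} \<xi> * RL \<alpha> 0 l \<xi>"
      proof (intro AE_I2 impI)
        fix \<xi> assume "0 < \<xi> \<and> \<xi> \<le> s"
        then show "y \<xi> - y 0 = indicator {0<..s} \<xi> * RL \<alpha> 0 l \<xi>"
          using y[of \<xi>] that by simp
      qed
    qed
    also have "\<dots> = (LBINT \<xi>:{0<..s}. l \<xi>)" by (rule RL_semigroup[OF a C _ l that(1)]) simp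
    finally show ?thesis using G by (simp add: field_simps)
  qed
  have "AE \<tau> in lborel. \<tau> \<noteq> 0" "AE \<tau> in lborel. \<tau> \<noteq> t" by (rule AE_lborel_singleton)+
  with bounded_indefinite_integral_deriv_AE[OF \<open>l \<in> borel_measurable borel\<close> l]
  show ?thesis
  proof eventually_elim
    case (elim \<tau>)
    show ?case
    proof
      assume "0 \<le> \<tau> \<and> \<tau> \<le> t"
      then have \<tau>: "0 < \<tau>" "\<tau> < t" using elim by auto
      have "((\<lambda>s. Gamma (1 - \<alpha>) * (LBINT \<xi>:{0<..s}. l \<xi>)) has_real_derivative Gamma (1 - \<alpha>) * l \<tau>) (at \<tau>)"
        using elim \<tau> by (intro DERIV_cmult) auto
      then have "((\<lambda>s. LINT \<xi>:{0..s}|lebesgue. (y \<xi> - y 0) / (s - \<xi>) powr \<alpha>) has_real_derivative Gamma (1 - \<alpha>) * l \<tau>) (at \<tau>)"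
        by (rule has_field_derivative_transform_within_open[of _ _ _ "{0<..<t}"]) (use \<tau> eq in auto)
      then show "caputo_deriv \<alpha> y \<tau> = l \<tau>"
        unfolding caputo_deriv_def using DERIV_imp_deriv G by fastforce
    qed
  qed
qed

section \<open>The Cauchy problem\<close>

lemma const_le_powr:
  fixes c r T \<alpha> :: real
  assumes "0 < r" "r \<le> T" "\<alpha> \<le> 1" "0 \<le> c"
  shows "c \<le> c * T powr (1 - \<alpha>) * r powr (\<alpha> - 1)"
proof -
  have "1 = r powr (1 - \<alpha>) * r powr (\<alpha> - 1)" using assms by (simp add: powr_add[symmetric])
  also have "\<dots> \<le> T powr (1 - \<alpha>) * r powr (\<alpha> - 1)"
    using assms by (intro mult_right_mono powr_mono2) auto
  finally show ?thesis using mult_left_mono[of 1 "T powr (1 - \<alpha>) * r powr (\<alpha> - 1)" c] assms by (simp add: mult_ac)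
qed

text \<open>The contribution of the density on \<open>[0, s]\<close> to a later value of the function.\<close>

definition memory :: "real \<Rightarrow> real \<Rightarrow> (real \<Rightarrow> real) \<Rightarrow> real \<Rightarrow> real" where
  "memory \<alpha> s l \<tau> = (LBINT \<xi>:{0<..s}. l \<xi> * (\<tau> - \<xi>) powr (\<alpha> - 1)) / Gamma \<alpha>"

lemma memory_cong:
  assumes "\<And>\<xi>. 0 < \<xi> \<Longrightarrow> \<xi> \<le> s \<Longrightarrow> l \<xi> = l' \<xi>"
  shows "memory \<alpha> s l \<tau> = memory \<alpha> s l' \<tau>"
  unfolding memory_def by (subst set_lebesgue_integral_cong[where g="\<lambda>\<xi>. l' \<xi> * (\<tau> - \<xi>) powr (\<alpha> - 1)"]) (auto simp: assms)

lemma memory_cong_AE: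
  assumes [measurable]: "l \<in> borel_measurable borel" "l' \<in> borel_measurable borel"
    and "AE \<xi> in lborel. 0 < \<xi> \<and> \<xi> \<le> s \<longrightarrow> l \<xi> = l' \<xi>"
  shows "memory \<alpha> s l \<tau> = memory \<alpha> s l' \<tau>"
proof -
  have "(LBINT \<xi>:{0<..s}. l \<xi> * (\<tau> - \<xi>) powr (\<alpha> - 1)) = (LBINT \<xi>:{0<..s}. l' \<xi> * (\<tau> - \<xi>) powr (\<alpha> - 1))"
    unfolding set_lebesgue_integral_def
    by (rule integral_cong_AE, measurable) (rule AE_mp[OF assms(3)], auto simp: indicator_def)
  then show ?thesis unfolding memory_def by simp
qed

lemma RL_cong_AE:
  assumes m: "set_borel_measurable borel {t<..\<tau>} g" "set_borel_measurable borel {t<..\<tau>} h"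
    and "AE \<xi> in lborel. t < \<xi> \<and> \<xi> \<le> \<tau> \<longrightarrow> g \<xi> = h \<xi>"
  shows "RL \<alpha> t g \<tau> = RL \<alpha> t h \<tau>"
proof -
  have [measurable]: "(\<lambda>\<xi>. indicat_real {t<..\<tau>} \<xi> * g \<xi>) \<in> borel_measurable borel"
      "(\<lambda>\<xi>. indicat_real {t<..\<tau>} \<xi> * h \<xi>) \<in> borel_measurable borel"
    using m unfolding set_borel_measurable_def by simp_all
  have eq: "indicat_real {t<..\<tau>} \<xi> *\<^sub>R (f \<xi> * (\<tau> - \<xi>) powr (\<alpha> - 1))
      = (indicat_real {t<..\<tau>} \<xi> * f \<xi>) * (\<tau> - \<xi>) powr (\<alpha> - 1)" for f \<xi> by simp
  have "(LBINT \<xi>:{t<..\<tau>}. g \<xi> * (\<tau> - \<xi>) powr (\<alpha> - 1)) = (LBINT \<xi>:{t<..\<tau>}. h \<xi> * (\<tau> - \<xi>) powr (\<alpha> - 1))"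
    unfolding set_lebesgue_integral_def eq
    by (rule integral_cong_AE, measurable) (rule AE_mp[OF assms(3)], auto simp: indicator_def)
  then show ?thesis unfolding RL_def by simp
qed

lemma set_borel_measurable_borel:
  fixes f :: "real \<Rightarrow> real"
  shows "f \<in> borel_measurable borel \<Longrightarrow> A \<in> sets borel \<Longrightarrow> set_borel_measurable borel A f"
  unfolding set_borel_measurable_def by simp

lemma memory_eq_RL:
  assumes "s \<le> \<tau>"
  shows "memory \<alpha> s l \<tau> = RL \<alpha> 0 (\<lambda>\<xi>. indicator {0<..s} \<xi> * l \<xi>) \<tau>"
proof -
  have "(LBINT \<xi>:{0<..s}. l \<xi> * (\<tau> - \<xi>) powr (\<alpha> - 1)) = (LBINT \<xi>:{0<..\<tau>}. indicator {0<..s} \<xi> * l \<xi> * (\<tau> - \<xi>) powr (\<alpha> - 1))"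
    unfolding set_lebesgue_integral_def
    by (intro Bochner_Integration.integral_cong) (use assms in \<open>auto simp: indicator_def\<close>)
  then show ?thesis unfolding memory_def RL_def by simp
qed

lemma memory_bounded:
  assumes "0 < \<alpha>" "\<alpha> \<le> 1" "0 \<le> C" "\<And>\<xi>. \<bar>l \<xi>\<bar> \<le> C" "s \<le> \<tau>" "\<tau> \<le> T"
  shows "\<bar>memory \<alpha> s l \<tau>\<bar> \<le> RL_const \<alpha> 1 T * C"
  unfolding memory_eq_RL[OF assms(5)]
  by (rule RL_bounded) (use assms in \<open>auto simp: indicator_def\<close>)

lemma RL_split:
  assumes "0 < \<alpha>" "\<alpha> \<le> 1" "0 \<le> C" and [measurable]: "l \<in> borel_measurable borel"
    and l: "\<And>\<xi>. \<bar>l \<xi>\<bar> \<le> C" and s: "0 \<le> s" "s \<le> \<tau>"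
  shows "RL \<alpha> 0 l \<tau> = memory \<alpha> s l \<tau> + RL \<alpha> s l \<tau>"
proof (cases "0 < \<tau>")
  case True
  let ?g = "\<lambda>\<xi>. indicat_real {0<..s} \<xi> * l \<xi>"
  have "RL \<alpha> 0 l \<tau> - RL \<alpha> 0 ?g \<tau> = RL \<alpha> 0 (\<lambda>\<xi>. l \<xi> - ?g \<xi>) \<tau>"
    by (rule RL_diff[where \<beta>=1 and C=C and C'=C])
       (use assms True in \<open>auto simp: indicator_def intro!: set_borel_measurable_borel\<close>)
  also have "\<dots> = RL \<alpha> s l \<tau>"
  proof -
    have "(LBINT \<xi>:{0<..\<tau>}. (l \<xi> - ?g \<xi>) * (\<tau> - \<xi>) powr (\<alpha> - 1)) = (LBINT \<xi>:{s<..\<tau>}. l \<xi> * (\<tau> - \<xi>) powr (\<alpha> - 1))"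
      unfolding set_lebesgue_integral_def
      by (intro Bochner_Integration.integral_cong) (use s in \<open>auto simp: indicator_def\<close>)
    then show ?thesis unfolding RL_def by simp
  qed
  finally show ?thesis using s by (simp add: memory_eq_RL)
next
  case False
  then have "\<tau> = 0" "s = 0" using s by auto
  then show ?thesis by (simp add: RL_empty memory_def set_lebesgue_integral_def)
qed

text \<open>A Taylor estimate that is uniform away from the singularity; it replaces differentiation under the integral sign.\<close>

lemma kernel_quadratic:
  fixes p d x y :: real
  assumes p: "p \<le> 0" and d: "0 < d" "d \<le> x" "d \<le> y"
  shows "\<bar>y powr p - x powr p - p * x powr (p - 1) * (y - x)\<bar> \<le> p * (p - 1) * d powr (p - 2) * (y - x)\<^sup>2"
proof -
  have dz: "d \<le> z" if "z \<in> closed_segment x y" for z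
    using that d by (auto simp: closed_segment_eq_real_ivl split: if_splits)
  then have pos: "0 < z" if "z \<in> closed_segment x y" for z
    using that d by (meson less_le_trans)
  have pp: "0 \<le> p * (p - 1)" using p by (simp add: mult_nonpos_nonpos)
  have k2: "\<bar>p * z powr (p - 1) - p * x powr (p - 1)\<bar> \<le> p * (p - 1) * d powr (p - 2) * \<bar>y - x\<bar>"
    if z: "z \<in> closed_segment x y" for z
  proof -
    have "norm (p * z powr (p - 1) - p * x powr (p - 1)) \<le> p * (p - 1) * d powr (p - 2) * norm (z - x)"
    proof (rule field_differentiable_bound[of "closed_segment x y"])
      fix v assume v: "v \<in> closed_segment x y"
      show "((\<lambda>z. p * z powr (p - 1)) has_field_derivative p * ((p - 1) * v powr (p - 2))) (at v within closed_segment x y)"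
        using pos[OF v] by (auto intro!: derivative_eq_intros)
      have "v powr (p - 2) \<le> d powr (p - 2)"
        using dz[OF v] d p by (intro powr_mono2') auto
      then have "p * (p - 1) * v powr (p - 2) \<le> p * (p - 1) * d powr (p - 2)"
        using pp by (rule mult_left_mono)
      moreover have "norm (p * ((p - 1) * v powr (p - 2))) = p * (p - 1) * v powr (p - 2)"
        using pp by (simp only: real_norm_def mult.assoc[symmetric] abs_mult[of "p * (p - 1)"] abs_of_nonneg powr_ge_zero)
      ultimately show "norm (p * ((p - 1) * v powr (p - 2))) \<le> p * (p - 1) * d powr (p - 2)" by simp
    qed (use z in auto)
    also have "norm (z - x) \<le> \<bar>y - x\<bar>" using z by (auto simp: closed_segment_eq_real_ivl split: if_splits)
    finally show ?thesis using pp by (simp add: mult_left_mono)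
  qed
  have "norm ((y powr p - p * x powr (p - 1) * y) - (x powr p - p * x powr (p - 1) * x))
     \<le> (p * (p - 1) * d powr (p - 2) * \<bar>y - x\<bar>) * norm (y - x)"
  proof (rule field_differentiable_bound[of "closed_segment x y"])
    fix v assume v: "v \<in> closed_segment x y"
    show "((\<lambda>z. z powr p - p * x powr (p - 1) * z) has_field_derivative
       p * v powr (p - 1) - p * x powr (p - 1)) (at v within closed_segment x y)"
      using pos[OF v] by (auto intro!: derivative_eq_intros)
    show "norm (p * v powr (p - 1) - p * x powr (p - 1)) \<le> p * (p - 1) * d powr (p - 2) * \<bar>y - x\<bar>"
      using k2[OF v] by simp
  qed auto
  moreover have "(y powr p - p * x powr (p - 1) * y) - (x powr p - p * x powr (p - 1) * x)
     = y powr p - x powr p - p * x powr (p - 1) * (y - x)"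
    by (simp add: algebra_simps)
  moreover have "(p * (p - 1) * d powr (p - 2) * \<bar>y - x\<bar>) * norm (y - x) = p * (p - 1) * d powr (p - 2) * (y - x)\<^sup>2"
    by (simp add: power2_eq_square mult.assoc)
  ultimately show ?thesis by (simp only: real_norm_def)
qed

lemma has_real_derivative_of_quadratic:
  fixes F :: "real \<Rightarrow> real"
  assumes d: "d > 0" and q: "\<And>y. \<bar>y - x\<bar> < d \<Longrightarrow> \<bar>F y - F x - D * (y - x)\<bar> \<le> K * (y - x)\<^sup>2"
  shows "(F has_real_derivative D) (at x)"
proof -
  have "((\<lambda>y. (F y - F x) / (y - x) - D) \<longlongrightarrow> 0) (at x)"
  proof (rule Lim_null_comparison)
    have "((\<lambda>y. \<bar>K\<bar> * \<bar>y - x\<bar>) \<longlongrightarrow> \<bar>K\<bar> * \<bar>x - x\<bar>) (at x)" by (intro tendsto_intros)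
    then show "((\<lambda>y. \<bar>K\<bar> * \<bar>y - x\<bar>) \<longlongrightarrow> 0) (at x)" by simp
    have "eventually (\<lambda>y. dist y x < d) (nhds x)" using d by (auto simp: eventually_nhds_metric)
    then show "eventually (\<lambda>y. norm ((F y - F x) / (y - x) - D) \<le> \<bar>K\<bar> * \<bar>y - x\<bar>) (at x)"
      unfolding eventually_at_filter
    proof (eventually_elim, intro impI)
      fix y assume y: "dist y x < d" "y \<noteq> x"
      have "(F y - F x) / (y - x) - D = (F y - F x - D * (y - x)) / (y - x)"
        using y by (simp add: field_simps)
      then have "norm ((F y - F x) / (y - x) - D) = \<bar>F y - F x - D * (y - x)\<bar> / \<bar>y - x\<bar>" by simp
      also have "\<dots> \<le> K * (y - x)\<^sup>2 / \<bar>y - x\<bar>"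
        using q[of y] y by (intro divide_right_mono) (auto simp: dist_real_def)
      also have "\<dots> = K * \<bar>y - x\<bar>"
        using y by (simp add: power2_eq_square field_simps abs_if)
      also have "\<dots> \<le> \<bar>K\<bar> * \<bar>y - x\<bar>" by (intro mult_right_mono) auto
      finally show "norm ((F y - F x) / (y - x) - D) \<le> \<bar>K\<bar> * \<bar>y - x\<bar>" .
    qed
  qed
  then show ?thesis unfolding has_field_derivative_iff by (simp add: LIM_zero_iff)
qed

lemma bounded_kernel_integrable:
  fixes l :: "real \<Rightarrow> real"
  assumes [measurable]: "l \<in> borel_measurable borel" and l: "\<And>\<xi>. \<bar>l \<xi>\<bar> \<le> C" and "0 \<le> s" "s < \<tau>" "p \<le> 0"
  shows "set_integrable lborel {0<..s} (\<lambda>\<xi>. l \<xi> * (\<tau> - \<xi>) powr p)"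
  unfolding set_integrable_def
proof (rule integrableI_bounded_set_indicator[where B="C * (\<tau> - s) powr p"])
  show "AE \<xi> in lborel. \<xi> \<in> {0<..s} \<longrightarrow> norm (l \<xi> * (\<tau> - \<xi>) powr p) \<le> C * (\<tau> - s) powr p"
  proof (intro AE_I2 impI)
    fix \<xi> assume "\<xi> \<in> {0<..s}"
    then have "(\<tau> - \<xi>) powr p \<le> (\<tau> - s) powr p" using assms by (intro powr_mono2') auto
    then show "norm (l \<xi> * (\<tau> - \<xi>) powr p) \<le> C * (\<tau> - s) powr p"
      using l[of \<xi>] by (auto simp: abs_mult intro!: mult_mono)
  qed
qed (use assms in auto)

text \<open>For \<open>\<tau> > s\<close> the kernel is smooth on \<open>[0, s]\<close> and the Taylor estimate can be integrated.  The exponents \<open>\<alpha> - 1\<close> and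
  \<open>\<alpha> - 2\<close> give the derivative of the memory term and the continuity of that derivative.\<close>

lemma memory_integral_has_derivative:
  fixes l :: "real \<Rightarrow> real"
  assumes p: "p \<le> 0" and lm[measurable]: "l \<in> borel_measurable borel" and l: "\<And>\<xi>. \<bar>l \<xi>\<bar> \<le> C" and s: "0 \<le> s" "s < \<tau>"
  shows "((\<lambda>\<tau>. LBINT \<xi>:{0<..s}. l \<xi> * (\<tau> - \<xi>) powr p) has_real_derivative
    p * (LBINT \<xi>:{0<..s}. l \<xi> * (\<tau> - \<xi>) powr (p - 1))) (at \<tau>)"
proof -
  have C: "0 \<le> C" using l[of 0] by linarith
  define d where "d = (\<tau> - s) / 2"
  define c where "c = p * (p - 1) * d powr (p - 2)"
  have d: "0 < d" using s by (simp add: d_def)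
  have c: "0 \<le> c" unfolding c_def using p by (simp add: mult_nonpos_nonpos)
  show ?thesis
  proof (rule has_real_derivative_of_quadratic[OF d, where K="C * c * s"])
    fix \<sigma> assume "\<bar>\<sigma> - \<tau>\<bar> < d"
    then have \<sigma>: "s + d \<le> \<sigma>" "s + d \<le> \<tau>" using s by (auto simp: d_def field_simps abs_if split: if_splits)
    note i1 = bounded_kernel_integrable[OF lm l s(1), of \<sigma> p]
      and i2 = bounded_kernel_integrable[OF lm l s(1), of \<tau> p]
      and i3 = bounded_kernel_integrable[OF lm l s(1), of \<tau> "p - 1"]
    let ?q = "\<lambda>\<xi>. l \<xi> * ((\<sigma> - \<xi>) powr p - (\<tau> - \<xi>) powr p - p * (\<tau> - \<xi>) powr (p - 1) * (\<sigma> - \<tau>))"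
    have I: "set_integrable lborel {0<..s} (\<lambda>\<xi>. l \<xi> * (\<sigma> - \<xi>) powr p - l \<xi> * (\<tau> - \<xi>) powr p - (p * (\<sigma> - \<tau>)) * (l \<xi> * (\<tau> - \<xi>) powr (p - 1)))"
      and Ieq: "(LBINT \<xi>:{0<..s}. l \<xi> * (\<sigma> - \<xi>) powr p - l \<xi> * (\<tau> - \<xi>) powr p - (p * (\<sigma> - \<tau>)) * (l \<xi> * (\<tau> - \<xi>) powr (p - 1)))
       = (LBINT \<xi>:{0<..s}. l \<xi> * (\<sigma> - \<xi>) powr p) - (LBINT \<xi>:{0<..s}. l \<xi> * (\<tau> - \<xi>) powr p)
         - (p * (\<sigma> - \<tau>)) * (LBINT \<xi>:{0<..s}. l \<xi> * (\<tau> - \<xi>) powr (p - 1))"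
      using i1 i2 i3 \<sigma> d p s by (auto intro!: set_integral_diff(1) set_integrable_mult_right simp: set_integral_diff(2) set_integral_mult_right)
    have qeq: "?q \<xi> = l \<xi> * (\<sigma> - \<xi>) powr p - l \<xi> * (\<tau> - \<xi>) powr p - (p * (\<sigma> - \<tau>)) * (l \<xi> * (\<tau> - \<xi>) powr (p - 1))" for \<xi>
      by (simp add: algebra_simps)
    have "\<bar>LBINT \<xi>:{0<..s}. ?q \<xi>\<bar> \<le> (LBINT \<xi>:{0<..s}. \<bar>?q \<xi>\<bar>)"
      using set_integral_norm_bound[OF I[unfolded qeq[symmetric]]] by simp
    also have "\<dots> \<le> (LBINT \<xi>:{0<..s}. C * (c * (\<sigma> - \<tau>)\<^sup>2))"
    proof (rule set_integral_mono)
      show "set_integrable lborel {0<..s} (\<lambda>\<xi>. \<bar>?q \<xi>\<bar>)"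
        using set_integrable_norm[OF I[unfolded qeq[symmetric]]] by simp
      show "set_integrable lborel {0<..s} (\<lambda>\<xi>. C * (c * (\<sigma> - \<tau>)\<^sup>2))"
        unfolding set_integrable_def using s by (intro integrable_scaleR_left integrable_real_indicator) auto
      fix \<xi> assume "\<xi> \<in> {0<..s}"
      then have "\<bar>(\<sigma> - \<xi>) powr p - (\<tau> - \<xi>) powr p - p * (\<tau> - \<xi>) powr (p - 1) * ((\<sigma> - \<xi>) - (\<tau> - \<xi>))\<bar>
        \<le> c * ((\<sigma> - \<xi>) - (\<tau> - \<xi>))\<^sup>2"
        unfolding c_def using \<sigma> by (intro kernel_quadratic p d) auto
      then show "\<bar>?q \<xi>\<bar> \<le> C * (c * (\<sigma> - \<tau>)\<^sup>2)"
        using l[of \<xi>] C unfolding abs_mult by (intro mult_mono) auto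
    qed
    also have "\<dots> = C * c * s * (\<sigma> - \<tau>)\<^sup>2"
      unfolding set_lebesgue_integral_def using s by simp
    finally have "\<bar>LBINT \<xi>:{0<..s}. ?q \<xi>\<bar> \<le> C * c * s * (\<sigma> - \<tau>)\<^sup>2" .
    then show "\<bar>(LBINT \<xi>:{0<..s}. l \<xi> * (\<sigma> - \<xi>) powr p) - (LBINT \<xi>:{0<..s}. l \<xi> * (\<tau> - \<xi>) powr p)
        - p * (LBINT \<xi>:{0<..s}. l \<xi> * (\<tau> - \<xi>) powr (p - 1)) * (\<sigma> - \<tau>)\<bar> \<le> C * c * s * (\<sigma> - \<tau>)\<^sup>2"
      unfolding qeq Ieq by (simp only: mult_ac)
  qed
qed

definition memory_deriv :: "real \<Rightarrow> real \<Rightarrow> (real \<Rightarrow> real) \<Rightarrow> real \<Rightarrow> real" where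
  "memory_deriv \<alpha> s l \<tau> = - ((1 - \<alpha>) / Gamma \<alpha>) * (LBINT \<xi>:{0<..s}. l \<xi> * (\<tau> - \<xi>) powr (\<alpha> - 2))"

lemma memory_has_derivative:
  assumes a: "0 < \<alpha>" "\<alpha> \<le> 1" and lm: "l \<in> borel_measurable borel" and l: "\<And>\<xi>. \<bar>l \<xi>\<bar> \<le> C" and s: "0 \<le> s" "s < \<tau>"
  shows "(memory \<alpha> s l has_real_derivative memory_deriv \<alpha> s l \<tau>) (at \<tau>)"
proof -
  have G: "Gamma \<alpha> > 0" using a by (simp add: Gamma_real_pos)
  have "((\<lambda>\<tau>. (LBINT \<xi>:{0<..s}. l \<xi> * (\<tau> - \<xi>) powr (\<alpha> - 1)) / Gamma \<alpha>) has_real_derivative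
     ((\<alpha> - 1) * (LBINT \<xi>:{0<..s}. l \<xi> * (\<tau> - \<xi>) powr (\<alpha> - 1 - 1))) / Gamma \<alpha>) (at \<tau>)"
    using memory_integral_has_derivative[OF _ lm l s, of "\<alpha> - 1"] a G by (intro DERIV_cdivide) auto
  moreover have "\<alpha> - 1 - 1 = \<alpha> - 2" by simp
  moreover have "memory_deriv \<alpha> s l \<tau> = ((\<alpha> - 1) * (LBINT \<xi>:{0<..s}. l \<xi> * (\<tau> - \<xi>) powr (\<alpha> - 2))) / Gamma \<alpha>"
    unfolding memory_deriv_def by (simp add: minus_divide_left)
  ultimately show ?thesis unfolding memory_def[abs_def] by simp
qed

lemma memory_deriv_continuous:
  assumes a: "0 < \<alpha>" "\<alpha> \<le> 1" and lm: "l \<in> borel_measurable borel" and l: "\<And>\<xi>. \<bar>l \<xi>\<bar> \<le> C" and s: "0 \<le> s"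
  shows "continuous_on {s<..T} (memory_deriv \<alpha> s l)"
proof -
  have "continuous_on {s<..T} (\<lambda>\<tau>. LBINT \<xi>:{0<..s}. l \<xi> * (\<tau> - \<xi>) powr (\<alpha> - 2))"
    using memory_integral_has_derivative[OF _ lm l s, of "\<alpha> - 2"] a
    by (intro continuous_at_imp_continuous_on ballI DERIV_isCont) auto
  then show ?thesis unfolding memory_deriv_def[abs_def] by (intro continuous_intros)
qed

text \<open>The kernel integrates to \<open>((\<tau> - s)\<^bsup>\<alpha>-1\<^esup> - \<tau>\<^bsup>\<alpha>-1\<^esup>)/(1 - \<alpha>)\<close>, so the derivative of the memory term lies in the weighted
  space.\<close>

lemma memory_deriv_bound:
  assumes a: "0 < \<alpha>" "\<alpha> < 1" and lm: "l \<in> borel_measurable borel" and l: "\<And>\<xi>. \<bar>l \<xi>\<bar> \<le> C" and s: "0 \<le> s" "s < \<tau>"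
  shows "\<bar>memory_deriv \<alpha> s l \<tau>\<bar> \<le> C / Gamma \<alpha> * (\<tau> - s) powr (\<alpha> - 1)"
proof -
  have G: "Gamma \<alpha> > 0" using a by (simp add: Gamma_real_pos)
  have C: "0 \<le> C" using l[of 0] by linarith
  have FTC: "has_bochner_integral lborel (\<lambda>\<xi>. (\<tau> - \<xi>) powr (\<alpha> - 2) * indicator {0..s} \<xi>)
     ((\<tau> - s) powr (\<alpha> - 1) / (1 - \<alpha>) - (\<tau> - 0) powr (\<alpha> - 1) / (1 - \<alpha>))"
  proof (rule has_bochner_integral_FTC_Icc_nonneg)
    fix \<xi> assume "\<xi> \<in> {0..s}"
    then have \<xi>: "0 \<le> \<xi>" "\<xi> \<le> s" by auto
    show "((\<lambda>\<xi>. (\<tau> - \<xi>) powr (\<alpha> - 1) / (1 - \<alpha>)) has_real_derivative (\<tau> - \<xi>) powr (\<alpha> - 2)) (at \<xi>)"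
    proof -
      have "((\<lambda>\<xi>. (\<tau> - \<xi>) powr (\<alpha> - 1)) has_real_derivative (1 - \<alpha>) * (\<tau> - \<xi>) powr (\<alpha> - 2)) (at \<xi>)"
        using \<xi> s by (auto intro!: derivative_eq_intros simp: algebra_simps)
      from DERIV_cdivide[OF this, of "1 - \<alpha>"] show ?thesis using a by simp
    qed
  qed (use s in auto)
  have i: "set_integrable lborel {0<..s} (\<lambda>\<xi>. l \<xi> * (\<tau> - \<xi>) powr (\<alpha> - 2))"
    by (rule bounded_kernel_integrable[OF lm l s]) (use a in auto)
  have "\<bar>LBINT \<xi>:{0<..s}. l \<xi> * (\<tau> - \<xi>) powr (\<alpha> - 2)\<bar> \<le> (LBINT \<xi>:{0<..s}. \<bar>l \<xi> * (\<tau> - \<xi>) powr (\<alpha> - 2)\<bar>)"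
    using set_integral_norm_bound[OF i] by simp
  also have "\<dots> \<le> (\<integral>\<xi>. C * ((\<tau> - \<xi>) powr (\<alpha> - 2) * indicator {0..s} \<xi>) \<partial>lborel)"
    unfolding set_lebesgue_integral_def
  proof (rule integral_mono)
    show "integrable lborel (\<lambda>\<xi>. indicat_real {0<..s} \<xi> *\<^sub>R \<bar>l \<xi> * (\<tau> - \<xi>) powr (\<alpha> - 2)\<bar>)"
      using set_integrable_norm[OF i] unfolding set_integrable_def by simp
    show "integrable lborel (\<lambda>\<xi>. C * ((\<tau> - \<xi>) powr (\<alpha> - 2) * indicator {0..s} \<xi>))"
      using FTC by (auto simp: has_bochner_integral_iff)
    show "indicat_real {0<..s} \<xi> *\<^sub>R \<bar>l \<xi> * (\<tau> - \<xi>) powr (\<alpha> - 2)\<bar> \<le> C * ((\<tau> - \<xi>) powr (\<alpha> - 2) * indicator {0..s} \<xi>)" for \<xi>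
      using l[of \<xi>] C by (auto simp: indicator_def abs_mult intro!: mult_right_mono)
  qed
  also have "\<dots> = C * ((\<tau> - s) powr (\<alpha> - 1) / (1 - \<alpha>) - (\<tau> - 0) powr (\<alpha> - 1) / (1 - \<alpha>))"
    using FTC by (simp add: has_bochner_integral_iff)
  also have "\<dots> \<le> C * ((\<tau> - s) powr (\<alpha> - 1) / (1 - \<alpha>))"
    using C a by (intro mult_left_mono) auto
  finally have *: "\<bar>LBINT \<xi>:{0<..s}. l \<xi> * (\<tau> - \<xi>) powr (\<alpha> - 2)\<bar> \<le> C * ((\<tau> - s) powr (\<alpha> - 1) / (1 - \<alpha>))" .
  have "\<bar>memory_deriv \<alpha> s l \<tau>\<bar> = (1 - \<alpha>) / Gamma \<alpha> * \<bar>LBINT \<xi>:{0<..s}. l \<xi> * (\<tau> - \<xi>) powr (\<alpha> - 2)\<bar>"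
    unfolding memory_deriv_def using a G by (simp add: abs_mult)
  also have "\<dots> \<le> (1 - \<alpha>) / Gamma \<alpha> * (C * ((\<tau> - s) powr (\<alpha> - 1) / (1 - \<alpha>)))"
    using * a G by (intro mult_left_mono) auto
  also have "\<dots> = C / Gamma \<alpha> * (\<tau> - s) powr (\<alpha> - 1)"
  proof -
    have "1 - \<alpha> \<noteq> 0" using a by simp
    then show ?thesis by simp
  qed
  finally show ?thesis .
qed

lemma memory_continuous:
  assumes "0 < \<alpha>" "\<alpha> \<le> 1" "l \<in> borel_measurable borel" "\<And>\<xi>. \<bar>l \<xi>\<bar> \<le> C" "0 \<le> s"
  shows "continuous_on {s<..T} (memory \<alpha> s l)"
  using memory_has_derivative[OF assms(1-4,5)]
  by (intro continuous_at_imp_continuous_on ballI DERIV_isCont) auto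

lemma caputo_deriv_cong:
  assumes xy: "\<And>\<xi>. 0 \<le> \<xi> \<Longrightarrow> \<xi> \<le> s \<Longrightarrow> x \<xi> = y \<xi>" and \<tau>: "0 < \<tau>" "\<tau> < s"
  shows "caputo_deriv \<alpha> x \<tau> = caputo_deriv \<alpha> y \<tau>"
proof -
  have "eventually (\<lambda>\<sigma>. \<sigma> \<in> {0<..<s}) (nhds \<tau>)" using \<tau> by (intro eventually_nhds_in_open) auto
  then have "eventually (\<lambda>\<sigma>. (LINT \<xi>:{0..\<sigma>}|lebesgue. (x \<xi> - x 0) / (\<sigma> - \<xi>) powr \<alpha>)
     = (LINT \<xi>:{0..\<sigma>}|lebesgue. (y \<xi> - y 0) / (\<sigma> - \<xi>) powr \<alpha>)) (nhds \<tau>)"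
  proof eventually_elim
    case (elim \<sigma>)
    then show ?case unfolding set_lebesgue_integral_def
      by (intro Bochner_Integration.integral_cong refl) (use xy \<tau> in \<open>auto simp: indicator_def\<close>)
  qed
  then show ?thesis unfolding caputo_deriv_def by (simp add: deriv_cong_ev)
qed

locale smooth_rhs =
  fixes T \<alpha> \<gamma> :: real and f ft fx :: "real \<Rightarrow> real \<Rightarrow> real"
  assumes T0: "0 < T" and a0: "0 < \<alpha>" and a1: "\<alpha> < 1"
    and C1: "C1_with_partials T f ft fx"
    and g0: "0 \<le> \<gamma>" and growth: "\<And>\<tau> x. 0 \<le> \<tau> \<Longrightarrow> \<tau> \<le> T \<Longrightarrow> \<bar>f \<tau> x\<bar> \<le> \<gamma> * (1 + \<bar>x\<bar>)"
begin

lemma a1': "\<alpha> \<le> 1" using a1 by simp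

lemma ft_deriv: "0 \<le> \<tau> \<Longrightarrow> \<tau> \<le> T \<Longrightarrow> ((\<lambda>s. f s x) has_real_derivative ft \<tau> x) (at \<tau> within {0..T})"
  and fx_deriv: "0 \<le> \<tau> \<Longrightarrow> \<tau> \<le> T \<Longrightarrow> (f \<tau> has_real_derivative fx \<tau> x) (at x)"
  and ft_cont: "continuous_on ({0..T} \<times> UNIV) (\<lambda>(\<tau>, x). ft \<tau> x)"
  and fx_cont: "continuous_on ({0..T} \<times> UNIV) (\<lambda>(\<tau>, x). fx \<tau> x)"
  using C1 unfolding C1_with_partials_def by auto

text \<open>Continuous partial derivatives imply differentiability: the increment in \<open>x\<close> is controlled by the mean value
  theorem, the increment in \<open>\<tau>\<close> is needed at the fixed state \<open>x\<close> only.\<close>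

lemma f_first_order:
  assumes \<tau>: "0 \<le> \<tau>" "\<tau> \<le> T" and e: "0 < e"
  shows "\<exists>d>0. \<forall>\<sigma> y. 0 \<le> \<sigma> \<longrightarrow> \<sigma> \<le> T \<longrightarrow> \<bar>\<sigma> - \<tau>\<bar> < d \<longrightarrow> \<bar>y - x\<bar> < d \<longrightarrow>
    \<bar>f \<sigma> y - f \<tau> x - ft \<tau> x * (\<sigma> - \<tau>) - fx \<tau> x * (y - x)\<bar> \<le> e * (\<bar>\<sigma> - \<tau>\<bar> + \<bar>y - x\<bar>)"
proof -
  obtain d1 where d1: "d1 > 0" "\<forall>\<sigma>\<in>{0..T}. \<bar>\<sigma> - \<tau>\<bar> < d1 \<longrightarrow> \<bar>f \<sigma> x - f \<tau> x - ft \<tau> x * (\<sigma> - \<tau>)\<bar> \<le> e * \<bar>\<sigma> - \<tau>\<bar>"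
    using ft_deriv[OF \<tau>, of x] e unfolding has_field_derivative_def has_derivative_within_alt by (auto simp: mult.commute)
  obtain d2 where d2: "d2 > 0" "\<And>\<sigma> y. \<sigma> \<in> {0..T} \<Longrightarrow> dist (\<sigma>, y) (\<tau>, x) < d2 \<Longrightarrow> \<bar>fx \<sigma> y - fx \<tau> x\<bar> < e"
    using fx_cont \<tau> e unfolding continuous_on_iff by (force simp: dist_real_def)
  show ?thesis
  proof (intro exI[of _ "min d1 (d2/2)"] conjI allI impI)
    show "0 < min d1 (d2/2)" using d1 d2 by simp
    fix \<sigma> y assume \<sigma>: "0 \<le> \<sigma>" "\<sigma> \<le> T" and n: "\<bar>\<sigma> - \<tau>\<bar> < min d1 (d2/2)" "\<bar>y - x\<bar> < min d1 (d2/2)"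
    have "norm ((f \<sigma> y - fx \<tau> x * y) - (f \<sigma> x - fx \<tau> x * x)) \<le> e * norm (y - x)"
    proof (rule field_differentiable_bound[of "closed_segment x y"])
      fix z assume z: "z \<in> closed_segment x y"
      show "((\<lambda>z. f \<sigma> z - fx \<tau> x * z) has_field_derivative fx \<sigma> z - fx \<tau> x) (at z within closed_segment x y)"
        using has_field_derivative_at_within[OF fx_deriv[OF \<sigma>, of z]] by (auto intro!: derivative_eq_intros)
      have "\<bar>z - x\<bar> < d2/2" using z n by (auto simp: closed_segment_eq_real_ivl split: if_splits)
      have "dist (\<sigma>, z) (\<tau>, x) \<le> \<bar>\<sigma> - \<tau>\<bar> + \<bar>z - x\<bar>"
        unfolding dist_Pair_Pair dist_real_def by (rule sqrt_sum_squares_le_sum) auto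
      then have "dist (\<sigma>, z) (\<tau>, x) < d2" using n \<open>\<bar>z - x\<bar> < d2/2\<close> by simp
      then show "norm (fx \<sigma> z - fx \<tau> x) \<le> e" using d2(2)[of \<sigma> z] \<sigma> by simp
    qed auto
    then have "\<bar>f \<sigma> y - f \<sigma> x - fx \<tau> x * (y - x)\<bar> \<le> e * \<bar>y - x\<bar>" by (simp add: algebra_simps)
    moreover have "\<bar>f \<sigma> x - f \<tau> x - ft \<tau> x * (\<sigma> - \<tau>)\<bar> \<le> e * \<bar>\<sigma> - \<tau>\<bar>" using d1(2) \<sigma> n by simp
    ultimately show "\<bar>f \<sigma> y - f \<tau> x - ft \<tau> x * (\<sigma> - \<tau>) - fx \<tau> x * (y - x)\<bar> \<le> e * (\<bar>\<sigma> - \<tau>\<bar> + \<bar>y - x\<bar>)"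
      by (simp add: algebra_simps)
  qed
qed

lemma f_lipschitz:
  obtains M where "0 \<le> M" "\<forall>\<sigma>\<in>{0..T}. \<forall>\<tau>\<in>{0..T}. \<forall>y\<in>{-N..N}. \<forall>x\<in>{-N..N}. \<bar>f \<sigma> y - f \<tau> x\<bar> \<le> M * (\<bar>\<sigma> - \<tau>\<bar> + \<bar>y - x\<bar>)"
    "\<forall>\<tau>\<in>{0..T}. \<forall>x\<in>{-N..N}. \<bar>ft \<tau> x\<bar> \<le> M \<and> \<bar>fx \<tau> x\<bar> \<le> M"
proof -
  have cpt: "compact ({0..T} \<times> {-N..N})" by (intro compact_Times compact_Icc)
  have "bounded ((\<lambda>(\<tau>, x). ft \<tau> x) ` ({0..T} \<times> {-N..N}))" "bounded ((\<lambda>(\<tau>, x). fx \<tau> x) ` ({0..T} \<times> {-N..N}))"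
    using ft_cont fx_cont by (intro compact_imp_bounded compact_continuous_image cpt; force intro: continuous_on_subset)+
  then obtain M1 M2 where M: "\<forall>\<tau>\<in>{0..T}. \<forall>x\<in>{-N..N}. \<bar>ft \<tau> x\<bar> \<le> M1" "\<forall>\<tau>\<in>{0..T}. \<forall>x\<in>{-N..N}. \<bar>fx \<tau> x\<bar> \<le> M2"
    unfolding bounded_iff by auto
  define M where "M = max 0 (max M1 M2)"
  have M3: "\<forall>\<tau>\<in>{0..T}. \<forall>x\<in>{-N..N}. \<bar>ft \<tau> x\<bar> \<le> M \<and> \<bar>fx \<tau> x\<bar> \<le> M"
    using M unfolding M_def by fastforce
  have "\<bar>f \<sigma> y - f \<tau> x\<bar> \<le> M * (\<bar>\<sigma> - \<tau>\<bar> + \<bar>y - x\<bar>)"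
    if "\<sigma> \<in> {0..T}" "\<tau> \<in> {0..T}" "y \<in> {-N..N}" "x \<in> {-N..N}" for \<sigma> \<tau> x y
  proof -
    have "norm (f \<sigma> y - f \<sigma> x) \<le> M * norm (y - x)"
      by (rule field_differentiable_bound[of "{-N..N}" _ "fx \<sigma>"])
         (use that M3 has_field_derivative_at_within[OF fx_deriv] in auto)
    moreover have "norm (f \<sigma> x - f \<tau> x) \<le> M * norm (\<sigma> - \<tau>)"
      by (rule field_differentiable_bound[of "{0..T}" "\<lambda>s. f s x" "\<lambda>s. ft s x"])
         (use that M3 ft_deriv in auto)
    ultimately show ?thesis by (simp add: algebra_simps)
  qed
  then show thesis using that[of M] M3 unfolding M_def by simp
qed

lemma f_cont: "continuous_on ({0..T} \<times> UNIV) (\<lambda>(\<tau>, x). f \<tau> x)"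
  unfolding continuous_on_iff
proof (intro ballI allI impI)
  fix p e assume p: "p \<in> {0..T} \<times> (UNIV :: real set)" and e: "(0::real) < e"
  obtain \<tau> x where px: "p = (\<tau>, x)" by force
  with p have \<tau>: "0 \<le> \<tau>" "\<tau> \<le> T" by auto
  obtain d where d: "d > 0" "\<And>\<sigma> y. 0 \<le> \<sigma> \<Longrightarrow> \<sigma> \<le> T \<Longrightarrow> \<bar>\<sigma> - \<tau>\<bar> < d \<Longrightarrow> \<bar>y - x\<bar> < d \<Longrightarrow>
    \<bar>f \<sigma> y - f \<tau> x - ft \<tau> x * (\<sigma> - \<tau>) - fx \<tau> x * (y - x)\<bar> \<le> 1 * (\<bar>\<sigma> - \<tau>\<bar> + \<bar>y - x\<bar>)"
    using f_first_order[OF \<tau> zero_less_one, of x] by auto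
  define K where "K = 1 + \<bar>ft \<tau> x\<bar> + \<bar>fx \<tau> x\<bar>"
  have K: "K > 0" by (simp add: K_def add_pos_nonneg)
  show "\<exists>d>0. \<forall>p'\<in>{0..T} \<times> UNIV. dist p' p < d \<longrightarrow> dist (case p' of (\<tau>, x) \<Rightarrow> f \<tau> x) (case p of (\<tau>, x) \<Rightarrow> f \<tau> x) < e"
  proof (intro exI[of _ "min d (e / (2 * K))"] conjI ballI impI)
    show "0 < min d (e / (2 * K))" using d e K by simp
    fix p' assume p': "p' \<in> {0..T} \<times> (UNIV :: real set)" and dist: "dist p' p < min d (e / (2 * K))"
    obtain \<sigma> y where p'x: "p' = (\<sigma>, y)" by force
    have n: "\<bar>\<sigma> - \<tau>\<bar> < min d (e / (2 * K))" "\<bar>y - x\<bar> < min d (e / (2 * K))"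
      using dist dist_fst_le[of p' p] dist_snd_le[of p' p] unfolding px p'x by (auto simp: dist_real_def)
    have "\<bar>f \<sigma> y - f \<tau> x\<bar> \<le> \<bar>ft \<tau> x * (\<sigma> - \<tau>)\<bar> + \<bar>fx \<tau> x * (y - x)\<bar> + (\<bar>\<sigma> - \<tau>\<bar> + \<bar>y - x\<bar>)"
      using d(2)[of \<sigma> y] n p' p'x by auto
    also have "\<dots> \<le> K * (\<bar>\<sigma> - \<tau>\<bar> + \<bar>y - x\<bar>)"
      unfolding K_def abs_mult by (simp add: algebra_simps)
    also have "\<dots> < K * (e / (2 * K) + e / (2 * K))" using n K by (intro mult_strict_left_mono) auto
    also have "\<dots> = e" using K by (simp add: field_simps)
    finally show "dist (case p' of (\<tau>, x) \<Rightarrow> f \<tau> x) (case p of (\<tau>, x) \<Rightarrow> f \<tau> x) < e"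
      unfolding px p'x by (simp add: dist_real_def)
  qed
qed

lemma comp_continuous:
  assumes F: "continuous_on ({0..T} \<times> UNIV) (\<lambda>(\<tau>, x). F \<tau> x)" and u: "continuous_on {s<..T} u" and s: "0 \<le> s"
  shows "continuous_on {s<..T} (\<lambda>\<xi>. F \<xi> (u \<xi> :: real) :: real)"
proof -
  have "continuous_on {s<..T} (\<lambda>\<xi>. (\<xi>, u \<xi>))" by (intro continuous_intros u)
  then have "continuous_on {s<..T} ((\<lambda>(\<tau>, x). F \<tau> x) \<circ> (\<lambda>\<xi>. (\<xi>, u \<xi>)))"
    by (rule continuous_on_compose) (rule continuous_on_subset[OF F], use s in auto)
  then show ?thesis by (simp add: o_def)
qed

text \<open>A bound for solutions with forcing term bounded by \<open>K\<close>, in which the growth rate of \<open>f\<close> enters but no Lipschitz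
  constant.\<close>

definition apriori :: "real \<Rightarrow> real" where
  "apriori K = volterra_const \<alpha> 1 \<gamma> T * (1 + K)"

text \<open>The right-hand side is truncated outside the a priori bound, which makes it globally Lipschitz and preserves the
  growth condition.  The solution of the truncated problem obeys the same a priori bound, so the truncation is never
  active.\<close>

lemma forced_solution_exists:
  assumes s: "0 \<le> s" "s < T" and A: "continuous_on {s<..T} A" "\<And>\<tau>. s < \<tau> \<Longrightarrow> \<tau> \<le> T \<Longrightarrow> \<bar>A \<tau>\<bar> \<le> K"
  shows "\<exists>u. continuous_on {s<..T} u \<and> (\<forall>\<tau>\<in>{s<..T}. \<bar>u \<tau>\<bar> \<le> apriori K \<and> u \<tau> = A \<tau> + RL \<alpha> s (\<lambda>\<xi>. f \<xi> (u \<xi>)) \<tau>)"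
proof -
  have K: "0 \<le> K" using A(2)[of T] s by simp
  define N where "N = apriori K"
  have N: "0 \<le> N" unfolding N_def apriori_def using K volterra_const_nonneg by simp
  obtain M where M: "0 \<le> M" "\<forall>\<sigma>\<in>{0..T}. \<forall>\<tau>\<in>{0..T}. \<forall>y\<in>{-N..N}. \<forall>x\<in>{-N..N}. \<bar>f \<sigma> y - f \<tau> x\<bar> \<le> M * (\<bar>\<sigma> - \<tau>\<bar> + \<bar>y - x\<bar>)"
    using f_lipschitz by metis
  define cl where "cl = (\<lambda>y. max (-N) (min N y))"
  have cl: "cl y \<in> {-N..N}" "\<bar>cl y\<bar> \<le> \<bar>y\<bar>" "\<bar>cl y - cl z\<bar> \<le> \<bar>y - z\<bar>" for y z
    using N unfolding cl_def by (auto simp: max_def min_def abs_if)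
  have cl_id: "cl y = y" if "\<bar>y\<bar> \<le> N" for y using that unfolding cl_def by auto
  define h where "h = (\<lambda>\<xi> y. f \<xi> (cl y))"
  define C where "C = (K + \<gamma>) * T powr (1 - \<alpha>)"
  have pw: "c \<le> (c * T powr (1 - \<alpha>)) * (\<tau> - s) powr (\<alpha> - 1)" if "s < \<tau>" "\<tau> \<le> T" "0 \<le> c" for c \<tau>
    using const_le_powr[of "\<tau> - s" T \<alpha> c] that s a1 by simp
  interpret weighted_volterra \<alpha> s T M C A h
  proof
    fix \<tau> assume \<tau>: "s < \<tau>" "\<tau> \<le> T"
    have "(K + \<gamma>) \<le> C * (\<tau> - s) powr (\<alpha> - 1)" unfolding C_def using pw \<tau> K g0 by simp
    then show "\<bar>A \<tau>\<bar> \<le> C * (\<tau> - s) powr (\<alpha> - 1)" using A(2)[OF \<tau>] g0 by linarith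
    have "\<bar>h \<tau> 0\<bar> \<le> \<gamma>" using growth[of \<tau> "cl 0"] \<tau> s N unfolding h_def by (simp add: cl_id)
    then show "\<bar>h \<tau> 0\<bar> \<le> C * (\<tau> - s) powr (\<alpha> - 1)"
      using \<open>(K + \<gamma>) \<le> C * (\<tau> - s) powr (\<alpha> - 1)\<close> K by linarith
    fix y z
    have "\<bar>h \<tau> y - h \<tau> z\<bar> \<le> M * (\<bar>\<tau> - \<tau>\<bar> + \<bar>cl y - cl z\<bar>)"
      unfolding h_def using M(2)[rule_format, of \<tau> \<tau> "cl y" "cl z"] cl(1) \<tau> s by simp
    also have "\<dots> \<le> M * \<bar>y - z\<bar>" using M(1) cl(3)[of y z] by (intro mult_left_mono) auto
    finally show "\<bar>h \<tau> y - h \<tau> z\<bar> \<le> M * \<bar>y - z\<bar>" .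
  next
    fix u :: "real \<Rightarrow> real" assume "continuous_on {s<..T} u"
    then have "continuous_on {s<..T} (\<lambda>\<xi>. cl (u \<xi>))" unfolding cl_def by (intro continuous_intros)
    then show "continuous_on {s<..T} (\<lambda>\<xi>. h \<xi> (u \<xi>))" unfolding h_def by (rule comp_continuous[OF f_cont _ s(1)])
  qed (use a0 a1 s M A in auto)
  obtain u where u: "solution u" using ex_solution by blast
  obtain B where B: "\<forall>\<tau>\<in>{s<..T}. \<bar>u \<tau>\<bar> \<le> B * (\<tau> - s) powr (\<alpha> - 1)"
    and uc: "continuous_on {s<..T} u" and ueq: "\<forall>\<tau>\<in>{s<..T}. u \<tau> = A \<tau> + RL \<alpha> s (\<lambda>\<xi>. h \<xi> (u \<xi>)) \<tau>"
    using u unfolding solution_def by blast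
  have uN: "\<bar>u \<tau>\<bar> \<le> N" if "s < \<tau>" "\<tau> \<le> T" for \<tau>
  proof -
    have "\<bar>u \<tau>\<bar> \<le> volterra_const \<alpha> 1 \<gamma> T * (1 + K) * (\<tau> - s) powr (1 - 1)"
    proof (rule volterra_bound[OF a0 a1' zero_less_one order_refl g0, where g=A and h="\<lambda>\<xi>. h \<xi> (u \<xi>)" and B=B])
      show "T - s \<le> T" "0 \<le> 1 + K" using s K by auto
      show "set_borel_measurable borel {s<..T} u" by (rule set_borel_measurable_continuous'[OF uc order_refl])
      fix \<tau> assume \<tau>: "s < \<tau>" "\<tau> \<le> T"
      show "\<bar>u \<tau>\<bar> \<le> B * (\<tau> - s) powr (\<alpha> - 1)" using B \<tau> by simp
      show "u \<tau> = A \<tau> + RL \<alpha> s (\<lambda>\<xi>. h \<xi> (u \<xi>)) \<tau>" using bspec[OF ueq, of \<tau>] \<tau> by simp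
      show "\<bar>A \<tau>\<bar> \<le> (1 + K) * (\<tau> - s) powr (1 - 1)" using A(2)[OF \<tau>] \<tau> by simp
      have "\<bar>h \<tau> (u \<tau>)\<bar> \<le> \<gamma> * (1 + \<bar>cl (u \<tau>)\<bar>)" unfolding h_def using \<tau> s by (intro growth) auto
      also have "\<dots> \<le> \<gamma> * (\<bar>u \<tau>\<bar> + (1 + K) * (\<tau> - s) powr (1 - 1))"
        using cl(2)[of "u \<tau>"] K \<tau> g0 by (intro mult_left_mono) auto
      finally show "\<bar>h \<tau> (u \<tau>)\<bar> \<le> \<gamma> * (\<bar>u \<tau>\<bar> + (1 + K) * (\<tau> - s) powr (1 - 1))" .
    qed (use that in auto)
    then show ?thesis using that unfolding N_def apriori_def by simp
  qed
  have "RL \<alpha> s (\<lambda>\<xi>. h \<xi> (u \<xi>)) \<tau> = RL \<alpha> s (\<lambda>\<xi>. f \<xi> (u \<xi>)) \<tau>" if "\<tau> \<in> {s<..T}" for \<tau>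
    by (rule RL_cong) (use that uN cl_id in \<open>auto simp: h_def\<close>)
  then show ?thesis using uc ueq uN unfolding N_def by (intro exI[of _ u]) auto
qed

text \<open>Up to time \<open>s\<close> the densities of \<open>x\<close> and \<open>y\<close> agree almost everywhere, since both are Caputo derivatives of the same
  function.  Therefore \<open>x\<close> and \<open>u\<close> satisfy Volterra equations with the same memory term.\<close>

lemma cauchy_solution_unique:
  assumes s: "0 \<le> s" "s < T"
    and [measurable]: "l \<in> borel_measurable borel" and l: "0 \<le> C" "\<And>\<xi>. \<bar>l \<xi>\<bar> \<le> C"
    and y: "\<And>\<tau>. 0 \<le> \<tau> \<Longrightarrow> \<tau> \<le> T \<Longrightarrow> y \<tau> = y 0 + RL \<alpha> 0 l \<tau>"
    and uc: "continuous_on {s<..T} u" and ub: "\<And>\<tau>. s < \<tau> \<Longrightarrow> \<tau> \<le> T \<Longrightarrow> \<bar>u \<tau>\<bar> \<le> N"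
    and u: "\<And>\<tau>. s < \<tau> \<Longrightarrow> \<tau> \<le> T \<Longrightarrow> u \<tau> = (y 0 + memory \<alpha> s l \<tau>) + RL \<alpha> s (\<lambda>\<xi>. f \<xi> (u \<xi>)) \<tau>"
    and x: "cauchy_solution \<alpha> T f s (restrict y {0..s}) x" and \<tau>0: "s < \<tau>0" "\<tau>0 \<le> T"
  shows "x \<tau>0 = u \<tau>0"
proof -
  have xAC: "x \<in> AC \<alpha> T T" and xw: "\<And>\<tau>. 0 \<le> \<tau> \<Longrightarrow> \<tau> \<le> s \<Longrightarrow> x \<tau> = y \<tau>"
    and xde: "AE \<tau> in lborel. s \<le> \<tau> \<and> \<tau> \<le> T \<longrightarrow> caputo_deriv \<alpha> x \<tau> = f \<tau> (x \<tau>)"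
    using x unfolding cauchy_solution_def by (auto simp: AE_restrict_space_iff AE_completion_iff)
  obtain l2 C2 where l2m[measurable]: "l2 \<in> borel_measurable borel" and l2: "0 \<le> C2" "\<And>\<xi>. \<bar>l2 \<xi>\<bar> \<le> C2"
    "\<And>\<tau>. 0 \<le> \<tau> \<Longrightarrow> \<tau> \<le> T \<Longrightarrow> x \<tau> = x 0 + RL \<alpha> 0 l2 \<tau>"
    by (rule AC_borel_density[OF xAC order_refl]) (rule that)
  have x0: "x 0 = y 0" using xw[of 0] s by simp
  have cx: "AE \<tau> in lborel. 0 \<le> \<tau> \<and> \<tau> \<le> T \<longrightarrow> caputo_deriv \<alpha> x \<tau> = l2 \<tau>"
    by (rule caputo_deriv_AE[OF a0 a1 l2(1) l2m l2(2,3)])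
  have cy: "AE \<tau> in lborel. 0 \<le> \<tau> \<and> \<tau> \<le> T \<longrightarrow> caputo_deriv \<alpha> y \<tau> = l \<tau>"
    by (rule caputo_deriv_AE[OF a0 a1 l(1) _ l(2) y]) simp
  have "AE \<tau> in lborel. \<tau> \<noteq> s" by (rule AE_lborel_singleton)
  with cx cy have l2l: "AE \<tau> in lborel. 0 < \<tau> \<and> \<tau> \<le> s \<longrightarrow> l2 \<tau> = l \<tau>"
  proof eventually_elim
    case (elim \<tau>)
    then show ?case using caputo_deriv_cong[of s x y \<tau> \<alpha>] xw s by auto
  qed
  have l2f: "AE \<tau> in lborel. s < \<tau> \<and> \<tau> \<le> T \<longrightarrow> l2 \<tau> = f \<tau> (x \<tau>)"
    using cx xde by eventually_elim (use s in auto)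
  define N' where "N' = max N (\<bar>y 0\<bar> + RL_const \<alpha> 1 T * C2)"
  have N': "\<bar>u \<tau>\<bar> \<le> N'" "\<bar>x \<tau>\<bar> \<le> N'" if "s < \<tau>" "\<tau> \<le> T" for \<tau>
  proof -
    show "\<bar>u \<tau>\<bar> \<le> N'" using ub[OF that] by (simp add: N'_def)
    have "\<bar>RL \<alpha> 0 l2 \<tau>\<bar> \<le> RL_const \<alpha> 1 T * C2"
      by (rule RL_bounded) (use a0 a1 l2 that in auto)
    then show "\<bar>x \<tau>\<bar> \<le> N'" using l2(3)[of \<tau>] that s x0 by (simp add: N'_def)
  qed
  have N'0: "0 \<le> N'" using N'(1)[OF \<tau>0] by linarith
  obtain M where M: "0 \<le> M" "\<forall>\<sigma>\<in>{0..T}. \<forall>\<tau>\<in>{0..T}. \<forall>y\<in>{-N'..N'}. \<forall>x\<in>{-N'..N'}. \<bar>f \<sigma> y - f \<tau> x\<bar> \<le> M * (\<bar>\<sigma> - \<tau>\<bar> + \<bar>y - x\<bar>)"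
    using f_lipschitz by metis
  have fuc: "continuous_on {s<..T} (\<lambda>\<xi>. f \<xi> (u \<xi>))" by (rule comp_continuous[OF f_cont uc s(1)])
  have [measurable]: "(\<lambda>\<xi>. indicat_real {s<..T} \<xi> * u \<xi>) \<in> borel_measurable borel"
    "(\<lambda>\<xi>. indicat_real {s<..T} \<xi> * f \<xi> (u \<xi>)) \<in> borel_measurable borel"
    using set_borel_measurable_continuous'[OF uc order_refl] set_borel_measurable_continuous'[OF fuc order_refl]
    unfolding set_borel_measurable_def by simp_all
  define z where "z = (\<lambda>\<tau>. indicator {s<..T} \<tau> * (y 0 + RL \<alpha> 0 l2 \<tau>) - indicator {s<..T} \<tau> * u \<tau>)"
  define g where "g = (\<lambda>\<xi>. indicator {s<..T} \<xi> * l2 \<xi> - indicat_real {s<..T} \<xi> * f \<xi> (u \<xi>))"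
  \<comment> \<open>The Lipschitz estimate for \<open>g\<close> holds almost everywhere only; truncating \<open>g\<close> makes it hold everywhere and does not change the integral.\<close>
  define h where "h = (\<lambda>\<xi>. max (- (M * \<bar>z \<xi>\<bar>)) (min (M * \<bar>z \<xi>\<bar>) (g \<xi>)))"
  have [measurable]: "z \<in> borel_measurable borel" unfolding z_def by measurable
  have [measurable]: "g \<in> borel_measurable borel" unfolding g_def by measurable
  have [measurable]: "h \<in> borel_measurable borel" unfolding h_def by measurable
  have zx: "z \<tau> = x \<tau> - u \<tau>" if "s < \<tau>" "\<tau> \<le> T" for \<tau>
    using l2(3)[of \<tau>] that s x0 by (simp add: z_def)
  have hg: "AE \<xi> in lborel. s < \<xi> \<and> \<xi> \<le> T \<longrightarrow> g \<xi> = h \<xi>"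
    using l2f
  proof (eventually_elim, intro impI)
    fix \<xi> assume "s < \<xi> \<and> \<xi> \<le> T \<longrightarrow> l2 \<xi> = f \<xi> (x \<xi>)" and \<xi>: "s < \<xi> \<and> \<xi> \<le> T"
    then have "\<bar>g \<xi>\<bar> \<le> M * \<bar>z \<xi>\<bar>"
      using M(2)[rule_format, of \<xi> \<xi> "x \<xi>" "u \<xi>"] N'[of \<xi>] zx[of \<xi>] s by (simp add: g_def abs_le_iff)
    then show "g \<xi> = h \<xi>" unfolding h_def by auto
  qed
  have fub: "\<bar>f \<xi> (u \<xi>)\<bar> \<le> \<gamma> * (1 + N')" if "s < \<xi>" "\<xi> \<le> T" for \<xi>
  proof -
    have "\<bar>f \<xi> (u \<xi>)\<bar> \<le> \<gamma> * (1 + \<bar>u \<xi>\<bar>)" using that s by (intro growth) auto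
    also have "\<dots> \<le> \<gamma> * (1 + N')" using N'(1)[OF that] g0 by (intro mult_left_mono) auto
    finally show ?thesis .
  qed
  have "\<bar>z \<tau>0\<bar> \<le> volterra_const \<alpha> \<alpha> M T * 0 * (\<tau>0 - s) powr (\<alpha> - 1)"
  proof (rule volterra_bound[OF a0 a1' a0 a1' M(1), where g="\<lambda>_. 0" and h=h and u=z and B="2 * N' * T powr (1 - \<alpha>)"])
    show "set_borel_measurable borel {s<..T} z" by (intro set_borel_measurable_borel) auto
    fix \<tau> assume \<tau>: "s < \<tau>" "\<tau> \<le> T"
    have "\<bar>z \<tau>\<bar> \<le> 2 * N'" using zx[OF \<tau>] N'[OF \<tau>] by linarith
    also have "\<dots> \<le> 2 * N' * T powr (1 - \<alpha>) * (\<tau> - s) powr (\<alpha> - 1)"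
      using \<tau> s a1 N'0 by (intro const_le_powr) auto
    finally show "\<bar>z \<tau>\<bar> \<le> 2 * N' * T powr (1 - \<alpha>) * (\<tau> - s) powr (\<alpha> - 1)" .
    have "x \<tau> = y 0 + memory \<alpha> s l \<tau> + RL \<alpha> s l2 \<tau>"
      using l2(3)[of \<tau>] \<tau> s x0 RL_split[OF a0 a1' l2(1) l2m l2(2) s(1), of \<tau>] memory_cong_AE[OF l2m _ l2l, of \<alpha> \<tau>]
      by simp
    then have "z \<tau> = RL \<alpha> s l2 \<tau> - RL \<alpha> s (\<lambda>\<xi>. f \<xi> (u \<xi>)) \<tau>"
      using zx[OF \<tau>] u[OF \<tau>] by linarith
    also have "\<dots> = RL \<alpha> s (\<lambda>\<xi>. l2 \<xi> - f \<xi> (u \<xi>)) \<tau>"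
      by (rule RL_diff[where \<beta>=1 and C=C2 and C'="\<gamma> * (1 + N')"])
         (use a0 a1 \<tau> l2 fub set_borel_measurable_continuous'[OF fuc] in \<open>auto intro!: set_borel_measurable_borel\<close>)
    also have "\<dots> = RL \<alpha> s g \<tau>"
      by (rule RL_cong) (use \<tau> in \<open>auto simp: g_def\<close>)
    also have "\<dots> = RL \<alpha> s h \<tau>"
    proof (rule RL_cong_AE)
      show "AE \<xi> in lborel. s < \<xi> \<and> \<xi> \<le> \<tau> \<longrightarrow> g \<xi> = h \<xi>"
        using hg by eventually_elim (use \<tau> in auto)
    qed (auto intro!: set_borel_measurable_borel)
    finally show "z \<tau> = 0 + RL \<alpha> s h \<tau>" by simp
    have "0 \<le> M * \<bar>z \<tau>\<bar>" using M by simp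
    then show "\<bar>h \<tau>\<bar> \<le> M * (\<bar>z \<tau>\<bar> + 0 * (\<tau> - s) powr (\<alpha> - 1))"
      unfolding h_def by (auto simp: abs_le_iff max_def min_def)
  qed (use s \<tau>0 in auto)
  then show ?thesis using zx[OF \<tau>0] by simp
qed

text \<open>The solution of the integral equation, glued to \<open>y\<close> at time \<open>s\<close>, has the density \<open>l\<close> before and \<open>f(\<cdot>, u)\<close> after
  \<open>s\<close>.  The bound does not depend on \<open>s\<close>.\<close>

lemma the_solution_integral_equation:
  assumes s: "0 \<le> s" "s < T"
    and lm[measurable]: "l \<in> borel_measurable borel" and l: "0 \<le> C" "\<And>\<xi>. \<bar>l \<xi>\<bar> \<le> C"
    and y: "\<And>\<tau>. 0 \<le> \<tau> \<Longrightarrow> \<tau> \<le> T \<Longrightarrow> y \<tau> = y 0 + RL \<alpha> 0 l \<tau>"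
  defines "X \<equiv> the_solution \<alpha> T f s (restrict y {0..s})"
  shows "continuous_on {s<..T} X"
    "\<And>\<tau>. s < \<tau> \<Longrightarrow> \<tau> \<le> T \<Longrightarrow> X \<tau> = y 0 + memory \<alpha> s l \<tau> + RL \<alpha> s (\<lambda>\<xi>. f \<xi> (X \<xi>)) \<tau>"
    "\<And>\<tau>. s < \<tau> \<Longrightarrow> \<tau> \<le> T \<Longrightarrow> \<bar>X \<tau>\<bar> \<le> apriori (\<bar>y 0\<bar> + RL_const \<alpha> 1 T * C)"
proof -
  define A where "A = (\<lambda>\<tau>. y 0 + memory \<alpha> s l \<tau>)"
  define K where "K = \<bar>y 0\<bar> + RL_const \<alpha> 1 T * C"
  have Ac: "continuous_on {s<..T} A" unfolding A_def
    by (intro continuous_intros memory_continuous[OF a0 a1' lm l(2) s(1)])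
  have AK: "\<bar>A \<tau>\<bar> \<le> K" if "s < \<tau>" "\<tau> \<le> T" for \<tau>
    using memory_bounded[OF a0 a1' l(1), where l=l and s=s and \<tau>=\<tau> and T=T] l(2) that unfolding A_def K_def by simp
  obtain u where uc: "continuous_on {s<..T} u"
    and u: "\<forall>\<tau>\<in>{s<..T}. \<bar>u \<tau>\<bar> \<le> apriori K \<and> u \<tau> = A \<tau> + RL \<alpha> s (\<lambda>\<xi>. f \<xi> (u \<xi>)) \<tau>"
    using forced_solution_exists[OF s Ac AK] by blast
  have ub: "\<bar>u \<tau>\<bar> \<le> apriori K" if "s < \<tau>" "\<tau> \<le> T" for \<tau>
    using u that unfolding greaterThanAtMost_iff Ball_def by blast
  have ue: "u \<tau> = (y 0 + memory \<alpha> s l \<tau>) + RL \<alpha> s (\<lambda>\<xi>. f \<xi> (u \<xi>)) \<tau>" if "s < \<tau>" "\<tau> \<le> T" for \<tau>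
    using bspec[OF u, of \<tau>] that unfolding A_def by simp
  define x where "x = restrict (\<lambda>\<tau>. if \<tau> \<le> s then y \<tau> else u \<tau>) {0..T}"
  have fuc: "continuous_on {s<..T} (\<lambda>\<xi>. f \<xi> (u \<xi>))" by (rule comp_continuous[OF f_cont uc s(1)])
  have [measurable]: "(\<lambda>\<xi>. indicat_real {s<..T} \<xi> * f \<xi> (u \<xi>)) \<in> borel_measurable borel"
    using set_borel_measurable_continuous'[OF fuc order_refl] unfolding set_borel_measurable_def by simp
  define l' where "l' = (\<lambda>\<xi>. indicator {..s} \<xi> * l \<xi> + indicat_real {s<..T} \<xi> * f \<xi> (u \<xi>))"
  have l'm[measurable]: "l' \<in> borel_measurable borel" unfolding l'_def by measurable
  define C' where "C' = C + \<gamma> * (1 + apriori K)"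
  have aK: "0 \<le> apriori K" using ub[of T] s by simp
  have C'0: "0 \<le> C'" unfolding C'_def using l g0 aK by simp
  have l'b: "\<bar>l' \<xi>\<bar> \<le> C'" for \<xi>
  proof -
    have "\<bar>f \<xi> (u \<xi>)\<bar> \<le> \<gamma> * (1 + apriori K)" if "s < \<xi>" "\<xi> \<le> T"
    proof -
      have "\<bar>f \<xi> (u \<xi>)\<bar> \<le> \<gamma> * (1 + \<bar>u \<xi>\<bar>)" using that s by (intro growth) auto
      also have "\<dots> \<le> \<gamma> * (1 + apriori K)" using ub[OF that] g0 by (intro mult_left_mono) auto
      finally show ?thesis .
    qed
    moreover have "0 \<le> \<gamma> * (1 + apriori K)" using g0 aK by simp
    ultimately show ?thesis using l(1) l(2)[of \<xi>] unfolding l'_def C'_def by (auto simp: indicator_def)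
  qed
  have x0: "x 0 = y 0" using s T0 by (simp add: x_def)
  have xeq: "x \<tau> = y 0 + RL \<alpha> 0 l' \<tau>" if "0 \<le> \<tau>" "\<tau> \<le> T" for \<tau>
  proof (cases "\<tau> \<le> s")
    case True
    have "RL \<alpha> 0 l' \<tau> = RL \<alpha> 0 l \<tau>" by (rule RL_cong) (use True in \<open>auto simp: l'_def\<close>)
    then show ?thesis using y[OF that] True that by (simp add: x_def)
  next
    case False
    have "RL \<alpha> 0 l' \<tau> = memory \<alpha> s l' \<tau> + RL \<alpha> s l' \<tau>"
      by (rule RL_split[OF a0 a1' C'0 l'm l'b s(1)]) (use False in auto)
    also have "memory \<alpha> s l' \<tau> = memory \<alpha> s l \<tau>" by (rule memory_cong) (auto simp: l'_def)
    also have "RL \<alpha> s l' \<tau> = RL \<alpha> s (\<lambda>\<xi>. f \<xi> (u \<xi>)) \<tau>"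
      by (rule RL_cong) (use that in \<open>auto simp: l'_def\<close>)
    finally show ?thesis using ue[of \<tau>] that False by (simp add: x_def)
  qed
  have sol: "cauchy_solution \<alpha> T f s (restrict y {0..s}) x"
    unfolding cauchy_solution_def
  proof (intro conjI ballI)
    show "x \<in> AC \<alpha> T T"
      by (rule AC_I[OF l'm l'b _ xeq]) (use T0 in \<open>simp_all add: x_def restrict_extensional del: restrict_apply\<close>)
    show "x \<tau> = restrict y {0..s} \<tau>" if "\<tau> \<in> {0..s}" for \<tau>
      using that s by (simp add: x_def)
    have "AE \<tau> in lborel. 0 \<le> \<tau> \<and> \<tau> \<le> T \<longrightarrow> caputo_deriv \<alpha> x \<tau> = l' \<tau>"
      by (rule caputo_deriv_AE[OF a0 a1 C'0 l'm l'b]) (use xeq x0 in simp)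
    moreover have "AE \<tau> in lborel. \<tau> \<noteq> s" by (rule AE_lborel_singleton)
    ultimately have "AE \<tau> in lborel. s \<le> \<tau> \<and> \<tau> \<le> T \<longrightarrow> caputo_deriv \<alpha> x \<tau> = f \<tau> (x \<tau>)"
      by eventually_elim (use s in \<open>auto simp: l'_def x_def\<close>)
    then show "AE \<tau> in lebesgue_on {s..T}. caputo_deriv \<alpha> x \<tau> = f \<tau> (x \<tau>)"
      by (simp add: AE_restrict_space_iff AE_completion_iff)
  qed
  have uniq: "x' = x" if x': "cauchy_solution \<alpha> T f s (restrict y {0..s}) x'" for x'
  proof (rule extensionalityI[of _ "{0..T}"])
    show "x' \<in> extensional {0..T}" using x' unfolding cauchy_solution_def AC_def by blast
    show "x \<in> extensional {0..T}" unfolding x_def by simp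
    fix \<tau> assume \<tau>: "\<tau> \<in> {0..T}"
    show "x' \<tau> = x \<tau>"
    proof (cases "\<tau> \<le> s")
      case True
      then show ?thesis using x' \<tau> unfolding cauchy_solution_def x_def by simp
    next
      case False
      have "x' \<tau> = u \<tau>"
        by (rule cauchy_solution_unique[OF s lm l(1) l(2) y uc ub ue x']) (use False \<tau> in auto)
      then show ?thesis using False \<tau> by (simp add: x_def)
    qed
  qed
  have Xx: "X = x" unfolding X_def the_solution_def using sol uniq by (rule the_equality)
  have Xu: "X \<tau> = u \<tau>" if "s < \<tau>" "\<tau> \<le> T" for \<tau> using that s unfolding Xx x_def by simp
  show "continuous_on {s<..T} X" using uc by (subst continuous_on_cong[OF refl, of _ X u]) (auto simp: Xu)
  fix \<tau> assume \<tau>: "s < \<tau>" "\<tau> \<le> T"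
  show "\<bar>X \<tau>\<bar> \<le> apriori (\<bar>y 0\<bar> + RL_const \<alpha> 1 T * C)" using ub[OF \<tau>] Xu[OF \<tau>] by (simp add: K_def)
  have "RL \<alpha> s (\<lambda>\<xi>. f \<xi> (X \<xi>)) \<tau> = RL \<alpha> s (\<lambda>\<xi>. f \<xi> (u \<xi>)) \<tau>" by (rule RL_cong) (use Xu \<tau> in auto)
  then show "X \<tau> = y 0 + memory \<alpha> s l \<tau> + RL \<alpha> s (\<lambda>\<xi>. f \<xi> (X \<xi>)) \<tau>"
    using ue[OF \<tau>] Xu[OF \<tau>] by simp
qed

end

section \<open>Vanishing perturbations of Volterra equations\<close>

lemma limsup_add_null:
  fixes u v :: "nat \<Rightarrow> ennreal"
  assumes v: "v \<longlonglongrightarrow> 0"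
  shows "limsup (\<lambda>n. u n + v n) \<le> limsup u"
proof (rule dense_ge)
  fix y assume y: "limsup u < y"
  obtain z where z: "limsup u < z" "z < y" using dense[OF y] by blast
  have "eventually (\<lambda>n. u n < z) sequentially"
    using Limsup_le_iff[of sequentially u "limsup u"] z(1) by blast
  moreover have "eventually (\<lambda>n. v n < y - z) sequentially"
    using order_tendstoD(2)[OF v] diff_gr0_ennreal[OF z(2)] by blast
  ultimately have "eventually (\<lambda>n. u n + v n \<le> y) sequentially"
  proof eventually_elim
    case (elim n)
    then have "u n + v n \<le> z + (y - z)" by (intro add_mono) auto
    then show ?case using add_diff_inverse_ennreal[of z y] z by simp
  qed
  then show "limsup (\<lambda>n. u n + v n) \<le> y" by (rule Limsup_bounded)
qed

lemma limsup_cmult_ennreal: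
  fixes u :: "nat \<Rightarrow> ennreal"
  assumes "c < top"
  shows "limsup (\<lambda>n. c * u n) = c * limsup u"
proof (rule Limsup_compose_continuous_mono)
  show "continuous_on UNIV (\<lambda>x. c * x)" by (rule ennreal_continuous_on_cmult[OF assms continuous_on_id])
  show "mono (\<lambda>x. c * x)" by (intro monoI mult_left_mono) auto
qed simp

text \<open>The reverse Fatou lemma turns the equations into the inequality \<open>S \<le> M I\<^sup>\<alpha> S\<close> for the upper limit \<open>S\<close> of \<open>|r n|\<close>, and
  \<open>S\<close> vanishes by \<open>nRL_subsolution_zero\<close>.  Pointwise convergence of the residuals \<open>e\<close> and \<open>\<phi>\<close> is enough,
  which matters because they do not converge uniformly near \<open>t\<close> in the natural weight.\<close>

lemma volterra_perturbation_null:
  fixes r \<phi> e h :: "nat \<Rightarrow> real \<Rightarrow> real"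
  assumes a: "0 < \<alpha>" "\<alpha> \<le> 1" and M: "0 \<le> M" and K: "0 \<le> K"
    and rm: "\<And>n. set_borel_measurable borel {t<..T} (r n)" and pm: "\<And>n. set_borel_measurable borel {t<..T} (\<phi> n)"
    and rb: "\<And>n \<xi>. t < \<xi> \<Longrightarrow> \<xi> \<le> T \<Longrightarrow> \<bar>r n \<xi>\<bar> \<le> K * (\<xi> - t) powr (\<alpha> - 1)"
    and pb: "\<And>n \<xi>. t < \<xi> \<Longrightarrow> \<xi> \<le> T \<Longrightarrow> \<bar>\<phi> n \<xi>\<bar> \<le> K * (\<xi> - t) powr (\<alpha> - 1)"
    and p0: "\<And>\<xi>. t < \<xi> \<Longrightarrow> \<xi> \<le> T \<Longrightarrow> (\<lambda>n. \<phi> n \<xi>) \<longlonglongrightarrow> 0"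
    and e0: "\<And>\<tau>. t < \<tau> \<Longrightarrow> \<tau> \<le> T \<Longrightarrow> (\<lambda>n. e n \<tau>) \<longlonglongrightarrow> 0"
    and req: "\<And>n \<tau>. t < \<tau> \<Longrightarrow> \<tau> \<le> T \<Longrightarrow> r n \<tau> = e n \<tau> + RL \<alpha> t (h n) \<tau>"
    and h: "\<And>n \<xi>. t < \<xi> \<Longrightarrow> \<xi> \<le> T \<Longrightarrow> \<bar>h n \<xi>\<bar> \<le> M * \<bar>r n \<xi>\<bar> + \<bar>\<phi> n \<xi>\<bar>"
    and \<tau>0: "t < \<tau>0" "\<tau>0 \<le> T"
  shows "(\<lambda>n. r n \<tau>0) \<longlonglongrightarrow> 0"
proof -
  have [measurable]: "(\<lambda>\<xi>. indicat_real {t<..T} \<xi> * r n \<xi>) \<in> borel_measurable borel"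
      "(\<lambda>\<xi>. indicat_real {t<..T} \<xi> * \<phi> n \<xi>) \<in> borel_measurable borel" for n
    using rm[of n] pm[of n] unfolding set_borel_measurable_def by simp_all
  define R where "R = (\<lambda>n \<xi>. ennreal \<bar>indicat_real {t<..T} \<xi> * r n \<xi>\<bar>)"
  define P where "P = (\<lambda>n \<xi>. ennreal \<bar>indicat_real {t<..T} \<xi> * \<phi> n \<xi>\<bar>)"
  define S where "S = (\<lambda>\<xi>. limsup (\<lambda>n. R n \<xi>))"
  have [measurable]: "R n \<in> borel_measurable borel" "P n \<in> borel_measurable borel" for n
    unfolding R_def P_def by measurable
  have [measurable]: "S \<in> borel_measurable borel" unfolding S_def by measurable
  have Req: "R n \<xi> = ennreal \<bar>r n \<xi>\<bar>" "P n \<xi> = ennreal \<bar>\<phi> n \<xi>\<bar>" if "t < \<xi>" "\<xi> \<le> T" for n \<xi>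
    using that unfolding R_def P_def by simp_all
  have "S \<tau>0 = 0"
  proof (rule nRL_subsolution_zero[OF a(1) M _ _ _ \<tau>0])
    show "S \<in> borel_measurable borel" by measurable
    have "(\<integral>\<^sup>+\<tau>. S \<tau> * indicator {t<..T} \<tau> \<partial>lborel)
      \<le> (\<integral>\<^sup>+\<tau>. ennreal K * (ennreal ((\<tau> - t) powr (\<alpha> - 1)) * indicator {t<..t+(T-t)} \<tau>) \<partial>lborel)"
    proof (intro nn_integral_mono)
      fix \<tau>
      show "S \<tau> * indicator {t<..T} \<tau> \<le> ennreal K * (ennreal ((\<tau> - t) powr (\<alpha> - 1)) * indicator {t<..t+(T-t)} \<tau>)"
      proof (cases "\<tau> \<in> {t<..T}")
        case True
        have "S \<tau> \<le> ennreal (K * (\<tau> - t) powr (\<alpha> - 1))"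
          unfolding S_def using True by (intro Limsup_bounded always_eventually allI) (auto simp: Req intro!: ennreal_leI rb)
        then show ?thesis using True K by (simp add: ennreal_mult)
      qed simp
    qed
    also have "\<dots> = ennreal K * ennreal ((T-t) powr \<alpha> / \<alpha>)"
    proof -
      have "T - t \<ge> 0" using \<tau>0 by simp
      then show ?thesis unfolding nn_integral_powr_shift[OF a(1) \<open>T - t \<ge> 0\<close>, of t, symmetric]
        by (intro nn_integral_cmult) measurable
    qed
    also have "\<dots> < \<infinity>" by (simp add: ennreal_mult_less_top)
    finally show "(\<integral>\<^sup>+\<tau>. S \<tau> * indicator {t<..T} \<tau> \<partial>lborel) < \<infinity>" .
  next
    fix \<tau> assume \<tau>: "t < \<tau>" "\<tau> \<le> T"
    define k where "k = (\<lambda>\<xi>. ennreal ((\<tau> - \<xi>) powr (\<alpha> - 1) / Gamma \<alpha>) * indicator {t<..\<tau>} \<xi>)"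
    have [measurable]: "k \<in> borel_measurable borel" unfolding k_def by measurable
    have kfin: "k \<xi> < top" for \<xi> unfolding k_def by (auto simp: indicator_def)
    define u where "u = (\<lambda>n \<xi>. (ennreal M * R n \<xi> + P n \<xi>) * k \<xi>)"
    have [measurable]: "u n \<in> borel_measurable borel" for n unfolding u_def by measurable
    have nRL_eq: "nRL \<alpha> t v \<tau> = (\<integral>\<^sup>+\<xi>. v \<xi> * k \<xi> \<partial>lborel)" for v
      unfolding nRL_def k_def by (simp add: mult.assoc)
    have "R n \<tau> \<le> (\<integral>\<^sup>+\<xi>. u n \<xi> \<partial>lborel) + ennreal \<bar>e n \<tau>\<bar>" for n
    proof -
      have "R n \<tau> \<le> ennreal (\<bar>RL \<alpha> t (h n) \<tau>\<bar> + \<bar>e n \<tau>\<bar>)"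
        unfolding Req[OF \<tau>] using req[OF \<tau>, of n] by (intro ennreal_leI) linarith
      also have "\<dots> = ennreal \<bar>RL \<alpha> t (h n) \<tau>\<bar> + ennreal \<bar>e n \<tau>\<bar>" by simp
      also have "ennreal \<bar>RL \<alpha> t (h n) \<tau>\<bar> \<le> nRL \<alpha> t (\<lambda>\<xi>. ennreal \<bar>h n \<xi>\<bar>) \<tau>" by (rule abs_RL_le) fact
      also have "\<dots> \<le> nRL \<alpha> t (\<lambda>\<xi>. ennreal M * R n \<xi> + P n \<xi>) \<tau>"
      proof (rule nRL_mono)
        fix \<xi> assume \<xi>: "t < \<xi>" "\<xi> \<le> \<tau>"
        have "ennreal \<bar>h n \<xi>\<bar> \<le> ennreal (M * \<bar>r n \<xi>\<bar> + \<bar>\<phi> n \<xi>\<bar>)" using \<xi> \<tau> by (intro ennreal_leI h) auto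
        also have "\<dots> = ennreal M * R n \<xi> + P n \<xi>" using \<xi> \<tau> M by (simp add: Req ennreal_mult)
        finally show "ennreal \<bar>h n \<xi>\<bar> \<le> ennreal M * R n \<xi> + P n \<xi>" .
      qed
      also have "\<dots> = (\<integral>\<^sup>+\<xi>. u n \<xi> \<partial>lborel)" unfolding nRL_eq u_def ..
      finally show ?thesis by (simp add: add_right_mono)
    qed
    then have "S \<tau> \<le> limsup (\<lambda>n. (\<integral>\<^sup>+\<xi>. u n \<xi> \<partial>lborel) + ennreal \<bar>e n \<tau>\<bar>)"
      unfolding S_def by (intro Limsup_mono always_eventually allI)
    also have "\<dots> \<le> limsup (\<lambda>n. \<integral>\<^sup>+\<xi>. u n \<xi> \<partial>lborel)"
    proof (rule limsup_add_null)
      have "(\<lambda>n. ennreal \<bar>e n \<tau>\<bar>) \<longlonglongrightarrow> ennreal \<bar>0\<bar>" by (intro tendsto_ennrealI tendsto_rabs e0 \<tau>)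
      then show "(\<lambda>n. ennreal \<bar>e n \<tau>\<bar>) \<longlonglongrightarrow> 0" by simp
    qed
    also have "\<dots> \<le> (\<integral>\<^sup>+\<xi>. limsup (\<lambda>n. u n \<xi>) \<partial>lborel)"
    proof (rule nn_integral_limsup[where w="\<lambda>\<xi>. ennreal (((M + 1) * K) * (\<xi> - t) powr (\<alpha> - 1)) * k \<xi>"])
      show "AE \<xi> in lborel. u n \<xi> \<le> ennreal (((M + 1) * K) * (\<xi> - t) powr (\<alpha> - 1)) * k \<xi>" for n
      proof (intro AE_I2)
        fix \<xi>
        show "u n \<xi> \<le> ennreal (((M + 1) * K) * (\<xi> - t) powr (\<alpha> - 1)) * k \<xi>"
        proof (cases "\<xi> \<in> {t<..\<tau>}")
          case True
          then have \<xi>: "t < \<xi>" "\<xi> \<le> T" using \<tau> by auto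
          have "M * \<bar>r n \<xi>\<bar> + \<bar>\<phi> n \<xi>\<bar> \<le> M * (K * (\<xi> - t) powr (\<alpha> - 1)) + K * (\<xi> - t) powr (\<alpha> - 1)"
            using rb[OF \<xi>, of n] pb[OF \<xi>, of n] M by (intro add_mono mult_left_mono)
          then have "M * \<bar>r n \<xi>\<bar> + \<bar>\<phi> n \<xi>\<bar> \<le> ((M + 1) * K) * (\<xi> - t) powr (\<alpha> - 1)"
            by (simp add: algebra_simps)
          then have "ennreal (M * \<bar>r n \<xi>\<bar> + \<bar>\<phi> n \<xi>\<bar>) \<le> ennreal (((M + 1) * K) * (\<xi> - t) powr (\<alpha> - 1))" by (rule ennreal_leI)
          moreover have "ennreal (M * \<bar>r n \<xi>\<bar> + \<bar>\<phi> n \<xi>\<bar>) = ennreal M * R n \<xi> + P n \<xi>" using \<xi> M by (simp add: Req ennreal_mult)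
          ultimately show ?thesis unfolding u_def by (intro mult_right_mono) auto
        qed (simp add: u_def k_def)
      qed
      have "0 \<le> (M + 1) * K" using M K by simp
      from nRL_powr_le[OF a a \<tau>(1) order_refl this]
      show "(\<integral>\<^sup>+\<xi>. ennreal (((M + 1) * K) * (\<xi> - t) powr (\<alpha> - 1)) * k \<xi> \<partial>lborel) < \<infinity>"
        unfolding nRL_eq by (rule le_less_trans) simp
    qed measurable
    also have "\<dots> \<le> (\<integral>\<^sup>+\<xi>. ennreal M * (S \<xi> * k \<xi>) \<partial>lborel)"
    proof (intro nn_integral_mono)
      fix \<xi>
      show "limsup (\<lambda>n. u n \<xi>) \<le> ennreal M * (S \<xi> * k \<xi>)"
      proof (cases "\<xi> \<in> {t<..\<tau>}")
        case True
        then have \<xi>: "t < \<xi>" "\<xi> \<le> T" using \<tau> by auto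
        have "(\<lambda>n. ennreal \<bar>\<phi> n \<xi>\<bar>) \<longlonglongrightarrow> ennreal \<bar>0\<bar>" by (intro tendsto_ennrealI tendsto_rabs p0 \<xi>)
        then have "(\<lambda>n. k \<xi> * P n \<xi>) \<longlonglongrightarrow> k \<xi> * 0"
          using kfin[of \<xi>] by (intro ennreal_tendsto_cmult) (simp_all add: Req[OF \<xi>])
        then have "limsup (\<lambda>n. (k \<xi> * ennreal M) * R n \<xi> + k \<xi> * P n \<xi>) \<le> limsup (\<lambda>n. (k \<xi> * ennreal M) * R n \<xi>)"
          by (intro limsup_add_null) simp
        also have "\<dots> = (k \<xi> * ennreal M) * S \<xi>"
          unfolding S_def by (rule limsup_cmult_ennreal) (simp add: ennreal_mult_less_top kfin)
        finally show ?thesis unfolding u_def by (simp add: algebra_simps)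
      qed (simp add: u_def k_def Limsup_const)
    qed
    also have "\<dots> = ennreal M * nRL \<alpha> t S \<tau>"
      unfolding nRL_eq by (rule nn_integral_cmult) measurable
    finally show "S \<tau> \<le> ennreal M * nRL \<alpha> t S \<tau>" .
  qed
  then have "(\<lambda>n. R n \<tau>0) \<longlonglongrightarrow> 0" unfolding S_def by (rule tendsto_0_if_Limsup_eq_0_ennreal)
  then have "(\<lambda>n. ennreal \<bar>r n \<tau>0\<bar>) \<longlonglongrightarrow> ennreal 0" unfolding Req[OF \<tau>0] by simp
  then have "(\<lambda>n. \<bar>r n \<tau>0\<bar>) \<longlonglongrightarrow> 0" by (subst (asm) tendsto_ennreal_iff) auto
  then show ?thesis by (simp add: tendsto_rabs_zero_iff)
qed

text \<open>Fractional integration commutes with affine changes of time up to the factor \<open>\<kappa>\<^bsup>\<alpha>\<^esup>\<close>.\<close>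

lemma RL_affine:
  assumes \<kappa>: "0 < \<kappa>"
  shows "RL \<alpha> (c + \<kappa> * t) g (c + \<kappa> * \<tau>) = \<kappa> powr \<alpha> * RL \<alpha> t (\<lambda>\<xi>. g (c + \<kappa> * \<xi>)) \<tau>"
proof -
  have "(LBINT \<xi>:{c + \<kappa> * t<..c + \<kappa> * \<tau>}. g \<xi> * ((c + \<kappa> * \<tau>) - \<xi>) powr (\<alpha> - 1))
    = \<bar>\<kappa>\<bar> *\<^sub>R (\<integral>\<xi>. indicat_real {c + \<kappa> * t<..c + \<kappa> * \<tau>} (c + \<kappa> * \<xi>) *\<^sub>R (g (c + \<kappa> * \<xi>) * ((c + \<kappa> * \<tau>) - (c + \<kappa> * \<xi>)) powr (\<alpha> - 1)) \<partial>lborel)"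
    unfolding set_lebesgue_integral_def by (rule lborel_integral_real_affine) (use \<kappa> in simp)
  also have "(\<integral>\<xi>. indicat_real {c + \<kappa> * t<..c + \<kappa> * \<tau>} (c + \<kappa> * \<xi>) *\<^sub>R (g (c + \<kappa> * \<xi>) * ((c + \<kappa> * \<tau>) - (c + \<kappa> * \<xi>)) powr (\<alpha> - 1)) \<partial>lborel)
    = (\<integral>\<xi>. \<kappa> powr (\<alpha> - 1) * (indicat_real {t<..\<tau>} \<xi> *\<^sub>R (g (c + \<kappa> * \<xi>) * (\<tau> - \<xi>) powr (\<alpha> - 1))) \<partial>lborel)"
  proof (intro Bochner_Integration.integral_cong refl)
    fix \<xi>
    have ind: "c + \<kappa> * \<xi> \<in> {c + \<kappa> * t<..c + \<kappa> * \<tau>} \<longleftrightarrow> \<xi> \<in> {t<..\<tau>}" using \<kappa> by simp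
    have "((c + \<kappa> * \<tau>) - (c + \<kappa> * \<xi>)) powr (\<alpha> - 1) = \<kappa> powr (\<alpha> - 1) * (\<tau> - \<xi>) powr (\<alpha> - 1)" if "\<xi> \<in> {t<..\<tau>}"
    proof -
      have "(c + \<kappa> * \<tau>) - (c + \<kappa> * \<xi>) = \<kappa> * (\<tau> - \<xi>)" by (simp add: algebra_simps)
      then show ?thesis using that \<kappa> by (simp add: powr_mult)
    qed
    then show "indicat_real {c + \<kappa> * t<..c + \<kappa> * \<tau>} (c + \<kappa> * \<xi>) *\<^sub>R (g (c + \<kappa> * \<xi>) * ((c + \<kappa> * \<tau>) - (c + \<kappa> * \<xi>)) powr (\<alpha> - 1))
      = \<kappa> powr (\<alpha> - 1) * (indicat_real {t<..\<tau>} \<xi> *\<^sub>R (g (c + \<kappa> * \<xi>) * (\<tau> - \<xi>) powr (\<alpha> - 1)))"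
      using ind by (auto simp: indicator_def)
  qed
  also have "\<bar>\<kappa>\<bar> *\<^sub>R \<dots> = \<kappa> powr \<alpha> * (LBINT \<xi>:{t<..\<tau>}. g (c + \<kappa> * \<xi>) * (\<tau> - \<xi>) powr (\<alpha> - 1))"
    using \<kappa> powr_add[of \<kappa> 1 "\<alpha> - 1"] unfolding set_lebesgue_integral_def by simp
  finally show ?thesis unfolding RL_def by simp
qed

lemma set_integral_abs_bound:
  fixes g :: "real \<Rightarrow> real"
  assumes "t \<le> s" "0 \<le> B" and b: "\<And>\<xi>. t < \<xi> \<Longrightarrow> \<xi> \<le> s \<Longrightarrow> \<bar>g \<xi>\<bar> \<le> B"
  shows "\<bar>LBINT \<xi>:{t<..s}. g \<xi>\<bar> \<le> B * (s - t)"
proof (cases "set_integrable lborel {t<..s} g")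
  case True
  have "\<bar>LBINT \<xi>:{t<..s}. g \<xi>\<bar> \<le> (LBINT \<xi>:{t<..s}. \<bar>g \<xi>\<bar>)" using set_integral_norm_bound[OF True] by simp
  also have "\<dots> \<le> (LBINT \<xi>:{t<..s}. B)"
  proof (rule set_integral_mono)
    show "set_integrable lborel {t<..s} (\<lambda>\<xi>. \<bar>g \<xi>\<bar>)" using set_integrable_norm[OF True] by simp
    show "set_integrable lborel {t<..s} (\<lambda>\<xi>. B)"
      unfolding set_integrable_def using assms by (intro integrable_scaleR_left integrable_real_indicator) auto
  qed (use b in auto)
  also have "\<dots> = B * (s - t)" unfolding set_lebesgue_integral_def using assms by simp
  finally show ?thesis .
next
  case False
  then show ?thesis using assms by (simp add: set_lebesgue_integral_def set_integrable_def not_integrable_integral_eq)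
qed

lemma set_integral_bounded_integrable:
  fixes g :: "real \<Rightarrow> real"
  assumes "set_borel_measurable borel {t<..s} g" "t \<le> s" and b: "\<And>\<xi>. t < \<xi> \<Longrightarrow> \<xi> \<le> s \<Longrightarrow> \<bar>g \<xi>\<bar> \<le> B"
  shows "set_integrable lborel {t<..s} g"
proof -
  have eq: "indicat_real {t<..s} \<xi> *\<^sub>R g \<xi> = indicat_real {t<..s} \<xi> *\<^sub>R (indicat_real {t<..s} \<xi> *\<^sub>R g \<xi>)" for \<xi>
    by (simp add: indicator_def)
  show ?thesis
    unfolding set_integrable_def
    by (subst eq, rule integrableI_bounded_set_indicator[where B=B])
       (use assms in \<open>auto simp: set_borel_measurable_def\<close>)
qed

section \<open>Difference quotients on a common time interval\<close>

lemma DERIV_sequentially: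
  fixes F :: "real \<Rightarrow> real"
  assumes F: "(F has_real_derivative D) (at t)" and \<sigma>: "\<sigma> \<longlonglongrightarrow> t" "\<And>n. \<sigma> n \<noteq> t"
  shows "(\<lambda>n. (F (\<sigma> n) - F t) / (\<sigma> n - t)) \<longlonglongrightarrow> D"
proof -
  have "((\<lambda>s. (F s - F t) / (s - t)) \<longlongrightarrow> D) (at t)" using F by (simp add: has_field_derivative_iff)
  moreover have "filterlim \<sigma> (at t) sequentially" using \<sigma> by (simp add: filterlim_at)
  ultimately show ?thesis by (rule filterlim_compose)
qed

text \<open>The path \<open>y\<close> with Borel density \<open>l\<close> is an extension of the initial function, and \<open>t\<close> is the base time at which the
  terminal value is differentiated.\<close>

locale ci_data = smooth_rhs +
  fixes t C :: real and l y :: "real \<Rightarrow> real"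
  assumes t0: "0 \<le> t" and tT: "t < T"
    and lm [measurable]: "l \<in> borel_measurable borel" and C0: "0 \<le> C" and lb: "\<And>\<xi>. \<bar>l \<xi>\<bar> \<le> C"
    and y_rep: "\<And>\<tau>. 0 \<le> \<tau> \<Longrightarrow> \<tau> \<le> T \<Longrightarrow> y \<tau> = y 0 + RL \<alpha> 0 l \<tau>"
begin

definition sol_radius :: real where "sol_radius = apriori (\<bar>y 0\<bar> + RL_const \<alpha> 1 T * C)"
definition sol :: "real \<Rightarrow> real \<Rightarrow> real" where "sol s = the_solution \<alpha> T f s (restrict y {0..s})"
definition \<theta> :: "real \<Rightarrow> real" where "\<theta> \<tau> = (T - \<tau>) / (T - t)"
definition \<kappa> :: "real \<Rightarrow> real" where "\<kappa> s = (T - s) / (T - t)"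

text \<open>The affine map of \<open>[t, T]\<close> onto \<open>[s, T]\<close> with fixed point \<open>T\<close>, of slope \<open>\<kappa> s\<close>.\<close>

definition \<psi> :: "real \<Rightarrow> real \<Rightarrow> real" where "\<psi> s \<tau> = \<tau> + (s - t) * \<theta> \<tau>"
definition sol_quot :: "real \<Rightarrow> real \<Rightarrow> real" where "sol_quot s \<tau> = (sol s (\<psi> s \<tau>) - sol t \<tau>) / (s - t)"

text \<open>The part of the memory that is acquired between \<open>t\<close> and \<open>s\<close>.\<close>

definition fresh_memory :: "real \<Rightarrow> real \<Rightarrow> real" where
  "fresh_memory s \<tau> = (LBINT \<xi>:{t<..s}. l \<xi> * (\<psi> s \<tau> - \<xi>) powr (\<alpha> - 1)) / Gamma \<alpha>"
definition memory_quot :: "real \<Rightarrow> real \<Rightarrow> real" where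
  "memory_quot s \<tau> = ((memory \<alpha> t l (\<psi> s \<tau>) - memory \<alpha> t l \<tau>) + fresh_memory s \<tau>) / (s - t)"

text \<open>In the Volterra equation for \<open>sol_quot\<close>, \<open>memory_quot\<close> is the forcing term and \<open>rhs_quot\<close> the integrand.
  The factor \<open>\<kappa>\<^bsup>\<alpha>\<^esup>\<close> stems from the change of time.\<close>

definition rhs_quot :: "real \<Rightarrow> real \<Rightarrow> real" where
  "rhs_quot s \<xi> = (\<kappa> s powr \<alpha> * f (\<psi> s \<xi>) (sol s (\<psi> s \<xi>)) - f \<xi> (sol t \<xi>)) / (s - t)"
definition density_mean :: "real \<Rightarrow> real" where "density_mean s = (LBINT \<xi>:{t<..s}. l \<xi>) / (s - t)"
definition rhs_bound :: real where "rhs_bound = \<gamma> * (1 + sol_radius)"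
definition a :: "real \<Rightarrow> real" where "a \<tau> = fx \<tau> (sol t \<tau>)"
definition b :: "real \<Rightarrow> real" where "b \<tau> = \<theta> \<tau> * ft \<tau> (sol t \<tau>) - \<alpha> * f \<tau> (sol t \<tau>) / (T - t)"
definition pbar :: "real \<Rightarrow> real" where "pbar \<tau> = \<theta> \<tau> * memory_deriv \<alpha> t l \<tau>"
definition qbar :: "real \<Rightarrow> real" where "qbar \<tau> = (\<tau> - t) powr (\<alpha> - 1) / Gamma \<alpha>"

lemma Gamma_alpha_pos: "0 < Gamma \<alpha>" using a0 by (simp add: Gamma_real_pos)

lemma sol_cont: "0 \<le> s \<Longrightarrow> s < T \<Longrightarrow> continuous_on {s<..T} (sol s)"
  and sol_eq: "0 \<le> s \<Longrightarrow> s < T \<Longrightarrow> s < \<tau> \<Longrightarrow> \<tau> \<le> T \<Longrightarrow> sol s \<tau> = y 0 + memory \<alpha> s l \<tau> + RL \<alpha> s (\<lambda>\<xi>. f \<xi> (sol s \<xi>)) \<tau>"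
  and sol_bound: "0 \<le> s \<Longrightarrow> s < T \<Longrightarrow> s < \<tau> \<Longrightarrow> \<tau> \<le> T \<Longrightarrow> \<bar>sol s \<tau>\<bar> \<le> sol_radius"
  unfolding sol_def sol_radius_def
  by (rule the_solution_integral_equation[OF _ _ lm C0 lb y_rep]; assumption)+

lemma sol_radius_nonneg: "0 \<le> sol_radius" using sol_bound[of t T] t0 tT by linarith
lemma rhs_bound_nonneg: "0 \<le> rhs_bound" using sol_radius_nonneg g0 by (simp add: rhs_bound_def)

lemma f_bound: "0 \<le> \<xi> \<Longrightarrow> \<xi> \<le> T \<Longrightarrow> \<bar>u\<bar> \<le> sol_radius \<Longrightarrow> \<bar>f \<xi> u\<bar> \<le> rhs_bound"
  unfolding rhs_bound_def by (rule order_trans[OF growth]) (auto intro!: mult_left_mono g0)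

lemma one_le_powr: "t < \<xi> \<Longrightarrow> \<xi> \<le> T \<Longrightarrow> 1 \<le> T powr (1 - \<alpha>) * (\<xi> - t) powr (\<alpha> - 1)"
  using const_le_powr[of "\<xi> - t" T \<alpha> 1] a1 t0 by simp

lemma theta_bounds: "t < \<tau> \<Longrightarrow> \<tau> \<le> T \<Longrightarrow> 0 \<le> \<theta> \<tau>" "t < \<tau> \<Longrightarrow> \<tau> \<le> T \<Longrightarrow> \<theta> \<tau> \<le> 1"
  using tT by (auto simp: \<theta>_def)

lemma kappa_bounds:
  assumes "t < s" "s < T"
  shows "0 < \<kappa> s" "\<kappa> s < 1" "\<kappa> s powr \<alpha> \<le> 1" "\<bar>\<kappa> s powr \<alpha> - 1\<bar> \<le> (s - t) / (T - t)"
proof -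
  show k: "0 < \<kappa> s" "\<kappa> s < 1" using assms by (auto simp: \<kappa>_def)
  show k1: "\<kappa> s powr \<alpha> \<le> 1" using k a0 by (intro powr_le1) auto
  have "\<kappa> s powr 1 \<le> \<kappa> s powr \<alpha>" using k a1 by (intro powr_mono') auto
  then have "\<bar>\<kappa> s powr \<alpha> - 1\<bar> \<le> 1 - \<kappa> s" using k k1 by simp
  also have "1 - \<kappa> s = (s - t) / (T - t)" using tT by (simp add: \<kappa>_def field_simps)
  finally show "\<bar>\<kappa> s powr \<alpha> - 1\<bar> \<le> (s - t) / (T - t)" .
qed

lemma psi_affine: "\<psi> s \<tau> = (T - \<kappa> s * T) + \<kappa> s * \<tau>"
  and psi_minus: "\<psi> s \<tau> - s = \<kappa> s * (\<tau> - t)"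
  and psi_T [simp]: "\<psi> s T = T"
  using tT unfolding \<psi>_def \<theta>_def \<kappa>_def by (simp_all add: divide_simps) (simp_all add: algebra_simps)

lemma psi_t: "\<psi> s t = s"
  using psi_minus[of s t] by simp

lemma psi_range:
  assumes "t < s" "s < T" "t < \<tau>" "\<tau> \<le> T"
  shows "s < \<psi> s \<tau>" "\<psi> s \<tau> \<le> T" "\<tau> \<le> \<psi> s \<tau>" "\<psi> s \<tau> - \<tau> \<le> s - t"
proof -
  note k = kappa_bounds[OF assms(1,2)] and th = theta_bounds[OF assms(3,4)]
  have "0 < \<kappa> s * (\<tau> - t)" using k assms by simp
  then show "s < \<psi> s \<tau>" using psi_minus[of s \<tau>] by linarith
  have "\<psi> s \<tau> = T - \<kappa> s * (T - \<tau>)" unfolding psi_affine by (simp add: algebra_simps)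
  then show "\<psi> s \<tau> \<le> T" using k assms by simp
  show "\<tau> \<le> \<psi> s \<tau>" using th assms by (simp add: \<psi>_def)
  have "(s - t) * \<theta> \<tau> \<le> (s - t) * 1" using th assms by (intro mult_left_mono) auto
  then show "\<psi> s \<tau> - \<tau> \<le> s - t" by (simp add: \<psi>_def)
qed

lemma psi_cont: "continuous_on A (\<psi> s)"
  unfolding \<psi>_def \<theta>_def using tT by (intro continuous_intros) auto

lemma theta_cont: "continuous_on A \<theta>"
  unfolding \<theta>_def using tT by (intro continuous_intros) auto

lemma sol_psi_cont:
  assumes "t < s" "s < T"
  shows "continuous_on {t<..T} (\<lambda>\<tau>. sol s (\<psi> s \<tau>))"
  by (rule continuous_on_compose2[OF sol_cont psi_cont]) (use assms t0 psi_range in auto)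

lemma rhs_sol_cont: "continuous_on {t<..T} (\<lambda>\<xi>. f \<xi> (sol t \<xi>))"
  by (rule comp_continuous[OF f_cont sol_cont[OF t0 tT] t0])

lemma rhs_sol_psi_cont:
  assumes "t < s" "s < T"
  shows "continuous_on {t<..T} (\<lambda>\<xi>. f (\<psi> s \<xi>) (sol s (\<psi> s \<xi>)))"
proof -
  have "continuous_on {t<..T} (\<lambda>\<xi>. (\<psi> s \<xi>, sol s (\<psi> s \<xi>)))"
    by (intro continuous_intros psi_cont sol_psi_cont assms)
  then have "continuous_on {t<..T} ((\<lambda>(\<tau>, x). f \<tau> x) \<circ> (\<lambda>\<xi>. (\<psi> s \<xi>, sol s (\<psi> s \<xi>))))"
  proof (rule continuous_on_compose)
    show "continuous_on ((\<lambda>\<xi>. (\<psi> s \<xi>, sol s (\<psi> s \<xi>))) ` {t<..T}) (\<lambda>(\<tau>, x). f \<tau> x)"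
      by (rule continuous_on_subset[OF f_cont]) (use psi_range[OF assms] assms t0 in force)
  qed
  then show ?thesis by (simp add: o_def)
qed

lemma sol_quot_cont: "t < s \<Longrightarrow> s < T \<Longrightarrow> continuous_on {t<..T} (sol_quot s)"
  unfolding sol_quot_def by (intro continuous_intros sol_psi_cont sol_cont t0 tT) auto

lemma rhs_quot_cont: "t < s \<Longrightarrow> s < T \<Longrightarrow> continuous_on {t<..T} (rhs_quot s)"
  unfolding rhs_quot_def by (intro continuous_intros rhs_sol_psi_cont rhs_sol_cont) auto

lemma a_cont: "continuous_on {t<..T} a"
  unfolding a_def by (rule comp_continuous[OF fx_cont sol_cont[OF t0 tT] t0])

lemma b_cont: "continuous_on {t<..T} b"
  unfolding b_def using tT
  by (intro continuous_intros theta_cont rhs_sol_cont comp_continuous[OF ft_cont sol_cont[OF t0 tT] t0]) auto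

lemma pbar_cont: "continuous_on {t<..T} pbar"
  unfolding pbar_def by (intro continuous_intros theta_cont memory_deriv_continuous[OF a0 a1' lm lb t0])

lemma qbar_cont: "continuous_on {t<..T} qbar"
  unfolding qbar_def using Gamma_alpha_pos by (intro continuous_intros) auto

lemma pbar_bound: "t < \<tau> \<Longrightarrow> \<tau> \<le> T \<Longrightarrow> \<bar>pbar \<tau>\<bar> \<le> C / Gamma \<alpha> * (\<tau> - t) powr (\<alpha> - 1)"
proof -
  assume \<tau>: "t < \<tau>" "\<tau> \<le> T"
  have "\<bar>pbar \<tau>\<bar> \<le> 1 * \<bar>memory_deriv \<alpha> t l \<tau>\<bar>"
    unfolding pbar_def abs_mult using theta_bounds[OF \<tau>] by (intro mult_right_mono) auto
  then show ?thesis using memory_deriv_bound[OF a0 a1 lm lb t0 \<tau>(1)] by linarith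
qed

text \<open>The equation of the solution starting at \<open>s\<close> is pulled back to \<open>(t, T]\<close> by \<open>\<psi> s\<close>, its memory up to \<open>s\<close> is split at \<open>t\<close>,
  and the equation of the solution starting at \<open>t\<close> is subtracted.\<close>

lemma sol_quot_eq:
  assumes s: "t < s" "s < T" and \<tau>: "t < \<tau>" "\<tau> \<le> T"
  shows "sol_quot s \<tau> = memory_quot s \<tau> + RL \<alpha> t (rhs_quot s) \<tau>"
proof -
  note k = kappa_bounds[OF s]
  note r = psi_range[OF s \<tau>]
  have s0: "0 \<le> s" using s t0 by simp
  define g1 where "g1 = (\<lambda>\<xi>. \<kappa> s powr \<alpha> * f (\<psi> s \<xi>) (sol s (\<psi> s \<xi>)))"
  have "sol s (\<psi> s \<tau>) = y 0 + memory \<alpha> s l (\<psi> s \<tau>) + RL \<alpha> s (\<lambda>\<xi>. f \<xi> (sol s \<xi>)) (\<psi> s \<tau>)"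
    by (rule sol_eq[OF s0 s(2) r(1,2)])
  also have "RL \<alpha> s (\<lambda>\<xi>. f \<xi> (sol s \<xi>)) (\<psi> s \<tau>) = RL \<alpha> t g1 \<tau>"
    using RL_affine[OF k(1), of \<alpha> "T - \<kappa> s * T" t "\<lambda>\<xi>. f \<xi> (sol s \<xi>)" \<tau>]
    unfolding psi_affine[symmetric] psi_t g1_def RL_cmult .
  also have "memory \<alpha> s l (\<psi> s \<tau>) = memory \<alpha> t l (\<psi> s \<tau>) + fresh_memory s \<tau>"
  proof -
    have bd: "\<bar>l \<xi> * (\<psi> s \<tau> - \<xi>) powr (\<alpha> - 1)\<bar> \<le> C * (\<psi> s \<tau> - s) powr (\<alpha> - 1)" if "\<xi> \<le> s" for \<xi>
    proof -
      have "(\<psi> s \<tau> - \<xi>) powr (\<alpha> - 1) \<le> (\<psi> s \<tau> - s) powr (\<alpha> - 1)"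
        using r that a1 by (intro powr_mono2') auto
      then show ?thesis using lb[of \<xi>] C0 unfolding abs_mult by (intro mult_mono) auto
    qed
    have "set_integrable lborel {0<..t} (\<lambda>\<xi>. l \<xi> * (\<psi> s \<tau> - \<xi>) powr (\<alpha> - 1))"
      "set_integrable lborel {t<..s} (\<lambda>\<xi>. l \<xi> * (\<psi> s \<tau> - \<xi>) powr (\<alpha> - 1))"
      by (rule set_integral_bounded_integrable[OF set_borel_measurable_borel _ bd]; use t0 s in auto)+
    moreover have "{0<..s} = {0<..t} \<union> {t<..s}" using t0 s by auto
    ultimately have "(LBINT \<xi>:{0<..s}. l \<xi> * (\<psi> s \<tau> - \<xi>) powr (\<alpha> - 1))
      = (LBINT \<xi>:{0<..t}. l \<xi> * (\<psi> s \<tau> - \<xi>) powr (\<alpha> - 1)) + (LBINT \<xi>:{t<..s}. l \<xi> * (\<psi> s \<tau> - \<xi>) powr (\<alpha> - 1))"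
      by (simp add: set_integral_Un)
    then show ?thesis unfolding memory_def fresh_memory_def by (simp add: add_divide_distrib)
  qed
  finally have 1: "sol s (\<psi> s \<tau>) = y 0 + (memory \<alpha> t l (\<psi> s \<tau>) + fresh_memory s \<tau>) + RL \<alpha> t g1 \<tau>" .
  have "RL \<alpha> t g1 \<tau> - RL \<alpha> t (\<lambda>\<xi>. f \<xi> (sol t \<xi>)) \<tau> = RL \<alpha> t (\<lambda>\<xi>. g1 \<xi> - f \<xi> (sol t \<xi>)) \<tau>"
  proof (rule RL_diff[OF a0 a1' zero_less_one order_refl \<tau>(1), where C=rhs_bound and C'=rhs_bound])
    show "set_borel_measurable borel {t<..\<tau>} g1" "set_borel_measurable borel {t<..\<tau>} (\<lambda>\<xi>. f \<xi> (sol t \<xi>))"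
      unfolding g1_def by (rule set_borel_measurable_continuous'[OF _ \<tau>(2)], intro continuous_intros rhs_sol_cont rhs_sol_psi_cont s)+
    fix \<xi> assume "t < \<xi>" "\<xi> \<le> \<tau>"
    then have \<xi>: "t < \<xi>" "\<xi> \<le> T" using \<tau> by auto
    show "\<bar>f \<xi> (sol t \<xi>)\<bar> \<le> rhs_bound * (\<xi> - t) powr (1 - 1)"
      using f_bound[OF _ \<xi>(2) sol_bound[OF t0 tT \<xi>]] \<xi> t0 by simp
    have "\<bar>f (\<psi> s \<xi>) (sol s (\<psi> s \<xi>))\<bar> \<le> rhs_bound"
      using psi_range[OF s \<xi>] s0 s by (intro f_bound sol_bound) auto
    then have "\<bar>g1 \<xi>\<bar> \<le> 1 * rhs_bound" unfolding g1_def abs_mult using k by (intro mult_mono) auto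
    then show "\<bar>g1 \<xi>\<bar> \<le> rhs_bound * (\<xi> - t) powr (1 - 1)" using \<xi> by simp
  qed
  then have 2: "sol s (\<psi> s \<tau>) - sol t \<tau> = (memory \<alpha> t l (\<psi> s \<tau>) - memory \<alpha> t l \<tau>) + fresh_memory s \<tau> + RL \<alpha> t (\<lambda>\<xi>. g1 \<xi> - f \<xi> (sol t \<xi>)) \<tau>"
    using 1 sol_eq[OF t0 tT \<tau>] by linarith
  have "RL \<alpha> t (rhs_quot s) \<tau> = RL \<alpha> t (\<lambda>\<xi>. (1 / (s - t)) * (g1 \<xi> - f \<xi> (sol t \<xi>))) \<tau>"
    unfolding rhs_quot_def g1_def by simp
  then show ?thesis unfolding sol_quot_def 2 memory_quot_def RL_cmult by (simp add: add_divide_distrib)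
qed

text \<open>The restriction to \<open>s \<le> (t + T)/2\<close> keeps the slope \<open>\<kappa> s\<close> above \<open>1/2\<close>, so that the singularity of the fresh memory is
  comparable with \<open>(\<tau> - t)\<^bsup>\<alpha>-1\<^esup>\<close>.\<close>

lemma memory_quot_bound:
  assumes s: "t < s" "s \<le> (t + T) / 2" and \<tau>: "t < \<tau>" "\<tau> \<le> T"
  shows "\<bar>memory_quot s \<tau>\<bar> \<le> 3 * C / Gamma \<alpha> * (\<tau> - t) powr (\<alpha> - 1)"
proof -
  have sT: "s < T" using s tT by simp
  note k = kappa_bounds[OF s(1) sT] and r = psi_range[OF s(1) sT \<tau>]
  have khalf: "1/2 \<le> \<kappa> s" using s tT by (simp add: \<kappa>_def field_simps)
  have "norm (memory \<alpha> t l (\<psi> s \<tau>) - memory \<alpha> t l \<tau>) \<le> (C / Gamma \<alpha> * (\<tau> - t) powr (\<alpha> - 1)) * norm (\<psi> s \<tau> - \<tau>)"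
  proof (rule field_differentiable_bound[of "{\<tau>..\<psi> s \<tau>}" _ "memory_deriv \<alpha> t l"])
    fix v assume v: "v \<in> {\<tau>..\<psi> s \<tau>}"
    then have tv: "t < v" using \<tau> by simp
    show "(memory \<alpha> t l has_field_derivative memory_deriv \<alpha> t l v) (at v within {\<tau>..\<psi> s \<tau>})"
      by (rule has_field_derivative_at_within[OF memory_has_derivative[OF a0 a1' lm lb t0 tv]])
    have "(v - t) powr (\<alpha> - 1) \<le> (\<tau> - t) powr (\<alpha> - 1)" using v \<tau> a1 by (intro powr_mono2') auto
    then have "C / Gamma \<alpha> * (v - t) powr (\<alpha> - 1) \<le> C / Gamma \<alpha> * (\<tau> - t) powr (\<alpha> - 1)"
      using C0 Gamma_alpha_pos by (intro mult_left_mono) auto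
    then show "norm (memory_deriv \<alpha> t l v) \<le> C / Gamma \<alpha> * (\<tau> - t) powr (\<alpha> - 1)"
      using memory_deriv_bound[OF a0 a1 lm lb t0 tv] by simp
  qed (use r in auto)
  also have "\<dots> \<le> (C / Gamma \<alpha> * (\<tau> - t) powr (\<alpha> - 1)) * (s - t)"
    using r C0 Gamma_alpha_pos by (intro mult_left_mono) auto
  finally have 1: "\<bar>memory \<alpha> t l (\<psi> s \<tau>) - memory \<alpha> t l \<tau>\<bar> \<le> (C / Gamma \<alpha> * (\<tau> - t) powr (\<alpha> - 1)) * (s - t)" by simp
  have "\<bar>LBINT \<xi>:{t<..s}. l \<xi> * (\<psi> s \<tau> - \<xi>) powr (\<alpha> - 1)\<bar> \<le> (C * (2 * (\<tau> - t) powr (\<alpha> - 1))) * (s - t)"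
  proof (rule set_integral_abs_bound)
    fix \<xi> assume \<xi>: "t < \<xi>" "\<xi> \<le> s"
    have "(1/2) * (\<tau> - t) \<le> \<kappa> s * (\<tau> - t)" using khalf \<tau> by (intro mult_right_mono) auto
    then have "(1/2) * (\<tau> - t) \<le> \<psi> s \<tau> - \<xi>" using psi_minus[of s \<tau>] \<xi> by linarith
    then have "(\<psi> s \<tau> - \<xi>) powr (\<alpha> - 1) \<le> ((1/2) * (\<tau> - t)) powr (\<alpha> - 1)"
      using \<tau> a1 by (intro powr_mono2') auto
    also have "\<dots> = (1/2) powr (\<alpha> - 1) * (\<tau> - t) powr (\<alpha> - 1)" using \<tau> by (subst powr_mult) auto
    also have "\<dots> \<le> 2 * (\<tau> - t) powr (\<alpha> - 1)"
    proof (rule mult_right_mono)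
      have "(1/2::real) powr (\<alpha> - 1) = 2 powr (1 - \<alpha>)"
        using powr_minus_divide[of "2::real" "\<alpha> - 1"] by (simp add: powr_divide)
      also have "\<dots> \<le> 2 powr 1" using a0 by (intro powr_mono) auto
      finally show "(1/2::real) powr (\<alpha> - 1) \<le> 2" by simp
    qed simp
    finally show "\<bar>l \<xi> * (\<psi> s \<tau> - \<xi>) powr (\<alpha> - 1)\<bar> \<le> C * (2 * (\<tau> - t) powr (\<alpha> - 1))"
      unfolding abs_mult using lb[of \<xi>] C0 by (intro mult_mono) auto
  qed (use s C0 in auto)
  then have 2: "\<bar>fresh_memory s \<tau>\<bar> \<le> (2 * C / Gamma \<alpha> * (\<tau> - t) powr (\<alpha> - 1)) * (s - t)"
    unfolding fresh_memory_def using Gamma_alpha_pos by (simp add: abs_divide divide_le_eq mult_ac)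
  define c where "c = C / Gamma \<alpha> * (\<tau> - t) powr (\<alpha> - 1)"
  have "\<bar>memory \<alpha> t l (\<psi> s \<tau>) - memory \<alpha> t l \<tau>\<bar> \<le> c * (s - t)" "\<bar>fresh_memory s \<tau>\<bar> \<le> 2 * (c * (s - t))"
    using 1 2 unfolding c_def by (simp_all add: mult_ac)
  then have "\<bar>(memory \<alpha> t l (\<psi> s \<tau>) - memory \<alpha> t l \<tau>) + fresh_memory s \<tau>\<bar> \<le> (3 * c) * (s - t)" by linarith
  then have "\<bar>memory_quot s \<tau>\<bar> \<le> 3 * c" unfolding memory_quot_def using s by (simp add: abs_divide divide_le_eq)
  then show ?thesis by (simp add: c_def)
qed

lemma density_mean_bound: "t < s \<Longrightarrow> \<bar>density_mean s\<bar> \<le> C"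
  using set_integral_abs_bound[of t s C l] C0 lb unfolding density_mean_def by (simp add: abs_divide divide_le_eq)

end

text \<open>All solutions under consideration take values in \<open>[-sol_radius, sol_radius]\<close>, where \<open>f\<close> is Lipschitz with constant \<open>M\<close>.\<close>

locale ci_data_lipschitz = ci_data +
  fixes M :: real
  assumes M0: "0 \<le> M"
    and M_lip: "\<forall>\<sigma>\<in>{0..T}. \<forall>\<tau>\<in>{0..T}. \<forall>y\<in>{-sol_radius..sol_radius}. \<forall>x\<in>{-sol_radius..sol_radius}. \<bar>f \<sigma> y - f \<tau> x\<bar> \<le> M * (\<bar>\<sigma> - \<tau>\<bar> + \<bar>y - x\<bar>)"
    and M_der: "\<forall>\<tau>\<in>{0..T}. \<forall>x\<in>{-sol_radius..sol_radius}. \<bar>ft \<tau> x\<bar> \<le> M \<and> \<bar>fx \<tau> x\<bar> \<le> M"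
begin

definition rhs_rate :: real where "rhs_rate = M + rhs_bound / (T - t)"
definition quot_const :: real where "quot_const = volterra_const \<alpha> \<alpha> rhs_rate T * max (3 * C / Gamma \<alpha>) (T powr (1 - \<alpha>))"

lemma rhs_rate_nonneg: "0 \<le> rhs_rate" unfolding rhs_rate_def using M0 rhs_bound_nonneg tT by simp
lemma quot_const_nonneg: "0 \<le> quot_const" unfolding quot_const_def
  by (intro mult_nonneg_nonneg volterra_const_nonneg) (simp add: le_max_iff_disj)

lemma sol_in: "t < \<xi> \<Longrightarrow> \<xi> \<le> T \<Longrightarrow> sol t \<xi> \<in> {-sol_radius..sol_radius}"
  using sol_bound[OF t0 tT, of \<xi>] by auto

lemma a_bound: "t < \<xi> \<Longrightarrow> \<xi> \<le> T \<Longrightarrow> \<bar>a \<xi>\<bar> \<le> M"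
  unfolding a_def using M_der[rule_format, OF _ sol_in, of \<xi>] t0 by simp

lemma b_bound:
  assumes \<xi>: "t < \<xi>" "\<xi> \<le> T"
  shows "\<bar>b \<xi>\<bar> \<le> rhs_rate"
proof -
  have "\<bar>\<theta> \<xi> * ft \<xi> (sol t \<xi>)\<bar> \<le> 1 * M"
    unfolding abs_mult using theta_bounds[OF \<xi>] M_der[rule_format, OF _ sol_in, of \<xi>] \<xi> t0 by (intro mult_mono) auto
  moreover have "\<bar>\<alpha> * f \<xi> (sol t \<xi>)\<bar> \<le> 1 * rhs_bound"
    unfolding abs_mult using f_bound[OF _ \<xi>(2) sol_bound[OF t0 tT \<xi>]] \<xi> t0 a0 a1 by (intro mult_mono) auto
  then have "\<bar>\<alpha> * f \<xi> (sol t \<xi>) / (T - t)\<bar> \<le> rhs_bound / (T - t)"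
    using tT by (simp add: abs_divide divide_right_mono)
  ultimately show ?thesis unfolding b_def rhs_rate_def by linarith
qed

lemma f_increment:
  assumes s: "t < s" "s < T" and \<xi>: "t < \<xi>" "\<xi> \<le> T"
  shows "\<bar>f (\<psi> s \<xi>) (sol s (\<psi> s \<xi>)) - f \<xi> (sol t \<xi>)\<bar> \<le> M * (s - t) * (1 + \<bar>sol_quot s \<xi>\<bar>)"
proof -
  note r = psi_range[OF s \<xi>]
  have s0: "0 \<le> s" using s t0 by simp
  have sol: "sol s (\<psi> s \<xi>) - sol t \<xi> = (s - t) * sol_quot s \<xi>" unfolding sol_quot_def using s by simp
  have "sol s (\<psi> s \<xi>) \<in> {-sol_radius..sol_radius}" using sol_bound[OF s0 s(2) r(1,2)] by auto
  then have "\<bar>f (\<psi> s \<xi>) (sol s (\<psi> s \<xi>)) - f \<xi> (sol t \<xi>)\<bar> \<le> M * (\<bar>\<psi> s \<xi> - \<xi>\<bar> + \<bar>sol s (\<psi> s \<xi>) - sol t \<xi>\<bar>)"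
    using sol_in[OF \<xi>] r \<xi> s0 s t0 by (intro M_lip[rule_format]) auto
  also have "\<dots> \<le> M * ((s - t) + (s - t) * \<bar>sol_quot s \<xi>\<bar>)"
    unfolding sol abs_mult using r s M0 by (intro mult_left_mono add_mono) auto
  finally show ?thesis by (simp add: algebra_simps)
qed

text \<open>The increment of \<open>\<kappa>\<^bsup>\<alpha>\<^esup> f\<close> splits into the increment of \<open>f\<close> and that of \<open>\<kappa>\<^bsup>\<alpha>\<^esup>\<close>; both are at most of order \<open>s - t\<close>.\<close>

lemma rhs_quot_bound:
  assumes s: "t < s" "s < T" and \<xi>: "t < \<xi>" "\<xi> \<le> T"
  shows "\<bar>rhs_quot s \<xi>\<bar> \<le> rhs_rate * (1 + \<bar>sol_quot s \<xi>\<bar>)"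
proof -
  note k = kappa_bounds[OF s]
  let ?f1 = "f (\<psi> s \<xi>) (sol s (\<psi> s \<xi>))" and ?f0 = "f \<xi> (sol t \<xi>)"
  have "\<bar>\<kappa> s powr \<alpha> * (?f1 - ?f0)\<bar> \<le> 1 * (M * (s - t) * (1 + \<bar>sol_quot s \<xi>\<bar>))"
    unfolding abs_mult[of "\<kappa> s powr \<alpha>"] using f_increment[OF s \<xi>] k by (intro mult_mono) auto
  moreover have "\<bar>(\<kappa> s powr \<alpha> - 1) * ?f0\<bar> \<le> (s - t) / (T - t) * rhs_bound"
    unfolding abs_mult using k f_bound[OF _ \<xi>(2) sol_bound[OF t0 tT \<xi>]] \<xi> t0 s tT by (intro mult_mono) auto
  moreover have "\<kappa> s powr \<alpha> * ?f1 - ?f0 = \<kappa> s powr \<alpha> * (?f1 - ?f0) + (\<kappa> s powr \<alpha> - 1) * ?f0"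
    by (simp add: algebra_simps)
  ultimately have "\<bar>\<kappa> s powr \<alpha> * ?f1 - ?f0\<bar> \<le> M * (s - t) * (1 + \<bar>sol_quot s \<xi>\<bar>) + (s - t) / (T - t) * rhs_bound"
    by linarith
  also have "\<dots> \<le> M * (s - t) * (1 + \<bar>sol_quot s \<xi>\<bar>) + (s - t) / (T - t) * rhs_bound * (1 + \<bar>sol_quot s \<xi>\<bar>)"
  proof -
    have "0 \<le> (s - t) / (T - t) * rhs_bound" using s tT rhs_bound_nonneg by simp
    from mult_left_mono[of 1 "1 + \<bar>sol_quot s \<xi>\<bar>", OF _ this] show ?thesis by simp
  qed
  also have "\<dots> = (rhs_rate * (1 + \<bar>sol_quot s \<xi>\<bar>)) * (s - t)"
  proof -
    have "M * e * w + e / d * F * w = ((M + F / d) * w) * e" for M e w d F :: real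
      by (simp add: algebra_simps)
    then show ?thesis unfolding rhs_rate_def .
  qed
  finally show ?thesis unfolding rhs_quot_def using s by (simp add: abs_divide divide_le_eq)
qed

text \<open>The difference quotients are dominated by a multiple of the weight that does not depend on \<open>s\<close>.\<close>

lemma sol_quot_bound:
  assumes s: "t < s" "s \<le> (t + T) / 2" and \<tau>: "t < \<tau>" "\<tau> \<le> T"
  shows "\<bar>sol_quot s \<tau>\<bar> \<le> quot_const * (\<tau> - t) powr (\<alpha> - 1)"
  unfolding quot_const_def
proof (rule volterra_bound[OF a0 a1' a0 a1' rhs_rate_nonneg, where g="memory_quot s" and h="rhs_quot s" and u="sol_quot s" and B="2 * sol_radius / (s - t) * T powr (1 - \<alpha>)"])
  have sT: "s < T" using s tT by simp
  have s0: "0 \<le> s" using s t0 by simp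
  show "T - t \<le> T" using t0 by simp
  show "set_borel_measurable borel {t<..T} (sol_quot s)"
    by (rule set_borel_measurable_continuous'[OF sol_quot_cont[OF s(1) sT] order_refl])
  show "0 \<le> max (3 * C / Gamma \<alpha>) (T powr (1 - \<alpha>))" by (simp add: le_max_iff_disj)
  fix \<tau> assume \<tau>: "t < \<tau>" "\<tau> \<le> T"
  show "sol_quot s \<tau> = memory_quot s \<tau> + RL \<alpha> t (rhs_quot s) \<tau>" by (rule sol_quot_eq[OF s(1) sT \<tau>])
  have "\<bar>sol s (\<psi> s \<tau>) - sol t \<tau>\<bar> \<le> 2 * sol_radius"
    using sol_bound[OF s0 sT psi_range(1,2)[OF s(1) sT \<tau>]] sol_bound[OF t0 tT \<tau>] by linarith
  then have "\<bar>sol_quot s \<tau>\<bar> \<le> 2 * sol_radius / (s - t)" unfolding sol_quot_def using s by (simp add: abs_divide divide_right_mono)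
  also have "\<dots> \<le> 2 * sol_radius / (s - t) * T powr (1 - \<alpha>) * (\<tau> - t) powr (\<alpha> - 1)"
    using \<tau> a1 sol_radius_nonneg s t0 by (intro const_le_powr) auto
  finally show "\<bar>sol_quot s \<tau>\<bar> \<le> 2 * sol_radius / (s - t) * T powr (1 - \<alpha>) * (\<tau> - t) powr (\<alpha> - 1)" .
  show "\<bar>memory_quot s \<tau>\<bar> \<le> max (3 * C / Gamma \<alpha>) (T powr (1 - \<alpha>)) * (\<tau> - t) powr (\<alpha> - 1)"
    by (rule order_trans[OF memory_quot_bound[OF s \<tau>]]) (intro mult_right_mono, auto)
  have "1 \<le> T powr (1 - \<alpha>) * (\<tau> - t) powr (\<alpha> - 1)" by (rule one_le_powr[OF \<tau>])
  also have "\<dots> \<le> max (3 * C / Gamma \<alpha>) (T powr (1 - \<alpha>)) * (\<tau> - t) powr (\<alpha> - 1)"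
    by (intro mult_right_mono) auto
  finally have "rhs_rate * (1 + \<bar>sol_quot s \<tau>\<bar>) \<le> rhs_rate * (\<bar>sol_quot s \<tau>\<bar> + max (3 * C / Gamma \<alpha>) (T powr (1 - \<alpha>)) * (\<tau> - t) powr (\<alpha> - 1))"
    using rhs_rate_nonneg by (intro mult_left_mono) auto
  then show "\<bar>rhs_quot s \<tau>\<bar> \<le> rhs_rate * (\<bar>sol_quot s \<tau>\<bar> + max (3 * C / Gamma \<alpha>) (T powr (1 - \<alpha>)) * (\<tau> - t) powr (\<alpha> - 1))"
    using rhs_quot_bound[OF s(1) sT \<tau>] by linarith
qed (use \<tau> in auto)

context
  fixes \<sigma> :: "nat \<Rightarrow> real"
  assumes \<sigma>: "\<And>n. t < \<sigma> n" "\<And>n. \<sigma> n \<le> (t + T) / 2" and \<sigma>_lim: "\<sigma> \<longlonglongrightarrow> t"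
begin

lemma \<sigma>T: "\<sigma> n < T" using \<sigma>(2)[of n] tT by simp

lemma kappa_lim: "(\<lambda>n. \<kappa> (\<sigma> n)) \<longlonglongrightarrow> 1"
proof -
  have "(\<lambda>n. \<kappa> (\<sigma> n)) \<longlonglongrightarrow> (T - t) / (T - t)" unfolding \<kappa>_def using tT by (intro tendsto_intros \<sigma>_lim) auto
  then show ?thesis using tT by simp
qed

text \<open>The old memory contributes its derivative along \<open>\<psi>\<close>.  The fresh memory contributes \<open>qbar\<close> times the mean of \<open>l\<close>:
  on the short interval \<open>[t, s]\<close> the kernel is nearly constant, whereas \<open>l\<close> is merely measurable and the
  mean need not converge.\<close>

lemma forcing_residual_lim:
  assumes \<tau>: "t < \<tau>" "\<tau> \<le> T"
  shows "(\<lambda>n. memory_quot (\<sigma> n) \<tau> - pbar \<tau> - density_mean (\<sigma> n) * qbar \<tau>) \<longlonglongrightarrow> 0"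
proof -
  have "(\<lambda>n. (memory \<alpha> t l (\<psi> (\<sigma> n) \<tau>) - memory \<alpha> t l (\<psi> t \<tau>)) / (\<sigma> n - t)) \<longlonglongrightarrow> memory_deriv \<alpha> t l \<tau> * \<theta> \<tau>"
  proof (rule DERIV_sequentially[OF _ \<sigma>_lim])
    have "\<psi> t \<tau> = \<tau>" by (simp add: \<psi>_def)
    then have "(memory \<alpha> t l has_real_derivative memory_deriv \<alpha> t l \<tau>) (at (\<psi> t \<tau>))"
      using memory_has_derivative[OF a0 a1' lm lb t0 \<tau>(1)] by simp
    moreover have "((\<lambda>s. \<psi> s \<tau>) has_real_derivative \<theta> \<tau>) (at t)"
      unfolding \<psi>_def by (auto intro!: derivative_eq_intros)
    ultimately show "((\<lambda>s. memory \<alpha> t l (\<psi> s \<tau>)) has_real_derivative memory_deriv \<alpha> t l \<tau> * \<theta> \<tau>) (at t)"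
      by (rule DERIV_chain2)
    show "\<sigma> n \<noteq> t" for n using \<sigma>(1)[of n] by simp
  qed
  then have 1: "(\<lambda>n. (memory \<alpha> t l (\<psi> (\<sigma> n) \<tau>) - memory \<alpha> t l \<tau>) / (\<sigma> n - t) - pbar \<tau>) \<longlonglongrightarrow> 0"
    by (subst LIM_zero_iff) (simp add: pbar_def \<psi>_def mult.commute)
  \<comment> \<open>The oscillation of the kernel on the short interval.\<close>
  define m where "m = (\<lambda>n. (\<kappa> (\<sigma> n) * (\<tau> - t)) powr (\<alpha> - 1) - (\<tau> - t + (\<sigma> n - t)) powr (\<alpha> - 1))"
  have "m \<longlonglongrightarrow> (1 * (\<tau> - t)) powr (\<alpha> - 1) - (\<tau> - t + (t - t)) powr (\<alpha> - 1)"
    unfolding m_def using \<tau> by (intro tendsto_intros kappa_lim \<sigma>_lim) auto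
  then have "m \<longlonglongrightarrow> 0" by simp
  then have mlim: "(\<lambda>n. C / Gamma \<alpha> * m n) \<longlonglongrightarrow> 0" by (rule tendsto_mult_right_zero)
  have 2: "(\<lambda>n. fresh_memory (\<sigma> n) \<tau> / (\<sigma> n - t) - density_mean (\<sigma> n) * qbar \<tau>) \<longlonglongrightarrow> 0"
  proof (rule Lim_null_comparison[OF always_eventually mlim], intro allI)
    fix n
    define s where "s = \<sigma> n"
    have s: "t < s" "s < T" using \<sigma> \<sigma>T by (auto simp: s_def)
    note k = kappa_bounds[OF s] and r = psi_range[OF s \<tau>]
    have up: "(\<psi> s \<tau> - \<xi>) powr (\<alpha> - 1) \<le> (\<kappa> s * (\<tau> - t)) powr (\<alpha> - 1)" if "\<xi> \<le> s" for \<xi>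
      using psi_minus[of s \<tau>] k \<tau> that a1 by (intro powr_mono2') auto
    have lo: "(\<tau> - t + (s - t)) powr (\<alpha> - 1) \<le> (\<psi> s \<tau> - \<xi>) powr (\<alpha> - 1)" if "t < \<xi>" "\<xi> \<le> s" for \<xi>
      using r that a1 \<tau> s by (intro powr_mono2') auto
    have up': "(\<tau> - t) powr (\<alpha> - 1) \<le> (\<kappa> s * (\<tau> - t)) powr (\<alpha> - 1)"
      using k \<tau> a1 by (intro powr_mono2') (auto simp: mult_le_cancel_right1)
    have lo': "(\<tau> - t + (s - t)) powr (\<alpha> - 1) \<le> (\<tau> - t) powr (\<alpha> - 1)"
      using \<tau> s a1 by (intro powr_mono2') auto
    have mn: "m n = (\<kappa> s * (\<tau> - t)) powr (\<alpha> - 1) - (\<tau> - t + (s - t)) powr (\<alpha> - 1)" by (simp add: m_def s_def)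
    have m0: "0 \<le> m n" using up' lo' mn by linarith
    have i1: "set_integrable lborel {t<..s} (\<lambda>\<xi>. l \<xi> * (\<psi> s \<tau> - \<xi>) powr (\<alpha> - 1))"
    proof (rule set_integral_bounded_integrable[OF set_borel_measurable_borel])
      show "\<bar>l \<xi> * (\<psi> s \<tau> - \<xi>) powr (\<alpha> - 1)\<bar> \<le> C * (\<kappa> s * (\<tau> - t)) powr (\<alpha> - 1)" if "t < \<xi>" "\<xi> \<le> s" for \<xi>
        unfolding abs_mult using lb[of \<xi>] up that C0 by (intro mult_mono) auto
    qed (use s in auto)
    have i2: "set_integrable lborel {t<..s} (\<lambda>\<xi>. l \<xi> * (\<tau> - t) powr (\<alpha> - 1))"
    proof (rule set_integral_bounded_integrable[OF set_borel_measurable_borel])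
      show "\<bar>l \<xi> * (\<tau> - t) powr (\<alpha> - 1)\<bar> \<le> C * (\<tau> - t) powr (\<alpha> - 1)" if "t < \<xi>" "\<xi> \<le> s" for \<xi>
        unfolding abs_mult using lb[of \<xi>] C0 by (intro mult_mono) auto
    qed (use s in auto)
    have "\<bar>LBINT \<xi>:{t<..s}. l \<xi> * (\<psi> s \<tau> - \<xi>) powr (\<alpha> - 1) - l \<xi> * (\<tau> - t) powr (\<alpha> - 1)\<bar> \<le> (C * m n) * (s - t)"
    proof (rule set_integral_abs_bound)
      fix \<xi> assume \<xi>: "t < \<xi>" "\<xi> \<le> s"
      have "\<bar>(\<psi> s \<tau> - \<xi>) powr (\<alpha> - 1) - (\<tau> - t) powr (\<alpha> - 1)\<bar> \<le> m n"
        using up[OF \<xi>(2)] lo[OF \<xi>] up' lo' unfolding mn by linarith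
      then have "\<bar>l \<xi> * ((\<psi> s \<tau> - \<xi>) powr (\<alpha> - 1) - (\<tau> - t) powr (\<alpha> - 1))\<bar> \<le> C * m n"
        unfolding abs_mult using lb[of \<xi>] C0 by (intro mult_mono) auto
      then show "\<bar>l \<xi> * (\<psi> s \<tau> - \<xi>) powr (\<alpha> - 1) - l \<xi> * (\<tau> - t) powr (\<alpha> - 1)\<bar> \<le> C * m n"
        by (simp add: right_diff_distrib)
    qed (use s C0 m0 in auto)
    then have "\<bar>(LBINT \<xi>:{t<..s}. l \<xi> * (\<psi> s \<tau> - \<xi>) powr (\<alpha> - 1)) - (LBINT \<xi>:{t<..s}. l \<xi>) * (\<tau> - t) powr (\<alpha> - 1)\<bar> \<le> (C * m n) * (s - t)"
      by (simp add: set_integral_diff(2)[OF i1 i2])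
    then have "\<bar>((LBINT \<xi>:{t<..s}. l \<xi> * (\<psi> s \<tau> - \<xi>) powr (\<alpha> - 1)) - (LBINT \<xi>:{t<..s}. l \<xi>) * (\<tau> - t) powr (\<alpha> - 1)) / (Gamma \<alpha> * (s - t))\<bar>
       \<le> C / Gamma \<alpha> * m n"
      using Gamma_alpha_pos s by (simp add: abs_divide abs_mult divide_le_eq mult_ac)
    moreover have "fresh_memory s \<tau> / (s - t) - density_mean s * qbar \<tau>
       = ((LBINT \<xi>:{t<..s}. l \<xi> * (\<psi> s \<tau> - \<xi>) powr (\<alpha> - 1)) - (LBINT \<xi>:{t<..s}. l \<xi>) * (\<tau> - t) powr (\<alpha> - 1)) / (Gamma \<alpha> * (s - t))"
      unfolding fresh_memory_def density_mean_def qbar_def using Gamma_alpha_pos s by (simp add: diff_divide_distrib mult.commute)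
    ultimately show "norm (fresh_memory (\<sigma> n) \<tau> / (\<sigma> n - t) - density_mean (\<sigma> n) * qbar \<tau>) \<le> C / Gamma \<alpha> * m n"
      by (simp add: s_def)
  qed
  have "(\<lambda>n. ((memory \<alpha> t l (\<psi> (\<sigma> n) \<tau>) - memory \<alpha> t l \<tau>) / (\<sigma> n - t) - pbar \<tau>)
      + (fresh_memory (\<sigma> n) \<tau> / (\<sigma> n - t) - density_mean (\<sigma> n) * qbar \<tau>)) \<longlonglongrightarrow> 0 + 0" by (intro tendsto_add 1 2)
  moreover have "((memory \<alpha> t l (\<psi> (\<sigma> n) \<tau>) - memory \<alpha> t l \<tau>) / (\<sigma> n - t) - pbar \<tau>)
      + (fresh_memory (\<sigma> n) \<tau> / (\<sigma> n - t) - density_mean (\<sigma> n) * qbar \<tau>) = memory_quot (\<sigma> n) \<tau> - pbar \<tau> - density_mean (\<sigma> n) * qbar \<tau>" for n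
    unfolding memory_quot_def add_divide_distrib by linarith
  ultimately show ?thesis by simp
qed

text \<open>At a fixed time the quotients are bounded, so differentiability of \<open>f\<close> at a single point suffices.  The three terms of the
  decomposition are the Taylor remainder of \<open>f\<close>, the product of the increments of \<open>\<kappa>\<^bsup>\<alpha>\<^esup>\<close> and \<open>f\<close>, and the remainder of
  \<open>\<kappa>\<^bsup>\<alpha>\<^esup>\<close>, whose derivative at \<open>t\<close> is \<open>-\<alpha>/(T - t)\<close>.\<close>

lemma rhs_residual_lim:
  assumes \<xi>: "t < \<xi>" "\<xi> \<le> T"
  shows "(\<lambda>n. rhs_quot (\<sigma> n) \<xi> - (a \<xi> * sol_quot (\<sigma> n) \<xi> + b \<xi>)) \<longlonglongrightarrow> 0"
proof -
  define K where "K = quot_const * (\<xi> - t) powr (\<alpha> - 1)"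
  have K0: "0 \<le> K" unfolding K_def using quot_const_nonneg by simp
  have DK: "\<bar>sol_quot (\<sigma> n) \<xi>\<bar> \<le> K" for n unfolding K_def by (rule sol_quot_bound[OF \<sigma> \<xi>])
  define F1 where "F1 = (\<lambda>n. f (\<psi> (\<sigma> n) \<xi>) (sol (\<sigma> n) (\<psi> (\<sigma> n) \<xi>)))"
  define f0 where "f0 = f \<xi> (sol t \<xi>)"
  have \<xi>0: "0 \<le> \<xi>" using \<xi> t0 by simp
  have \<delta>_lim: "(\<lambda>n. \<sigma> n - t) \<longlonglongrightarrow> 0" using \<sigma>_lim by (simp add: LIM_zero_iff)
  have \<delta>0: "0 < \<sigma> n - t" for n using \<sigma>(1)[of n] by simp
  have psi: "\<psi> (\<sigma> n) \<xi> - \<xi> = (\<sigma> n - t) * \<theta> \<xi>" for n by (simp add: \<psi>_def)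
  have Xd: "sol (\<sigma> n) (\<psi> (\<sigma> n) \<xi>) - sol t \<xi> = (\<sigma> n - t) * sol_quot (\<sigma> n) \<xi>" for n
    unfolding sol_quot_def using \<delta>0[of n] by simp
  have T1: "(\<lambda>n. (F1 n - f0) / (\<sigma> n - t) - (\<theta> \<xi> * ft \<xi> (sol t \<xi>) + a \<xi> * sol_quot (\<sigma> n) \<xi>)) \<longlonglongrightarrow> 0"
  proof (rule tendstoI)
    fix e :: real assume e: "0 < e"
    define e' where "e' = e / (2 * (1 + K))"
    have e': "0 < e'" using e K0 by (simp add: e'_def)
    obtain d where d: "d > 0" "\<And>\<sigma>' y'. 0 \<le> \<sigma>' \<Longrightarrow> \<sigma>' \<le> T \<Longrightarrow> \<bar>\<sigma>' - \<xi>\<bar> < d \<Longrightarrow> \<bar>y' - sol t \<xi>\<bar> < d \<Longrightarrow>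
      \<bar>f \<sigma>' y' - f \<xi> (sol t \<xi>) - ft \<xi> (sol t \<xi>) * (\<sigma>' - \<xi>) - fx \<xi> (sol t \<xi>) * (y' - sol t \<xi>)\<bar> \<le> e' * (\<bar>\<sigma>' - \<xi>\<bar> + \<bar>y' - sol t \<xi>\<bar>)"
      using f_first_order[OF \<xi>0 \<xi>(2) e', of "sol t \<xi>"] by blast
    have "(\<lambda>n. (\<sigma> n - t) * (1 + K)) \<longlonglongrightarrow> 0" by (rule tendsto_mult_left_zero[OF \<delta>_lim])
    from order_tendstoD(2)[OF this d(1)]
    show "eventually (\<lambda>n. dist ((F1 n - f0) / (\<sigma> n - t) - (\<theta> \<xi> * ft \<xi> (sol t \<xi>) + a \<xi> * sol_quot (\<sigma> n) \<xi>)) 0 < e) sequentially"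
    proof eventually_elim
      case (elim n)
      let ?d = "\<sigma> n - t"
      note r = psi_range[OF \<sigma>(1) \<sigma>T \<xi>, of n]
      have 1: "\<bar>\<psi> (\<sigma> n) \<xi> - \<xi>\<bar> \<le> ?d" using r by simp
      have 2: "\<bar>sol (\<sigma> n) (\<psi> (\<sigma> n) \<xi>) - sol t \<xi>\<bar> \<le> ?d * K"
        unfolding Xd abs_mult using DK[of n] \<delta>0[of n] by (intro mult_mono) auto
      have dK: "?d * (1 + K) = ?d + ?d * K" by (simp add: algebra_simps)
      have "0 \<le> ?d * K" using \<delta>0[of n] K0 by simp
      then have "\<bar>F1 n - f0 - ft \<xi> (sol t \<xi>) * (?d * \<theta> \<xi>) - fx \<xi> (sol t \<xi>) * (?d * sol_quot (\<sigma> n) \<xi>)\<bar>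
         \<le> e' * (\<bar>\<psi> (\<sigma> n) \<xi> - \<xi>\<bar> + \<bar>sol (\<sigma> n) (\<psi> (\<sigma> n) \<xi>) - sol t \<xi>\<bar>)"
        unfolding F1_def f0_def psi[symmetric] Xd[symmetric]
        using 1 2 elim dK r \<xi>0 \<delta>0[of n] by (intro d(2)) linarith+
      also have "\<dots> \<le> e' * (?d + ?d * K)" using 1 2 e' by (intro mult_left_mono add_mono) auto
      also have "\<dots> = e / 2 * ?d" unfolding e'_def dK[symmetric] using K0 by (simp add: field_simps)
      finally have "\<bar>F1 n - f0 - ft \<xi> (sol t \<xi>) * (?d * \<theta> \<xi>) - fx \<xi> (sol t \<xi>) * (?d * sol_quot (\<sigma> n) \<xi>)\<bar> / ?d \<le> e / 2"
        using \<delta>0[of n] by (simp add: divide_le_eq)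
      moreover have "(F1 n - f0) / ?d - (\<theta> \<xi> * ft \<xi> (sol t \<xi>) + a \<xi> * sol_quot (\<sigma> n) \<xi>)
         = (F1 n - f0 - ft \<xi> (sol t \<xi>) * (?d * \<theta> \<xi>) - fx \<xi> (sol t \<xi>) * (?d * sol_quot (\<sigma> n) \<xi>)) / ?d"
        using \<delta>0[of n] by (simp add: a_def diff_divide_distrib mult_ac)
      ultimately have "\<bar>(F1 n - f0) / ?d - (\<theta> \<xi> * ft \<xi> (sol t \<xi>) + a \<xi> * sol_quot (\<sigma> n) \<xi>)\<bar> \<le> e / 2"
        using \<delta>0[of n] by (simp only: abs_divide abs_of_pos)
      also have "\<dots> < e" using e by simp
      finally show ?case by (simp only: dist_real_def diff_zero)
    qed
  qed
  have T2: "(\<lambda>n. (\<kappa> (\<sigma> n) powr \<alpha> - 1) * ((F1 n - f0) / (\<sigma> n - t))) \<longlonglongrightarrow> 0"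
  proof (rule Lim_null_comparison[OF always_eventually], intro allI)
    show "(\<lambda>n. (\<sigma> n - t) / (T - t) * (M * (1 + K))) \<longlonglongrightarrow> 0"
      by (intro tendsto_mult_left_zero tendsto_divide_zero \<delta>_lim)
    fix n
    have "\<bar>F1 n - f0\<bar> \<le> M * (\<sigma> n - t) * (1 + \<bar>sol_quot (\<sigma> n) \<xi>\<bar>)"
      unfolding F1_def f0_def by (rule f_increment[OF \<sigma>(1) \<sigma>T \<xi>])
    then have "\<bar>(F1 n - f0) / (\<sigma> n - t)\<bar> \<le> M * (1 + \<bar>sol_quot (\<sigma> n) \<xi>\<bar>)"
      using \<delta>0[of n] by (simp add: abs_divide divide_le_eq mult_ac)
    also have "\<dots> \<le> M * (1 + K)" using DK[of n] M0 by (intro mult_left_mono) auto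
    finally show "norm ((\<kappa> (\<sigma> n) powr \<alpha> - 1) * ((F1 n - f0) / (\<sigma> n - t))) \<le> (\<sigma> n - t) / (T - t) * (M * (1 + K))"
      unfolding real_norm_def abs_mult[of "\<kappa> (\<sigma> n) powr \<alpha> - 1"]
      using kappa_bounds(4)[OF \<sigma>(1) \<sigma>T, of n] \<delta>0[of n] tT by (intro mult_mono) auto
  qed
  have T3: "(\<lambda>n. (\<kappa> (\<sigma> n) powr \<alpha> - \<kappa> t powr \<alpha>) / (\<sigma> n - t)) \<longlonglongrightarrow> - \<alpha> / (T - t)"
  proof (rule DERIV_sequentially[OF _ \<sigma>_lim])
    have k1: "(T - t) / (T - t) = 1" using tT by simp
    have "((\<lambda>s. T - s) has_real_derivative - 1) (at t)" by (auto intro!: derivative_eq_intros)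
    from DERIV_fun_powr[OF DERIV_cdivide[OF this, of "T - t"], of \<alpha>]
    have "((\<lambda>s. ((T - s) / (T - t)) powr \<alpha>) has_real_derivative \<alpha> * ((T - t) / (T - t)) powr (\<alpha> - 1) * (- 1 / (T - t))) (at t)"
      using tT by simp
    then show "((\<lambda>s. \<kappa> s powr \<alpha>) has_real_derivative - \<alpha> / (T - t)) (at t)"
      unfolding \<kappa>_def k1 by simp
    show "\<sigma> n \<noteq> t" for n using \<sigma>(1)[of n] by simp
  qed
  have kt: "\<kappa> t powr \<alpha> = 1" using tT by (simp add: \<kappa>_def)
  have "(\<lambda>n. (\<kappa> (\<sigma> n) powr \<alpha> - 1) / (\<sigma> n - t) * f0) \<longlonglongrightarrow> - \<alpha> / (T - t) * f0"
    using T3 unfolding kt by (intro tendsto_mult tendsto_const)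
  then have T4: "(\<lambda>n. (\<kappa> (\<sigma> n) powr \<alpha> - 1) / (\<sigma> n - t) * f0 - (- \<alpha> / (T - t) * f0)) \<longlonglongrightarrow> 0"
    by (rule LIM_zero)
  have eq: "rhs_quot (\<sigma> n) \<xi> - (a \<xi> * sol_quot (\<sigma> n) \<xi> + b \<xi>) =
     ((F1 n - f0) / (\<sigma> n - t) - (\<theta> \<xi> * ft \<xi> (sol t \<xi>) + a \<xi> * sol_quot (\<sigma> n) \<xi>))
     + (\<kappa> (\<sigma> n) powr \<alpha> - 1) * ((F1 n - f0) / (\<sigma> n - t))
     + ((\<kappa> (\<sigma> n) powr \<alpha> - 1) / (\<sigma> n - t) * f0 - (- \<alpha> / (T - t) * f0))" for n
  proof -
    have "rhs_quot (\<sigma> n) \<xi> = (F1 n - f0) / (\<sigma> n - t) + (\<kappa> (\<sigma> n) powr \<alpha> - 1) * ((F1 n - f0) / (\<sigma> n - t))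
       + (\<kappa> (\<sigma> n) powr \<alpha> - 1) / (\<sigma> n - t) * f0"
    proof -
      have "rhs_quot (\<sigma> n) \<xi> = (\<kappa> (\<sigma> n) powr \<alpha> * F1 n - f0) / (\<sigma> n - t)" unfolding rhs_quot_def F1_def f0_def ..
      also have "\<kappa> (\<sigma> n) powr \<alpha> * F1 n - f0
        = (F1 n - f0) + (\<kappa> (\<sigma> n) powr \<alpha> - 1) * (F1 n - f0) + (\<kappa> (\<sigma> n) powr \<alpha> - 1) * f0"
        by (simp add: algebra_simps)
      finally show ?thesis by (simp add: add_divide_distrib)
    qed
    moreover have "b \<xi> = \<theta> \<xi> * ft \<xi> (sol t \<xi>) + (- \<alpha> / (T - t) * f0)" unfolding b_def f0_def by simp
    ultimately show ?thesis by simp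
  qed
  show ?thesis unfolding eq using tendsto_add[OF tendsto_add[OF T1 T2] T4] by simp
qed

text \<open>The error \<open>r\<close> satisfies a Volterra equation with the residuals of the two preceding lemmas.\<close>

lemma remainder_lim:
  assumes p: "continuous_on {t<..T} p" "\<forall>\<tau>\<in>{t<..T}. \<bar>p \<tau>\<bar> \<le> Bp * (\<tau> - t) powr (\<alpha> - 1)"
      "\<forall>\<tau>\<in>{t<..T}. p \<tau> = pbar \<tau> + RL \<alpha> t (\<lambda>\<xi>. a \<xi> * p \<xi> + b \<xi>) \<tau>"
    and q: "continuous_on {t<..T} q" "\<forall>\<tau>\<in>{t<..T}. \<bar>q \<tau>\<bar> \<le> Bq * (\<tau> - t) powr (\<alpha> - 1)"
      "\<forall>\<tau>\<in>{t<..T}. q \<tau> = qbar \<tau> + RL \<alpha> t (\<lambda>\<xi>. a \<xi> * q \<xi>) \<tau>"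
  shows "(\<lambda>n. (sol (\<sigma> n) T - sol t T) / (\<sigma> n - t) - p T - density_mean (\<sigma> n) * q T) \<longlonglongrightarrow> 0"
proof -
  define r where "r = (\<lambda>n \<tau>. sol_quot (\<sigma> n) \<tau> - p \<tau> - density_mean (\<sigma> n) * q \<tau>)"
  define \<phi> where "\<phi> = (\<lambda>n \<tau>. rhs_quot (\<sigma> n) \<tau> - (a \<tau> * sol_quot (\<sigma> n) \<tau> + b \<tau>))"
  define h where "h = (\<lambda>n \<tau>. (rhs_quot (\<sigma> n) \<tau> - (a \<tau> * p \<tau> + b \<tau>)) - density_mean (\<sigma> n) * (a \<tau> * q \<tau>))"
  define W where "W = T powr (1 - \<alpha>)"
  define K where "K = (quot_const + Bp + C * Bq) + (2 * (rhs_rate * W) + (rhs_rate + M) * quot_const)"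
  have pb: "\<bar>p \<tau>\<bar> \<le> Bp * (\<tau> - t) powr (\<alpha> - 1)" "\<bar>q \<tau>\<bar> \<le> Bq * (\<tau> - t) powr (\<alpha> - 1)" if "t < \<tau>" "\<tau> \<le> T" for \<tau>
    using p(2) q(2) that by simp_all
  have B0: "0 \<le> Bp" "0 \<le> Bq" using powr_coeff_nonneg[OF pb(1)[of T]] powr_coeff_nonneg[OF pb(2)[of T]] tT by auto
  have W0: "0 \<le> W" by (simp add: W_def)
  have DK: "\<bar>sol_quot (\<sigma> n) \<tau>\<bar> \<le> quot_const * (\<tau> - t) powr (\<alpha> - 1)" if "t < \<tau>" "\<tau> \<le> T" for n \<tau>
    by (rule sol_quot_bound[OF \<sigma> that])
  have one: "1 \<le> W * (\<tau> - t) powr (\<alpha> - 1)" if "t < \<tau>" "\<tau> \<le> T" for \<tau> unfolding W_def by (rule one_le_powr[OF that])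
  have HK: "\<bar>rhs_quot (\<sigma> n) \<tau>\<bar> \<le> (rhs_rate * W + rhs_rate * quot_const) * (\<tau> - t) powr (\<alpha> - 1)" if "t < \<tau>" "\<tau> \<le> T" for n \<tau>
  proof -
    have "\<bar>rhs_quot (\<sigma> n) \<tau>\<bar> \<le> rhs_rate * (1 + \<bar>sol_quot (\<sigma> n) \<tau>\<bar>)" by (rule rhs_quot_bound[OF \<sigma>(1) \<sigma>T that])
    also have "\<dots> \<le> rhs_rate * (W * (\<tau> - t) powr (\<alpha> - 1) + quot_const * (\<tau> - t) powr (\<alpha> - 1))"
      using rhs_rate_nonneg by (intro mult_left_mono add_mono one DK that) auto
    finally show ?thesis by (simp add: algebra_simps)
  qed
  have bK: "\<bar>b \<tau>\<bar> \<le> (rhs_rate * W) * (\<tau> - t) powr (\<alpha> - 1)" if "t < \<tau>" "\<tau> \<le> T" for \<tau>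
    using b_bound[OF that] mult_left_mono[OF one[OF that] rhs_rate_nonneg] by (simp add: mult_ac)
  have aK: "\<bar>a \<tau> * z\<bar> \<le> (M * B) * (\<tau> - t) powr (\<alpha> - 1)" if "t < \<tau>" "\<tau> \<le> T" "\<bar>z\<bar> \<le> B * (\<tau> - t) powr (\<alpha> - 1)" for \<tau> z B
  proof -
    have "\<bar>a \<tau> * z\<bar> \<le> M * (B * (\<tau> - t) powr (\<alpha> - 1))"
      unfolding abs_mult using a_bound[OF that(1,2)] that(3) M0 by (intro mult_mono) auto
    then show ?thesis by (simp add: mult_ac)
  qed
  have QK: "\<bar>density_mean (\<sigma> n) * z\<bar> \<le> (C * B) * (\<tau> - t) powr (\<alpha> - 1)" if "\<bar>z\<bar> \<le> B * (\<tau> - t) powr (\<alpha> - 1)" for n \<tau> z B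
  proof -
    have "\<bar>density_mean (\<sigma> n) * z\<bar> \<le> C * (B * (\<tau> - t) powr (\<alpha> - 1))"
      unfolding abs_mult using density_mean_bound[OF \<sigma>(1)] that C0 by (intro mult_mono) auto
    then show ?thesis by (simp add: mult_ac)
  qed
  note cont = sol_quot_cont[OF \<sigma>(1) \<sigma>T] rhs_quot_cont[OF \<sigma>(1) \<sigma>T] a_cont b_cont p(1) q(1)
  have "(\<lambda>n. r n T) \<longlonglongrightarrow> 0"
  proof (rule volterra_perturbation_null[OF a0 a1' M0, where \<phi>=\<phi> and h=h and K=K and e="\<lambda>n \<tau>. memory_quot (\<sigma> n) \<tau> - pbar \<tau> - density_mean (\<sigma> n) * qbar \<tau>"])
    show "0 \<le> K" unfolding K_def using quot_const_nonneg B0 C0 rhs_rate_nonneg M0 W0 by simp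
    show "t < T" "T \<le> T" using tT by auto
    show "set_borel_measurable borel {t<..T} (r n)" for n
      unfolding r_def by (rule set_borel_measurable_continuous'[OF _ order_refl]) (intro continuous_intros cont)
    show "set_borel_measurable borel {t<..T} (\<phi> n)" for n
      unfolding \<phi>_def by (rule set_borel_measurable_continuous'[OF _ order_refl]) (intro continuous_intros cont)
    fix \<tau> assume \<tau>: "t < \<tau>" "\<tau> \<le> T"
    let ?w = "(\<tau> - t) powr (\<alpha> - 1)"
    have w0: "0 \<le> ?w" by simp
    show "(\<lambda>n. \<phi> n \<tau>) \<longlonglongrightarrow> 0" unfolding \<phi>_def by (rule rhs_residual_lim[OF \<tau>])
    show "(\<lambda>n. memory_quot (\<sigma> n) \<tau> - pbar \<tau> - density_mean (\<sigma> n) * qbar \<tau>) \<longlonglongrightarrow> 0" by (rule forcing_residual_lim[OF \<tau>])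
    fix n
    have "\<bar>r n \<tau>\<bar> \<le> quot_const * ?w + Bp * ?w + (C * Bq) * ?w"
      unfolding r_def using DK[OF \<tau>, of n] pb(1)[OF \<tau>] QK[OF pb(2)[OF \<tau>], of n] by linarith
    also have "\<dots> = (quot_const + Bp + C * Bq) * ?w" by (simp add: algebra_simps)
    also have "\<dots> \<le> K * ?w" unfolding K_def using quot_const_nonneg rhs_rate_nonneg M0 W0 by (intro mult_right_mono) auto
    finally show "\<bar>r n \<tau>\<bar> \<le> K * ?w" .
    have "\<bar>\<phi> n \<tau>\<bar> \<le> (rhs_rate * W + rhs_rate * quot_const) * ?w + (M * quot_const) * ?w + (rhs_rate * W) * ?w"
      unfolding \<phi>_def using HK[OF \<tau>, of n] aK[OF \<tau> DK[OF \<tau>], of n] bK[OF \<tau>] by linarith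
    also have "\<dots> = (2 * (rhs_rate * W) + (rhs_rate + M) * quot_const) * ?w" by (simp add: algebra_simps)
    also have "\<dots> \<le> K * ?w" unfolding K_def using quot_const_nonneg B0 C0 by (intro mult_right_mono) auto
    finally show "\<bar>\<phi> n \<tau>\<bar> \<le> K * ?w" .
    have "h n \<tau> = a \<tau> * r n \<tau> + \<phi> n \<tau>" unfolding h_def r_def \<phi>_def by (simp add: algebra_simps)
    moreover have "\<bar>a \<tau> * r n \<tau>\<bar> \<le> M * \<bar>r n \<tau>\<bar>" unfolding abs_mult using a_bound[OF \<tau>] by (intro mult_right_mono) auto
    ultimately show "\<bar>h n \<tau>\<bar> \<le> M * \<bar>r n \<tau>\<bar> + \<bar>\<phi> n \<tau>\<bar>" by linarith
    have sub: "\<xi> \<le> T" if "\<xi> \<le> \<tau>" for \<xi> using that \<tau> by simp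
    have apb: "\<bar>a \<xi> * p \<xi> + b \<xi>\<bar> \<le> (M * Bp + rhs_rate * W) * (\<xi> - t) powr (\<alpha> - 1)" if "t < \<xi>" "\<xi> \<le> T" for \<xi>
      using aK[OF that pb(1)[OF that]] bK[OF that] by (simp add: distrib_right)
    have "RL \<alpha> t (rhs_quot (\<sigma> n)) \<tau> - RL \<alpha> t (\<lambda>\<xi>. a \<xi> * p \<xi> + b \<xi>) \<tau> = RL \<alpha> t (\<lambda>\<xi>. rhs_quot (\<sigma> n) \<xi> - (a \<xi> * p \<xi> + b \<xi>)) \<tau>"
      by (rule RL_diff[OF a0 a1' a0 a1' \<tau>(1) _ HK _ apb])
         (use sub in \<open>auto intro!: set_borel_measurable_continuous'[OF _ \<tau>(2)] continuous_intros cont\<close>)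
    moreover have "RL \<alpha> t (\<lambda>\<xi>. rhs_quot (\<sigma> n) \<xi> - (a \<xi> * p \<xi> + b \<xi>)) \<tau> - RL \<alpha> t (\<lambda>\<xi>. density_mean (\<sigma> n) * (a \<xi> * q \<xi>)) \<tau> = RL \<alpha> t (h n) \<tau>"
      unfolding h_def
    proof (rule RL_diff[OF a0 a1' a0 a1' \<tau>(1), where C="(rhs_rate * W + rhs_rate * quot_const) + (M * Bp + rhs_rate * W)" and C'="C * (M * Bq)"])
      fix \<xi> assume \<xi>: "t < \<xi>" "\<xi> \<le> \<tau>"
      show "\<bar>rhs_quot (\<sigma> n) \<xi> - (a \<xi> * p \<xi> + b \<xi>)\<bar> \<le> ((rhs_rate * W + rhs_rate * quot_const) + (M * Bp + rhs_rate * W)) * (\<xi> - t) powr (\<alpha> - 1)"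
        using HK[OF \<xi>(1) sub[OF \<xi>(2)], of n] apb[OF \<xi>(1) sub[OF \<xi>(2)]] unfolding distrib_right by linarith
      show "\<bar>density_mean (\<sigma> n) * (a \<xi> * q \<xi>)\<bar> \<le> C * (M * Bq) * (\<xi> - t) powr (\<alpha> - 1)"
        by (rule QK[OF aK[OF \<xi>(1) sub[OF \<xi>(2)] pb(2)[OF \<xi>(1) sub[OF \<xi>(2)]]]])
    qed (auto intro!: set_borel_measurable_continuous'[OF _ \<tau>(2)] continuous_intros cont)
    moreover have "RL \<alpha> t (\<lambda>\<xi>. density_mean (\<sigma> n) * (a \<xi> * q \<xi>)) \<tau> = density_mean (\<sigma> n) * RL \<alpha> t (\<lambda>\<xi>. a \<xi> * q \<xi>) \<tau>" by (rule RL_cmult)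
    moreover have "p \<tau> = pbar \<tau> + RL \<alpha> t (\<lambda>\<xi>. a \<xi> * p \<xi> + b \<xi>) \<tau>" using bspec[OF p(3), of \<tau>] \<tau> by simp
    moreover have "density_mean (\<sigma> n) * q \<tau> = density_mean (\<sigma> n) * qbar \<tau> + density_mean (\<sigma> n) * RL \<alpha> t (\<lambda>\<xi>. a \<xi> * q \<xi>) \<tau>"
      using bspec[OF q(3), of \<tau>] \<tau> by (simp add: distrib_left)
    ultimately show "r n \<tau> = (memory_quot (\<sigma> n) \<tau> - pbar \<tau> - density_mean (\<sigma> n) * qbar \<tau>) + RL \<alpha> t (h n) \<tau>"
      using sol_quot_eq[OF \<sigma>(1) \<sigma>T \<tau>, of n] unfolding r_def by linarith
  qed
  then show ?thesis unfolding r_def sol_quot_def by simp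
qed

end

end

section \<open>The derivatives of the terminal value\<close>

lemma integral_eq_solution_cong:
  assumes "\<And>\<tau>. t < \<tau> \<Longrightarrow> \<tau> \<le> T \<Longrightarrow> g \<tau> = g' \<tau>"
  shows "integral_eq_solution \<alpha> t T g h p \<longleftrightarrow> integral_eq_solution \<alpha> t T g' h p"
  unfolding integral_eq_solution_def using assms by auto

context ci_data
begin

lemma caputo_y: "AE \<tau> in lborel. 0 \<le> \<tau> \<and> \<tau> \<le> T \<longrightarrow> caputo_deriv \<alpha> y \<tau> = l \<tau>"
  by (rule caputo_deriv_AE[OF a0 a1 C0 lm lb y_rep])

lemma pbar_eq:
  assumes \<tau>: "t < \<tau>" "\<tau> \<le> T"
  shows "- ((1 - \<alpha>) / Gamma \<alpha>) * ((T - \<tau>) / (T - t)) *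
      (LINT \<xi>:{0..t}|lebesgue. caputo_deriv \<alpha> (restrict y {0..t}) \<xi> / (\<tau> - \<xi>) powr (2 - \<alpha>)) = pbar \<tau>"
proof -
  have "(LINT \<xi>:{0..t}|lebesgue. caputo_deriv \<alpha> (restrict y {0..t}) \<xi> / (\<tau> - \<xi>) powr (2 - \<alpha>))
     = (LBINT \<xi>:{0<..t}. l \<xi> * (\<tau> - \<xi>) powr (\<alpha> - 2))"
  proof (rule set_lebesgue_integral_AE_eq)
    show "set_borel_measurable borel {0<..t} (\<lambda>\<xi>. l \<xi> * (\<tau> - \<xi>) powr (\<alpha> - 2))"
      by (intro set_borel_measurable_borel) auto
    have "AE \<xi> in lborel. \<xi> \<noteq> 0" "AE \<xi> in lborel. \<xi> \<noteq> t" by (rule AE_lborel_singleton)+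
    with caputo_y
    show "AE \<xi> in lborel. indicat_real {0..t} \<xi> * (caputo_deriv \<alpha> (restrict y {0..t}) \<xi> / (\<tau> - \<xi>) powr (2 - \<alpha>))
       = indicat_real {0<..t} \<xi> * (l \<xi> * (\<tau> - \<xi>) powr (\<alpha> - 2))"
    proof eventually_elim
      case (elim \<xi>)
      show ?case
      proof (cases "0 < \<xi> \<and> \<xi> < t")
        case True
        have "caputo_deriv \<alpha> (restrict y {0..t}) \<xi> = caputo_deriv \<alpha> y \<xi>"
          by (rule caputo_deriv_cong[of t]) (use True in auto)
        moreover have "1 / (\<tau> - \<xi>) powr (2 - \<alpha>) = (\<tau> - \<xi>) powr (\<alpha> - 2)"
          using powr_minus_divide[of "\<tau> - \<xi>" "2 - \<alpha>"] by simp
        ultimately show ?thesis using True elim tT by (simp add: divide_inverse)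
      next
        case False
        then show ?thesis using elim by (auto simp: indicator_def)
      qed
    qed
  qed
  then show ?thesis unfolding pbar_def \<theta>_def memory_deriv_def by (simp add: mult_ac)
qed

lemma qbar_eq:
  "1 / (Gamma \<alpha> * (\<tau> - t) powr (1 - \<alpha>)) = qbar \<tau>"
  unfolding qbar_def using powr_minus_divide[of "\<tau> - t" "1 - \<alpha>"] by simp

lemma caputo_integral:
  assumes s: "t < s" "s < T"
  shows "(LINT \<xi>:{t..s}|lebesgue. caputo_deriv \<alpha> y \<xi>) = density_mean s * (s - t)"
proof -
  have "(LINT \<xi>:{t..s}|lebesgue. caputo_deriv \<alpha> y \<xi>) = (LBINT \<xi>:{t<..s}. l \<xi>)"
  proof (rule set_lebesgue_integral_AE_eq)
    show "set_borel_measurable borel {t<..s} l" by (intro set_borel_measurable_borel) auto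
    have "AE \<xi> in lborel. \<xi> \<noteq> t" by (rule AE_lborel_singleton)
    with caputo_y show "AE \<xi> in lborel. indicat_real {t..s} \<xi> * caputo_deriv \<alpha> y \<xi> = indicat_real {t<..s} \<xi> * l \<xi>"
      by eventually_elim (use s t0 in \<open>auto simp: indicator_def\<close>)
  qed
  then show ?thesis unfolding density_mean_def using s by simp
qed

end

context ci_data_lipschitz
begin

lemma p_volterra: "weighted_volterra \<alpha> t T M (C / Gamma \<alpha> + rhs_rate * T powr (1 - \<alpha>)) pbar (\<lambda>\<xi> z. a \<xi> * z + b \<xi>)"
proof
  fix \<tau> assume \<tau>: "t < \<tau>" "\<tau> \<le> T"
  have w: "0 \<le> (\<tau> - t) powr (\<alpha> - 1)" by simp
  have "\<bar>b \<tau>\<bar> \<le> rhs_rate * (T powr (1 - \<alpha>) * (\<tau> - t) powr (\<alpha> - 1))"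
    using b_bound[OF \<tau>] mult_left_mono[OF one_le_powr[OF \<tau>] rhs_rate_nonneg] by simp
  moreover have "0 \<le> C / Gamma \<alpha> * (\<tau> - t) powr (\<alpha> - 1)" using C0 Gamma_alpha_pos by simp
  moreover have "0 \<le> rhs_rate * (T powr (1 - \<alpha>) * (\<tau> - t) powr (\<alpha> - 1))" using rhs_rate_nonneg by simp
  ultimately show "\<bar>pbar \<tau>\<bar> \<le> (C / Gamma \<alpha> + rhs_rate * T powr (1 - \<alpha>)) * (\<tau> - t) powr (\<alpha> - 1)"
    "\<bar>a \<tau> * 0 + b \<tau>\<bar> \<le> (C / Gamma \<alpha> + rhs_rate * T powr (1 - \<alpha>)) * (\<tau> - t) powr (\<alpha> - 1)"
    using pbar_bound[OF \<tau>] unfolding distrib_right by (simp_all add: mult.assoc)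
  fix y z
  have "\<bar>a \<tau> * y + b \<tau> - (a \<tau> * z + b \<tau>)\<bar> = \<bar>a \<tau>\<bar> * \<bar>y - z\<bar>" by (simp add: abs_mult[symmetric] right_diff_distrib)
  also have "\<dots> \<le> M * \<bar>y - z\<bar>" using a_bound[OF \<tau>] by (intro mult_right_mono) auto
  finally show "\<bar>a \<tau> * y + b \<tau> - (a \<tau> * z + b \<tau>)\<bar> \<le> M * \<bar>y - z\<bar>" .
qed (use a0 a1 tT M0 pbar_cont in \<open>auto intro!: continuous_intros a_cont b_cont\<close>)

lemma q_volterra: "weighted_volterra \<alpha> t T M (1 / Gamma \<alpha>) qbar (\<lambda>\<xi> z. a \<xi> * z)"
proof
  fix \<tau> assume \<tau>: "t < \<tau>" "\<tau> \<le> T"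
  show "\<bar>qbar \<tau>\<bar> \<le> 1 / Gamma \<alpha> * (\<tau> - t) powr (\<alpha> - 1)" unfolding qbar_def using Gamma_alpha_pos by simp
  show "\<bar>a \<tau> * 0\<bar> \<le> 1 / Gamma \<alpha> * (\<tau> - t) powr (\<alpha> - 1)" using Gamma_alpha_pos by simp
  fix y z
  have "\<bar>a \<tau> * y - a \<tau> * z\<bar> = \<bar>a \<tau>\<bar> * \<bar>y - z\<bar>" by (simp add: abs_mult[symmetric] right_diff_distrib)
  also have "\<dots> \<le> M * \<bar>y - z\<bar>" using a_bound[OF \<tau>] by (intro mult_right_mono) auto
  finally show "\<bar>a \<tau> * y - a \<tau> * z\<bar> \<le> M * \<bar>y - z\<bar>" .
qed (use a0 a1 tT M0 qbar_cont in \<open>auto intro!: continuous_intros a_cont\<close>)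

text \<open>The remainder is defined by the expansion itself; only its order has to be shown, and this is done along sequences.\<close>

lemma expansion:
  assumes p: "integral_eq_solution \<alpha> t T pbar (\<lambda>\<xi> z. a \<xi> * z + b \<xi>) p"
    and q: "integral_eq_solution \<alpha> t T qbar (\<lambda>\<xi> z. a \<xi> * z) q"
  shows "\<exists>r :: real \<Rightarrow> real. ((\<lambda>\<delta>. r \<delta> / \<delta>) \<longlongrightarrow> 0) (at_right 0) \<and>
    (\<forall>\<tau>\<in>{t<..<T}. rho \<alpha> T f (\<tau>, restrict y {0..\<tau>}) - rho \<alpha> T f (t, restrict y {0..t}) =
      p T * (\<tau> - t) + q T * (LINT \<xi>:{t..\<tau>}|lebesgue. caputo_deriv \<alpha> y \<xi>) + r (\<tau> - t))"
proof -
  interpret PV: weighted_volterra \<alpha> t T M "C / Gamma \<alpha> + rhs_rate * T powr (1 - \<alpha>)" pbar "\<lambda>\<xi> z. a \<xi> * z + b \<xi>" by (rule p_volterra)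
  interpret QV: weighted_volterra \<alpha> t T M "1 / Gamma \<alpha>" qbar "\<lambda>\<xi> z. a \<xi> * z" by (rule q_volterra)
  have "PV.solution p" using p unfolding PV.integral_eq_solution_iff by simp
  then obtain Bp where p': "continuous_on {t<..T} p" "\<forall>\<tau>\<in>{t<..T}. \<bar>p \<tau>\<bar> \<le> Bp * (\<tau> - t) powr (\<alpha> - 1)"
    "\<forall>\<tau>\<in>{t<..T}. p \<tau> = pbar \<tau> + RL \<alpha> t (\<lambda>\<xi>. a \<xi> * p \<xi> + b \<xi>) \<tau>"
    unfolding PV.solution_def by blast
  have "QV.solution q" using q unfolding QV.integral_eq_solution_iff by simp
  then obtain Bq where q': "continuous_on {t<..T} q" "\<forall>\<tau>\<in>{t<..T}. \<bar>q \<tau>\<bar> \<le> Bq * (\<tau> - t) powr (\<alpha> - 1)"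
    "\<forall>\<tau>\<in>{t<..T}. q \<tau> = qbar \<tau> + RL \<alpha> t (\<lambda>\<xi>. a \<xi> * q \<xi>) \<tau>"
    unfolding QV.solution_def by blast
  define r where "r = (\<lambda>\<delta>. sol (t + \<delta>) T - sol t T - p T * \<delta> - q T * (LINT \<xi>:{t..t + \<delta>}|lebesgue. caputo_deriv \<alpha> y \<xi>))"
  have rX: "rho \<alpha> T f (s, restrict y {0..s}) = sol s T" for s unfolding rho_def sol_def by simp
  have "((\<lambda>\<delta>. r \<delta> / \<delta>) \<longlongrightarrow> 0) (at_right 0)"
    unfolding tendsto_at_iff_sequentially
  proof (intro allI impI)
    fix \<delta> :: "nat \<Rightarrow> real" assume \<delta>: "\<forall>i. \<delta> i \<in> {0<..} - {0}" and lim: "\<delta> \<longlonglongrightarrow> 0"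
    have "0 < (T - t) / 2" using tT by simp
    from order_tendstoD(2)[OF lim this] obtain k where k: "\<And>n. n \<ge> k \<Longrightarrow> \<delta> n < (T - t) / 2"
      unfolding eventually_sequentially by blast
    \<comment> \<open>The uniform bounds hold for starting times in the first half of the interval, so the first \<open>k\<close> terms are dropped.\<close>
    define \<sigma> where "\<sigma> = (\<lambda>n. t + \<delta> (n + k))"
    have \<sigma>1: "t < \<sigma> n" for n using \<delta> by (simp add: \<sigma>_def)
    have \<sigma>2: "\<sigma> n \<le> (t + T) / 2" for n using k[of "n + k"] by (simp add: \<sigma>_def field_simps)
    have "(\<lambda>n. t + \<delta> (n + k)) \<longlonglongrightarrow> t + 0" by (intro tendsto_intros LIMSEQ_ignore_initial_segment lim)
    then have \<sigma>3: "\<sigma> \<longlonglongrightarrow> t" by (simp add: \<sigma>_def)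
    have "r (\<delta> (n + k)) / \<delta> (n + k) = (sol (\<sigma> n) T - sol t T) / (\<sigma> n - t) - p T - density_mean (\<sigma> n) * q T" for n
    proof -
      have sT: "\<sigma> n < T" using \<sigma>2[of n] tT by simp
      have d: "0 < \<delta> (n + k)" using \<delta> by simp
      show ?thesis
        unfolding r_def \<sigma>_def[symmetric] using caputo_integral[OF \<sigma>1 sT] d
        by (simp add: \<sigma>_def diff_divide_distrib mult_ac)
    qed
    with remainder_lim[OF \<sigma>1 \<sigma>2 \<sigma>3 p' q'] have "(\<lambda>n. r (\<delta> (n + k)) / \<delta> (n + k)) \<longlonglongrightarrow> 0" by simp
    then show "((\<lambda>\<delta>. r \<delta> / \<delta>) \<circ> \<delta>) \<longlonglongrightarrow> 0" unfolding o_def by (rule LIMSEQ_offset)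
  qed
  moreover have "\<forall>\<tau>\<in>{t<..<T}. rho \<alpha> T f (\<tau>, restrict y {0..\<tau>}) - rho \<alpha> T f (t, restrict y {0..t}) =
      p T * (\<tau> - t) + q T * (LINT \<xi>:{t..\<tau>}|lebesgue. caputo_deriv \<alpha> y \<xi>) + r (\<tau> - t)"
    unfolding rX r_def by simp
  ultimately show ?thesis by blast
qed

end

context smooth_rhs
begin

text \<open>The two integral equations in the form in which the theorem states them.\<close>

definition p_eq :: "real \<Rightarrow> (real \<Rightarrow> real) \<Rightarrow> (real \<Rightarrow> real) \<Rightarrow> bool" where
  "p_eq t w = (let x = the_solution \<alpha> T f t w in
     integral_eq_solution \<alpha> t T
       (\<lambda>\<tau>. - ((1 - \<alpha>) / Gamma \<alpha>) * ((T - \<tau>) / (T - t)) *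
          (LINT \<xi>:{0..t}|lebesgue. caputo_deriv \<alpha> w \<xi> / (\<tau> - \<xi>) powr (2 - \<alpha>)))
       (\<lambda>\<xi> z. fx \<xi> (x \<xi>) * z + (((T - \<xi>) / (T - t)) * ft \<xi> (x \<xi>) - \<alpha> * f \<xi> (x \<xi>) / (T - t))))"

definition q_eq :: "real \<Rightarrow> (real \<Rightarrow> real) \<Rightarrow> (real \<Rightarrow> real) \<Rightarrow> bool" where
  "q_eq t w = (let x = the_solution \<alpha> T f t w in
     integral_eq_solution \<alpha> t T (\<lambda>\<tau>. 1 / (Gamma \<alpha> * (\<tau> - t) powr (1 - \<alpha>))) (\<lambda>\<xi> z. fx \<xi> (x \<xi>) * z))"

text \<open>The equations for \<open>p\<close> and \<open>q\<close> involve \<open>w\<close> only, so their solutions are the same for every extension \<open>y\<close>.\<close>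

lemma extension_expansion:
  assumes t: "0 \<le> t" "t < T" and y: "y \<in> AC \<alpha> T T" and w: "w = restrict y {0..t}"
  shows "\<exists>!p. p_eq t w p" "\<exists>!q. q_eq t w q"
    "p_eq t w p \<Longrightarrow> q_eq t w q \<Longrightarrow>
      \<exists>r :: real \<Rightarrow> real. ((\<lambda>\<delta>. r \<delta> / \<delta>) \<longlongrightarrow> 0) (at_right 0) \<and>
      (\<forall>\<tau>\<in>{t<..<T}. rho \<alpha> T f (\<tau>, restrict y {0..\<tau>}) - rho \<alpha> T f (t, w) =
        p T * (\<tau> - t) + q T * (LINT \<xi>:{t..\<tau>}|lebesgue. caputo_deriv \<alpha> y \<xi>) + r (\<tau> - t))"
proof -
  obtain l C where l: "l \<in> borel_measurable borel" "0 \<le> C" "\<And>\<xi>. \<bar>l \<xi>\<bar> \<le> C"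
    "\<And>\<tau>. 0 \<le> \<tau> \<Longrightarrow> \<tau> \<le> T \<Longrightarrow> y \<tau> = y 0 + RL \<alpha> 0 l \<tau>"
    by (rule AC_borel_density[OF y order_refl]) (rule that)
  interpret S: ci_data T \<alpha> \<gamma> f ft fx t C l y
    by unfold_locales (rule t l | assumption)+
  obtain M where M: "0 \<le> M" "\<forall>\<sigma>\<in>{0..T}. \<forall>\<tau>\<in>{0..T}. \<forall>y\<in>{-S.sol_radius..S.sol_radius}. \<forall>x\<in>{-S.sol_radius..S.sol_radius}. \<bar>f \<sigma> y - f \<tau> x\<bar> \<le> M * (\<bar>\<sigma> - \<tau>\<bar> + \<bar>y - x\<bar>)"
    "\<forall>\<tau>\<in>{0..T}. \<forall>x\<in>{-S.sol_radius..S.sol_radius}. \<bar>ft \<tau> x\<bar> \<le> M \<and> \<bar>fx \<tau> x\<bar> \<le> M"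
    by (rule f_lipschitz)
  interpret L: ci_data_lipschitz T \<alpha> \<gamma> f ft fx t C l y M
    by unfold_locales (rule M)+
  interpret PV: weighted_volterra \<alpha> t T M "C / Gamma \<alpha> + L.rhs_rate * T powr (1 - \<alpha>)" S.pbar "\<lambda>\<xi> z. S.a \<xi> * z + S.b \<xi>" by (rule L.p_volterra)
  interpret QV: weighted_volterra \<alpha> t T M "1 / Gamma \<alpha>" S.qbar "\<lambda>\<xi> z. S.a \<xi> * z" by (rule L.q_volterra)
  have pe: "p_eq t w = integral_eq_solution \<alpha> t T S.pbar (\<lambda>\<xi> z. S.a \<xi> * z + S.b \<xi>)"
    unfolding p_eq_def Let_def w
    by (rule ext, subst integral_eq_solution_cong[OF S.pbar_eq]) (simp_all add: S.a_def S.b_def S.sol_def S.\<theta>_def)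
  have qe: "q_eq t w = integral_eq_solution \<alpha> t T S.qbar (\<lambda>\<xi> z. S.a \<xi> * z)"
    unfolding q_eq_def Let_def w S.qbar_eq by (simp add: S.a_def S.sol_def)
  show "\<exists>!p. p_eq t w p" unfolding pe by (rule PV.integral_eq_solution_ex1)
  show "\<exists>!q. q_eq t w q" unfolding qe by (rule QV.integral_eq_solution_ex1)
  assume p: "p_eq t w p" and q: "q_eq t w q"
  show "\<exists>r :: real \<Rightarrow> real. ((\<lambda>\<delta>. r \<delta> / \<delta>) \<longlongrightarrow> 0) (at_right 0) \<and>
      (\<forall>\<tau>\<in>{t<..<T}. rho \<alpha> T f (\<tau>, restrict y {0..\<tau>}) - rho \<alpha> T f (t, w) =
        p T * (\<tau> - t) + q T * (LINT \<xi>:{t..\<tau>}|lebesgue. caputo_deriv \<alpha> y \<xi>) + r (\<tau> - t))"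
    unfolding w by (rule L.expansion[OF p[unfolded pe] q[unfolded qe]])
qed

text \<open>The defining density of \<open>w\<close> already lives on \<open>[0, T]\<close>.\<close>

lemma AC_extend:
  assumes t: "0 \<le> t" "t < T" and w: "w \<in> AC \<alpha> T t"
  obtains y where "y \<in> AC \<alpha> T T" "w = restrict y {0..t}"
proof -
  obtain l C where l: "l \<in> borel_measurable borel" "0 \<le> C" "\<And>\<xi>. \<bar>l \<xi>\<bar> \<le> C"
    "\<And>\<tau>. 0 \<le> \<tau> \<Longrightarrow> \<tau> \<le> t \<Longrightarrow> w \<tau> = w 0 + RL \<alpha> 0 l \<tau>"
    by (rule AC_borel_density[OF w]) (use t in simp, rule that)
  define y where "y = restrict (\<lambda>\<tau>. w 0 + RL \<alpha> 0 l \<tau>) {0..T}"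
  show thesis
  proof
    show "y \<in> AC \<alpha> T T"
      by (rule AC_I[OF l(1,3), where ?x0.0="w 0"]) (use T0 in \<open>auto simp: y_def restrict_extensional\<close>)
    show "w = restrict y {0..t}"
    proof (rule extensionalityI[of _ "{0..t}"])
      show "w \<in> extensional {0..t}" using w unfolding AC_def by blast
      fix \<tau> assume "\<tau> \<in> {0..t}"
      then show "w \<tau> = restrict y {0..t} \<tau>" using l(4)[of \<tau>] t by (simp add: y_def)
    qed simp
  qed
qed

end

theorem theorem3p1:
  fixes T \<alpha> :: real and f ft fx :: "real \<Rightarrow> real \<Rightarrow> real"
  assumes "T > 0" and "0 < \<alpha>" and "\<alpha> < 1"
    and "C1_with_partials T f ft fx"
    and "\<exists>\<gamma>\<ge>0. \<forall>\<tau>\<in>{0..T}. \<forall>x. \<bar>f \<tau> x\<bar> \<le> \<gamma> * (1 + \<bar>x\<bar>)"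
  shows "\<forall>(t, w)\<in>initial_data \<alpha> T.
    let x = the_solution \<alpha> T f t w;
        pbar = (\<lambda>\<tau>. - ((1 - \<alpha>) / Gamma \<alpha>) * ((T - \<tau>) / (T - t)) *
                 (LINT \<xi>:{0..t}|lebesgue. caputo_deriv \<alpha> w \<xi> / (\<tau> - \<xi>) powr (2 - \<alpha>)));
        qbar = (\<lambda>\<tau>. 1 / (Gamma \<alpha> * (\<tau> - t) powr (1 - \<alpha>)));
        a = (\<lambda>\<tau>. fx \<tau> (x \<tau>));
        b = (\<lambda>\<tau>. ((T - \<tau>) / (T - t)) * ft \<tau> (x \<tau>) - \<alpha> * f \<tau> (x \<tau>) / (T - t));
        p_eq = integral_eq_solution \<alpha> t T pbar (\<lambda>\<xi> y. a \<xi> * y + b \<xi>);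
        q_eq = integral_eq_solution \<alpha> t T qbar (\<lambda>\<xi> y. a \<xi> * y)
    in ci_differentiable \<alpha> T (rho \<alpha> T f) t w \<and>
       (\<exists>!p. p_eq p) \<and> (\<exists>!q. q_eq q) \<and>
       (\<forall>p q. p_eq p \<and> q_eq q \<longrightarrow> has_ci_derivatives \<alpha> T (rho \<alpha> T f) t w (p T) (q T))"
proof -
  obtain \<gamma> where \<gamma>: "0 \<le> \<gamma>" "\<forall>\<tau>\<in>{0..T}. \<forall>x. \<bar>f \<tau> x\<bar> \<le> \<gamma> * (1 + \<bar>x\<bar>)" using assms(5) by blast
  interpret smooth_rhs T \<alpha> \<gamma> f ft fx by unfold_locales (use assms(1-4) \<gamma> in auto)
  have main: "ci_differentiable \<alpha> T (rho \<alpha> T f) t w \<and> (\<exists>!p. p_eq t w p) \<and> (\<exists>!q. q_eq t w q) \<and>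
      (\<forall>p q. p_eq t w p \<and> q_eq t w q \<longrightarrow> has_ci_derivatives \<alpha> T (rho \<alpha> T f) t w (p T) (q T))"
    if t: "0 \<le> t" "t < T" and w: "w \<in> AC \<alpha> T t" for t w
  proof -
    obtain y where y: "y \<in> AC \<alpha> T T" "w = restrict y {0..t}" by (rule AC_extend[OF t w])
    note ex = extension_expansion(1,2)[OF t y]
    have ci: "has_ci_derivatives \<alpha> T (rho \<alpha> T f) t w (p T) (q T)" if pq: "p_eq t w p" "q_eq t w q" for p q
      unfolding has_ci_derivatives_def extensions_def
    proof (intro ballI)
      fix y' assume "y' \<in> {y \<in> AC \<alpha> T T. restrict y {0..t} = w}"
      then have "y' \<in> AC \<alpha> T T" "w = restrict y' {0..t}" by auto
      from extension_expansion(3)[OF t this pq]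
      show "\<exists>r. ((\<lambda>\<delta>. r \<delta> / \<delta>) \<longlongrightarrow> 0) (at_right 0) \<and>
        (\<forall>\<tau>\<in>{t<..<T}. rho \<alpha> T f (\<tau>, restrict y' {0..\<tau>}) - rho \<alpha> T f (t, w) =
          p T * (\<tau> - t) + q T * (LINT \<xi>:{t..\<tau>}|lebesgue. caputo_deriv \<alpha> y' \<xi>) + r (\<tau> - t))" .
    qed
    have "ci_differentiable \<alpha> T (rho \<alpha> T f) t w"
      unfolding ci_differentiable_def using ex ci by blast
    then show ?thesis using ex ci by blast
  qed
  show ?thesis
    using main unfolding initial_data_def p_eq_def q_eq_def Let_def by auto
qed

end
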